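(* Let $0\le\delta<\rho\le1$, $\mu\in\mathbb{R}$, and let $\sigma_\hbar\in S^\mu_{\rho,\delta}(\hbar\mathbb{Z}^n\times\mathbb{T}^n)$. Then there exists a symbol $\sigma_\hbar^t\in S^\mu_{\rho,\delta}(\hbar\mathbb{Z}^n\times\mathbb{T}^n)$ such that the transpose operator $\mathrm{Op}_\hbar(\sigma_\hbar)^t$ is the semi-classical pseudo-differential operator with symbol $\sigma_\hbar^t$, i.e. $\mathrm{Op}_\hbar(\sigma_\hbar)^t=\mathrm{Op}_\hbar(\sigma_\hbar^t)$. The symbol $\sigma_\hbar^t$ has the asymptotic expansion $$\sigma_\hbar^t(k,\theta)\sim\sum_\alpha\frac1{\alpha!}\Delta^\alpha_{\hbar,k}D^{(\alpha)}_{\hbar,\theta}\big[\sigma_\hbar(k,-\theta)\big].$$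
   Context: Fix $n\ge1$ and $\hbar\in(0,1]$. $\hbar\mathbb{Z}^n=\{\hbar\bar k:\bar k\in\mathbb{Z}^n\}\subset\mathbb{R}^n$, $|k|$ is the Euclidean norm, $\mathbb{T}^n=\mathbb{R}^n/\mathbb{Z}^n$ with normalized Haar measure, $k\cdot\theta=\sum_jk_j\theta_j$, $\mathbb{N}_0=\{0,1,2,\dots\}$. Semi-classical Fourier transform: $\widehat f(\theta)=\sum_{k\in\hbar\mathbb{Z}^n}e^{-2\pi\frac{i}{\hbar}k\cdot\theta}f(k)$. $\mathcal{S}(\hbar\mathbb{Z}^n)$ is the space of $\varphi:\hbar\mathbb{Z}^n\to\mathbb{C}$ with $\sup_k(1+|k|)^N|\varphi(k)|<\infty$ for all $N$. Difference operators: with $v_j$ the $j$-th standard unit vector, $\Delta_{\hbar,j}g(k)=\frac{g(k+\hbar v_j)-g(k)}{\hbar}$ and $\Delta_\hbar^\alpha=\Delta_{\hbar,1}^{\alpha_1}\cdots\Delta_{\hbar,n}^{\alpha_n}$ (written $\Delta^\alpha_{\hbar,k}$ when acting in $k$). Toroidal operators: $D_{\hbar,\theta}^{(\beta)}=\hbar^{|\beta|}\prod_{j=1}^n\prod_{\ell=0}^{\beta_j-1}\big(\frac{1}{2\pi i}\frac{\partial}{\partial\theta_j}-\ell\big)$; in the expansion $D^{(\alpha)}_{\hbar,\theta}$ is applied to the function $\theta\mapsto\sigma_\hbar(k,-\theta)$. Symbol class: $\sigma_\hbar:\hbar\mathbb{Z}^n\times\mathbb{T}^n\to\mathbb{C}$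 belongs to $S^\mu_{\rho,\delta}(\hbar\mathbb{Z}^n\times\mathbb{T}^n)$ if $\sigma_\hbar(k,\cdot)\in C^\infty(\mathbb{T}^n)$ for all $k$ and for all $\alpha,\beta\in\mathbb{N}_0^n$ there is $C_{\alpha,\beta}>0$ with $|D^{(\beta)}_{\hbar,\theta}\Delta^\alpha_{\hbar,k}\sigma_\hbar(k,\theta)|\le C_{\alpha,\beta}(1+|k|)^{\mu-\rho|\alpha|+\delta|\beta|}$ for all $(k,\theta)$. Quantization: $\mathrm{Op}_\hbar(\sigma_\hbar)f(k)=\int_{\mathbb{T}^n}e^{2\pi\frac{i}{\hbar}k\cdot\theta}\sigma_\hbar(k,\theta)\widehat f(\theta)\,d\theta$. The transpose $T^t$ of a linear operator $T$ is defined by $\sum_{k\in\hbar\mathbb{Z}^n}(T^tf)(k)g(k)=\sum_{k\in\hbar\mathbb{Z}^n}f(k)(Tg)(k)$ for $f,g\in\mathcal{S}(\hbar\mathbb{Z}^n)$. The asymptotic expansion means: for every $N\in\mathbb{N}$, $\sigma^t_\hbar(k,\theta)-\sum_{|\alpha|<N}\frac1{\alpha!}\Delta^\alpha_{\hbar,k}D^{(\alpha)}_{\hbar,\theta}[\sigma_\hbar(k,-\theta)]\in S^{\mu-N(\rho-\delta)}_{\rho,\delta}(\hbar\mathbb{Z}^n\times\mathbb{T}^n)$. *)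

theory Defs
  imports "HOL-Analysis.Analysis"
begin

text \<open>
  The parameter \<open>h\<close> is the semi-classical parameter. Functions on the lattice are functions on
  \<open>real ^ 'n\<close> of which only the values at lattice points matter, and functions on the torus are
  functions on \<open>real ^ 'n\<close> that are 1-periodic in each coordinate.
\<close>

definition hlattice :: "real \<Rightarrow> (real ^ 'n) set" where
  "hlattice h = {h *\<^sub>R k | k. \<forall>j. k $ j \<in> \<int>}"

definition schwartz :: "real \<Rightarrow> (real ^ 'n \<Rightarrow> complex) set" where
  "schwartz h = {f. \<forall>N::nat. bdd_above ((\<lambda>k. (1 + norm k) ^ N * cmod (f k)) ` hlattice h)}"


subsection \<open>Multi-indices\<close>

definition mi_size :: "('n::finite \<Rightarrow> nat) \<Rightarrow> nat" where
  "mi_size \<alpha> = (\<Sum>j\<in>UNIV. \<alpha> j)"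

definition mi_fact :: "('n::finite \<Rightarrow> nat) \<Rightarrow> nat" where
  "mi_fact \<alpha> = (\<Prod>j\<in>UNIV. fact (\<alpha> j))"

lemma finite_mi_size_less: "finite {\<alpha> :: 'n::finite \<Rightarrow> nat. mi_size \<alpha> < N}"
proof (rule finite_subset)
  show "{\<alpha> :: 'n \<Rightarrow> nat. mi_size \<alpha> < N} \<subseteq> PiE UNIV (\<lambda>_. {..<N})"
  proof
    fix \<alpha> :: "'n \<Rightarrow> nat" assume "\<alpha> \<in> {\<alpha>. mi_size \<alpha> < N}"
    moreover have "\<alpha> j \<le> mi_size \<alpha>" for j
      unfolding mi_size_def by (rule member_le_sum) auto
    ultimately show "\<alpha> \<in> PiE UNIV (\<lambda>_. {..<N})"
      by (auto intro: le_less_trans)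
  qed
qed (auto intro: finite_PiE)

text \<open>
  An enumeration of the coordinates, fixing the order in which the operators of a multi-index
  product are composed. The difference operators commute, and so do the partial derivatives of
  smooth functions, so the order chosen is immaterial.
\<close>

definition coords :: "'n::finite list" where
  "coords = (SOME js. distinct js \<and> set js = UNIV)"

lemma coords: "distinct (coords :: 'n::finite list)" "set (coords :: 'n list) = UNIV"
proof -
  have "\<exists>js :: 'n list. distinct js \<and> set js = UNIV"
    using finite_distinct_list[of "UNIV :: 'n set"] by auto
  then have "distinct (coords :: 'n list) \<and> set (coords :: 'n list) = UNIV"
    unfolding coords_def by (rule someI_ex)
  then show "distinct (coords :: 'n list)" "set (coords :: 'n list) = UNIV" by auto
qed


subsection \<open>Difference operators and toroidal differential operators\<close>

definition diff1 :: "real \<Rightarrow> 'n \<Rightarrow> (real ^ 'n \<Rightarrow> complex) \<Rightarrow> real ^ 'n \<Rightarrow> complex" where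
  "diff1 h j g k = (g (k + h *\<^sub>R axis j 1) - g k) / of_real h"

definition diff_op ::
    "real \<Rightarrow> ('n::finite \<Rightarrow> nat) \<Rightarrow> (real ^ 'n \<Rightarrow> complex) \<Rightarrow> real ^ 'n \<Rightarrow> complex" where
  "diff_op h \<alpha> = foldr (\<lambda>j. diff1 h j ^^ \<alpha> j) coords"

definition partial :: "'n \<Rightarrow> (real ^ 'n \<Rightarrow> complex) \<Rightarrow> real ^ 'n \<Rightarrow> complex" where
  "partial j f \<theta> = vector_derivative (\<lambda>t. f (\<theta> + t *\<^sub>R axis j 1)) (at 0)"

definition tor_factor ::
    "'n \<Rightarrow> nat \<Rightarrow> (real ^ 'n \<Rightarrow> complex) \<Rightarrow> real ^ 'n \<Rightarrow> complex" where
  "tor_factor j l f \<theta> = 1 / (2 * of_real pi * \<i>) * partial j f \<theta> - of_nat l * f \<theta>"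

definition tor_op ::
    "real \<Rightarrow> ('n::finite \<Rightarrow> nat) \<Rightarrow> (real ^ 'n \<Rightarrow> complex) \<Rightarrow> real ^ 'n \<Rightarrow> complex" where
  "tor_op h \<beta> f \<theta> =
     of_real (h ^ mi_size \<beta>) * foldr (\<lambda>j. foldr (tor_factor j) [0..<\<beta> j]) coords f \<theta>"


subsection \<open>Symbol classes and quantization\<close>

fun C_times :: "nat \<Rightarrow> (real ^ 'n \<Rightarrow> complex) \<Rightarrow> bool" where
  "C_times 0 f \<longleftrightarrow> continuous_on UNIV f"
| "C_times (Suc m) f \<longleftrightarrow> f differentiable_on UNIV \<and> (\<forall>j. C_times m (partial j f))"

definition smooth_torus :: "(real ^ 'n \<Rightarrow> complex) \<Rightarrow> bool" where
  "smooth_torus f \<longleftrightarrow> (\<forall>\<theta> j. f (\<theta> + axis j 1) = f \<theta>) \<and> (\<forall>m. C_times m f)"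

definition symbol_class ::
    "real \<Rightarrow> real \<Rightarrow> real \<Rightarrow> real \<Rightarrow> (real ^ 'n::finite \<Rightarrow> real ^ 'n \<Rightarrow> complex) set" where
  "symbol_class h \<mu> \<rho> \<delta> = {\<sigma>.
     (\<forall>k\<in>hlattice h. smooth_torus (\<sigma> k)) \<and>
     (\<forall>\<alpha> \<beta>. \<exists>C>0. \<forall>k\<in>hlattice h. \<forall>\<theta>.
        cmod (tor_op h \<beta> (\<lambda>\<eta>. diff_op h \<alpha> (\<lambda>l. \<sigma> l \<eta>) k) \<theta>)
          \<le> C * (1 + norm k) powr (\<mu> - \<rho> * real (mi_size \<alpha>) + \<delta> * real (mi_size \<beta>)))}"

definition semi_fourier :: "real \<Rightarrow> (real ^ 'n \<Rightarrow> complex) \<Rightarrow> real ^ 'n \<Rightarrow> complex" where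
  "semi_fourier h f \<theta> =
     (\<Sum>\<^sub>\<infinity>k\<in>hlattice h. exp (- 2 * of_real pi * (\<i> / of_real h) * of_real (k \<bullet> \<theta>)) * f k)"

text \<open>
  Integration over the torus with respect to normalized Haar measure is Lebesgue integration
  over the unit cube.
\<close>

definition semi_Op ::
    "real \<Rightarrow> (real ^ 'n \<Rightarrow> real ^ 'n \<Rightarrow> complex) \<Rightarrow>
     (real ^ 'n \<Rightarrow> complex) \<Rightarrow> real ^ 'n \<Rightarrow> complex" where
  "semi_Op h \<sigma> f k =
     (LINT \<theta>:cbox 0 (\<chi> j. 1)|lborel.
        exp (2 * of_real pi * (\<i> / of_real h) * of_real (k \<bullet> \<theta>)) * \<sigma> k \<theta> * semi_fourier h f \<theta>)"


subsection \<open>Transpose of an operator\<close>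

text \<open>
  \<open>is_transpose h T T'\<close> says that \<open>T'\<close> is the transpose of \<open>T\<close>. Convergence of both sums is
  required explicitly, since a divergent \<open>infsum\<close> has the value 0. By the lemma below, the
  condition determines \<open>T'\<close> as an operator from Schwartz functions to functions on the lattice.
\<close>

definition is_transpose ::
    "real \<Rightarrow> ((real ^ 'n \<Rightarrow> complex) \<Rightarrow> real ^ 'n \<Rightarrow> complex) \<Rightarrow>
     ((real ^ 'n \<Rightarrow> complex) \<Rightarrow> real ^ 'n \<Rightarrow> complex) \<Rightarrow> bool" where
  "is_transpose h T T' \<longleftrightarrow>
     (\<forall>f\<in>schwartz h. \<forall>g\<in>schwartz h.
        (\<lambda>k. T' f k * g k) summable_on hlattice h \<and>
        (\<lambda>k. f k * T g k) summable_on hlattice h \<and>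
        (\<Sum>\<^sub>\<infinity>k\<in>hlattice h. T' f k * g k) = (\<Sum>\<^sub>\<infinity>k\<in>hlattice h. f k * T g k))"

lemma is_transpose_unique:
  fixes f :: "real ^ 'n \<Rightarrow> complex"
  assumes "is_transpose h T T1" "is_transpose h T T2" "f \<in> schwartz h" "k \<in> hlattice h"
  shows "T1 f k = T2 f k"
proof -
  define g :: "real ^ 'n \<Rightarrow> complex" where "g = (\<lambda>l. if l = k then 1 else 0)"
  have g: "g \<in> schwartz h"
    unfolding schwartz_def g_def
    by (auto intro!: bdd_aboveI[where M = "(1 + norm k) ^ _"])
  have "(\<Sum>\<^sub>\<infinity>l\<in>hlattice h. F l * g l) = F k" for F :: "real ^ 'n \<Rightarrow> complex"
  proof -
    have "(\<Sum>\<^sub>\<infinity>l\<in>hlattice h. F l * g l) = (\<Sum>\<^sub>\<infinity>l\<in>{k}. F l * g l)"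
      by (rule infsum_cong_neutral) (use assms(4) in \<open>auto simp: g_def\<close>)
    then show ?thesis by (simp add: g_def)
  qed
  then show ?thesis using assms g unfolding is_transpose_def by metis
qed

end

theory Submission imports Defs begin

text \<open>
  Write \<open>c y p\<close> for the \<open>p\<close>-th Fourier coefficient of \<open>\<sigma> (h y)\<close>. The operator with symbol
  \<open>\<sigma>\<close> has the matrix \<open>(x, m) \<mapsto> c x (m - x)\<close>, so its transpose has the symbol with Fourier
  coefficients \<open>a (x + p) p\<close>, where \<open>a y p = c y (- p)\<close> are the coefficients of
  \<open>\<theta> \<mapsto> \<sigma> (h y) (- \<theta>)\<close>. The asymptotic expansion is the discrete Taylor expansion of
  \<open>a (x + p) p\<close> in the shift \<open>p\<close>, since the falling factorials of \<open>p\<close> are the Fourier multipliers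
  of the toroidal operators.

  Estimating a remainder by the sum of the moduli of its Fourier coefficients loses a power of
  \<open>1 + \<bar>k\<bar>\<close>. This is harmless: the remainder of a sufficiently late order \<open>N'\<close> beats any such loss, as
  \<open>\<delta> < \<rho>\<close>, and it differs from the remainder of order \<open>N\<close> by finitely many terms which satisfy
  the symbol estimates of order \<open>\<mu> - N (\<rho> - \<delta>)\<close>.
\<close>

section \<open>Fourier series on the torus\<close>

text \<open>The symbol class bounds suprema in \<open>\<theta>\<close>, and for toroidal operators
  only. Two features of the transpose do not fit this. Reflecting \<open>\<theta>\<close> turns the
  falling factorial of \<open>p\<close> into that of \<open>- p\<close>, a different polynomial, so
  bounds for arbitrary polynomial multipliers are wanted. And in \<open>a (x + p) p\<close> the
  lattice point moves with the frequency, so the remainder is not a multiplier applied to a symbol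
  at one lattice point; it has to be estimated one coefficient at a time. A single coefficient is
  bounded by a supremum, and \<open>M\<close> powers of decay in \<open>p\<close> cost a factor
  \<open>(1 + \<bar>k\<bar>) powr (\<delta> * M)\<close>; the shift, by Peetre's inequality, costs
  powers of \<open>p\<close> again. The gain of \<open>\<rho>\<close> for each difference outweighs
  these losses. The transposed symbol is the remainder of order 0, so one estimate of remainders
  yields both its symbol class and the expansion. As \<open>h\<close> is fixed, its powers may enter
  all constants. Smooth symbols are brought into coefficient form by Fourier inversion, which rests
  on the Stone-Weierstrass theorem and the compactness of the torus.\<close>

definition emb :: "int ^ 'n \<Rightarrow> real ^ 'n" where
  "emb p = (\<chi> j. of_int (p $ j))"

text \<open>Valued in \<open>nat\<close>, since it is the length of a lattice path to the origin and
  serves as an induction measure.\<close>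

definition l1 :: "int ^ 'n::finite \<Rightarrow> nat" where
  "l1 p = (\<Sum>j\<in>UNIV. nat \<bar>p $ j\<bar>)"

definition weight :: "int ^ 'n::finite \<Rightarrow> real" where
  "weight p = 1 + real (l1 p)"

definition chi :: "int ^ 'n::finite \<Rightarrow> real ^ 'n \<Rightarrow> complex" where
  "chi p \<theta> = cis (2 * pi * (emb p \<bullet> \<theta>))"

definition fourier_series :: "(int ^ 'n::finite \<Rightarrow> complex) \<Rightarrow> real ^ 'n \<Rightarrow> complex" where
  "fourier_series a \<theta> = (\<Sum>\<^sub>\<infinity>p. a p * chi p \<theta>)"

definition rapid :: "(int ^ 'n::finite \<Rightarrow> complex) \<Rightarrow> bool" where
  "rapid a \<longleftrightarrow> (\<forall>M::nat. \<exists>C. \<forall>p. cmod (a p) * weight p ^ M \<le> C)"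

lemma emb_nth [simp]: "emb p $ j = of_int (p $ j)"
  by (simp add: emb_def)

lemma emb_add: "emb (p + q) = emb p + emb q"
  by (simp add: vec_eq_iff)

lemma emb_minus: "emb (- p) = - emb p"
  by (simp add: vec_eq_iff)

lemma emb_0 [simp]: "emb 0 = 0"
  by (simp add: vec_eq_iff)

lemma emb_axis: "emb (axis j 1) = axis j 1"
  by (simp add: vec_eq_iff axis_def)

lemma inj_emb: "inj emb"
  by (rule injI) (simp add: vec_eq_iff)

lemma norm_emb_le: "norm (emb p) \<le> real (l1 p)"
proof -
  have "norm (emb p) \<le> (\<Sum>j\<in>UNIV. \<bar>emb p $ j\<bar>)" by (rule norm_le_l1_cart)
  also have "\<dots> = real (l1 p)" by (simp add: l1_def)
  finally show ?thesis .
qed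

lemma l1_minus [simp]: "l1 (- p) = l1 p"
  by (simp add: l1_def)

lemma l1_eq_0: "l1 p = 0 \<longleftrightarrow> p = 0"
  by (auto simp: l1_def vec_eq_iff)

lemma abs_nth_le_l1: "\<bar>p $ j\<bar> \<le> int (l1 p)"
proof -
  have "nat \<bar>p $ j\<bar> \<le> l1 p" unfolding l1_def by (rule member_le_sum) auto
  then show ?thesis by linarith
qed

lemma weight_ge_1: "1 \<le> weight p"
  by (simp add: weight_def)

lemma weight_pos [simp]: "0 < weight p"
  by (simp add: weight_def add_pos_nonneg)

lemma weight_nonneg [simp]: "0 \<le> weight p"
  using weight_pos[of p] by linarith

lemma weight_nonzero [simp]: "weight p \<noteq> 0"
  using weight_pos[of p] by linarith

lemma weight_minus [simp]: "weight (- p) = weight p"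
  by (simp add: weight_def)

lemma abs_nth_le_weight: "\<bar>of_int (p $ j)\<bar> \<le> weight p"
  using abs_nth_le_l1[of p j] unfolding weight_def by linarith

lemma norm_emb_le_weight: "norm (emb p) \<le> weight p"
  using norm_emb_le[of p] by (simp add: weight_def)

lemma norm_chi [simp]: "cmod (chi p \<theta>) = 1"
  by (simp add: chi_def)

lemma chi_mult: "chi p \<theta> * chi q \<theta> = chi (p + q) \<theta>"
  by (simp add: chi_def cis_mult emb_add inner_add_left algebra_simps)

lemma chi_0 [simp]: "chi 0 \<theta> = 1"
  by (simp add: chi_def)

lemma chi_uminus: "chi p (- \<theta>) = chi (- p) \<theta>"
  by (simp add: chi_def emb_minus)

lemma chi_add: "chi p (\<theta> + \<eta>) = chi p \<theta> * chi p \<eta>"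
  by (simp add: chi_def inner_add_right cis_mult algebra_simps)

lemma chi_axis [simp]: "chi p (axis j 1) = 1"
  by (simp add: chi_def inner_axis cis_multiple_2pi)

lemma continuous_chi [continuous_intros]: "continuous_on S (chi p)"
  unfolding chi_def by (intro continuous_intros)

subsection \<open>Summability\<close>

lemma summable_inverse_square_int: "(\<lambda>i::int. 1 / (1 + real_of_int i ^ 2)) summable_on UNIV"
proof -
  have *: "(\<lambda>i::nat. 1 / (1 + real i ^ 2)) summable_on UNIV"
  proof (rule summable_on_comparison_test)
    have "summable (\<lambda>n. inverse (real (Suc n) ^ 2))"
      using inverse_power_summable[of 2, where 'a = real] by (subst summable_Suc_iff) auto
    then have "summable (\<lambda>n. 2 * inverse (real (Suc n) ^ 2))" by (rule summable_mult)
    then show "(\<lambda>n. 2 * inverse (real (Suc n) ^ 2)) summable_on UNIV"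
      by (intro norm_summable_imp_summable_on) auto
    show "1 / (1 + real i ^ 2) \<le> 2 * inverse (real (Suc i) ^ 2)" for i
    proof -
      have "0 \<le> (1 - real i) ^ 2" by simp
      then have "(real (Suc i)) ^ 2 \<le> 2 * (1 + real i ^ 2)"
        by (simp add: power2_eq_square algebra_simps)
      then show ?thesis by (simp add: field_simps add_pos_nonneg)
    qed
  qed auto
  have "(\<lambda>i::int. 1 / (1 + real_of_int i ^ 2)) summable_on (range int \<union> range (\<lambda>n. - int n))"
  proof (rule summable_on_union)
    show "(\<lambda>i::int. 1 / (1 + real_of_int i ^ 2)) summable_on range int"
      using * by (subst summable_on_reindex) (auto simp: o_def)
    show "(\<lambda>i::int. 1 / (1 + real_of_int i ^ 2)) summable_on range (\<lambda>n. - int n)"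
      using * by (subst summable_on_reindex) (auto simp: o_def inj_on_def)
  qed
  moreover have "range int \<union> range (\<lambda>n. - int n) = UNIV"
  proof -
    have "i \<in> range int \<union> range (\<lambda>n. - int n)" for i
      by (cases i rule: int_cases2) auto
    then show ?thesis by blast
  qed
  ultimately show ?thesis by simp
qed

text \<open>Two powers for each coordinate: \<open>weight p ^ 2\<close> dominates every
  \<open>1 + (p $ j) ^ 2\<close>, so the summand is at most a product of convergent one-dimensional
  series.\<close>

lemma summable_weight:
  "(\<lambda>p::int ^ 'n::finite. 1 / weight p ^ (2 * CARD('n))) summable_on UNIV"
proof (rule nonneg_bdd_above_summable_on)
  define f :: "int \<Rightarrow> real" where "f i = 1 / (1 + real_of_int i ^ 2)" for i
  have f0: "0 \<le> f i" for i by (simp add: f_def)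
  have fs: "f summable_on UNIV"
    using summable_inverse_square_int unfolding f_def by simp
  have le: "1 / weight p ^ (2 * CARD('n)) \<le> (\<Prod>j\<in>UNIV. f (p $ j))" for p :: "int ^ 'n"
  proof -
    have "(\<Prod>j\<in>(UNIV::'n set). 1 / weight p ^ 2) \<le> (\<Prod>j\<in>UNIV. f (p $ j))"
    proof (intro prod_mono conjI)
      fix j
      have 0: "0 < 1 + real_of_int (p $ j) ^ 2" by (simp add: add_pos_nonneg)
      have "1 + real_of_int (p $ j) ^ 2 \<le> (1 + \<bar>real_of_int (p $ j)\<bar>) ^ 2"
        by (simp add: power2_eq_square algebra_simps)
      also have "\<dots> \<le> weight p ^ 2"
        using abs_nth_le_l1[of p j] by (intro power_mono) (auto simp: weight_def)
      finally show "1 / weight p ^ 2 \<le> f (p $ j)"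
        unfolding f_def using 0 by (intro divide_left_mono mult_pos_pos) auto
    qed auto
    then show ?thesis by (simp add: power_mult power_divide)
  qed
  show "bdd_above (sum (\<lambda>p::int ^ 'n. 1 / weight p ^ (2 * CARD('n))) ` {F. F \<subseteq> UNIV \<and> finite F})"
  proof (rule bdd_aboveI2)
    fix F :: "(int ^ 'n) set" assume "F \<in> {F. F \<subseteq> UNIV \<and> finite F}"
    then have F: "finite F" by simp
    \<comment> \<open>\<open>F\<close> lies in the box spanned by its coordinate projections, and
      over a box the sum of products factors.\<close>
    define B where "B = (\<lambda>j. (\<lambda>p. p $ j) ` F)"
    have "(\<Sum>p\<in>F. 1 / weight p ^ (2 * CARD('n))) \<le> (\<Sum>p\<in>F. \<Prod>j\<in>UNIV. f (p $ j))"
      by (intro sum_mono le)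
    also have "\<dots> = (\<Sum>g\<in>(\<lambda>p j. p $ j) ` F. \<Prod>j\<in>UNIV. f (g j))"
      by (subst sum.reindex) (auto simp: inj_on_def vec_eq_iff fun_eq_iff)
    also have "\<dots> \<le> (\<Sum>g\<in>PiE UNIV B. \<Prod>j\<in>UNIV. f (g j))"
      using F by (intro sum_mono2 finite_PiE) (auto simp: B_def f0 intro!: prod_nonneg)
    also have "\<dots> = (\<Prod>j\<in>UNIV. \<Sum>i\<in>B j. f i)"
      using F by (intro prod_sum_PiE[symmetric]) (auto simp: B_def)
    also have "\<dots> \<le> (\<Prod>j\<in>(UNIV::'n set). \<Sum>\<^sub>\<infinity>i. f i)"
      using F f0 by (intro prod_mono conjI sum_nonneg finite_sum_le_infsum fs) (auto simp: B_def)
    finally show "(\<Sum>p\<in>F. 1 / weight p ^ (2 * CARD('n))) \<le> (\<Prod>j\<in>(UNIV::'n set). \<Sum>\<^sub>\<infinity>i. f i)" .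
  qed
qed auto

section \<open>Rapidly decreasing sequences\<close>

lemma rapidE:
  assumes "rapid a"
  obtains C where "C > 0" "\<And>p. cmod (a p) \<le> C / weight p ^ M"
proof -
  obtain C where C: "\<And>p. cmod (a p) * weight p ^ M \<le> C"
    using assms unfolding rapid_def by blast
  have "cmod (a p) \<le> max C 1 / weight p ^ M" for p
    using C[of p] by (simp add: field_simps le_max_iff_disj)
  then show ?thesis using that[of "max C 1"] by simp
qed

lemma rapidI:
  assumes "\<And>M::nat. \<exists>C. \<forall>p. cmod (a p) * weight p ^ M \<le> C"
  shows "rapid a"
  using assms unfolding rapid_def by blast

lemma weight_summable_bound:
  assumes "\<And>p. cmod (a p) \<le> C / weight p ^ (2 * CARD('n))"
  shows "(\<lambda>p::int ^ 'n::finite. cmod (a p)) summable_on UNIV"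
proof (rule Infinite_Sum.abs_summable_on_comparison_test')
  show "(\<lambda>p::int ^ 'n. C * (1 / weight p ^ (2 * CARD('n)))) summable_on UNIV"
    by (intro summable_on_cmult_right summable_weight)
qed (use assms in auto)

lemma rapid_abs_summable:
  fixes a :: "int ^ 'n::finite \<Rightarrow> complex"
  assumes "rapid a"
  shows "(\<lambda>p. cmod (a p)) summable_on UNIV"
proof -
  obtain C where "\<And>p. cmod (a p) \<le> C / weight p ^ (2 * CARD('n))"
    using rapidE[OF assms, where M = "2 * CARD('n)"] by blast
  then show ?thesis by (rule weight_summable_bound)
qed

lemma rapid_cmult: "rapid a \<Longrightarrow> rapid (\<lambda>p. c * a p)"
proof (rule rapidI)
  fix M assume a: "rapid a"
  obtain C where C: "C > 0" "\<And>p. cmod (a p) \<le> C / weight p ^ M"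
    using rapidE[OF a, where M = M] by blast
  then have "cmod (a p) * weight p ^ M \<le> C" for p
    by (simp add: pos_le_divide_eq)
  then have "cmod c * (cmod (a p) * weight p ^ M) \<le> cmod c * C" for p
    by (intro mult_left_mono) auto
  then show "\<exists>C. \<forall>p. cmod (c * a p) * weight p ^ M \<le> C"
    by (auto simp: norm_mult mult.assoc)
qed

lemma rapid_add: "rapid a \<Longrightarrow> rapid b \<Longrightarrow> rapid (\<lambda>p. a p + b p)"
proof (rule rapidI)
  fix M assume "rapid a" "rapid b"
  then obtain C D where C: "\<And>p. cmod (a p) * weight p ^ M \<le> C" and D: "\<And>p. cmod (b p) * weight p ^ M \<le> D"
    unfolding rapid_def by meson
  have "cmod (a p + b p) * weight p ^ M \<le> C + D" for p
  proof -
    have "cmod (a p + b p) * weight p ^ M \<le> (cmod (a p) + cmod (b p)) * weight p ^ M"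
      by (intro mult_right_mono norm_triangle_ineq) auto
    then show ?thesis using C[of p] D[of p] by (simp add: distrib_right)
  qed
  then show "\<exists>C. \<forall>p. cmod (a p + b p) * weight p ^ M \<le> C" by blast
qed

lemma rapid_0 [simp]: "rapid (\<lambda>p. 0)"
  by (auto simp: rapid_def)

lemma rapid_sum: "(\<And>i. i \<in> I \<Longrightarrow> rapid (a i)) \<Longrightarrow> rapid (\<lambda>p. \<Sum>i\<in>I. a i p)"
  by (induction I rule: infinite_finite_induct) (simp_all add: rapid_add)

lemma rapid_diff: "rapid a \<Longrightarrow> rapid b \<Longrightarrow> rapid (\<lambda>p. a p - b p)"
  using rapid_add[of a "\<lambda>p. (-1) * b p"] rapid_cmult[of b "-1"] by simp

lemma rapid_reflect: "rapid a \<Longrightarrow> rapid (\<lambda>p. a (- p))"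
proof (rule rapidI)
  fix M assume "rapid a"
  then obtain C where "cmod (a p) * weight p ^ M \<le> C" for p
    unfolding rapid_def by blast
  from this[of "- p" for p] show "\<exists>C. \<forall>p. cmod (a (- p)) * weight p ^ M \<le> C" by auto
qed

text \<open>Asking \<open>a\<close> for \<open>m + M\<close> powers of decay leaves \<open>M\<close>
  powers after the multiplication.\<close>

lemma rapid_mult_growth:
  assumes a: "rapid a" and q: "\<And>p. cmod (q p) \<le> D * weight p ^ m"
  shows "rapid (\<lambda>p. q p * a p)"
proof (rule rapidI)
  fix M
  obtain C where C: "C > 0" "\<And>p. cmod (a p) \<le> C / weight p ^ (m + M)" 
    using rapidE[OF a, where M = "m + M"] by blast
  have "cmod (q p * a p) * weight p ^ M \<le> D * C" for p
  proof -
    have "cmod (q p) * cmod (a p) * weight p ^ M \<le> (D * weight p ^ m) * (C / weight p ^ (m + M)) * weight p ^ M"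
      by (intro mult_mono q C mult_nonneg_nonneg order_trans[OF norm_ge_zero q]
          order_trans[OF norm_ge_zero C(2)]) auto
    also have "\<dots> = D * C" by (simp add: power_add)
    finally show ?thesis by (simp add: norm_mult)
  qed
  then show "\<exists>C. \<forall>p. cmod (q p * a p) * weight p ^ M \<le> C" by blast
qed

lemma rapid_coord: "rapid a \<Longrightarrow> rapid (\<lambda>p. of_int (p $ j) * a p)"
  by (rule rapid_mult_growth[where D = 1 and m = 1]) (auto simp: abs_nth_le_weight)

section \<open>Linear operations on Fourier series\<close>

lemma has_sum_diff:
  fixes f g :: "'a \<Rightarrow> complex"
  assumes "(f has_sum a) A" "(g has_sum b) A"
  shows "((\<lambda>x. f x - g x) has_sum (a - b)) A"
  using has_sum_add[OF assms(1), of "\<lambda>x. - g x" "- b"] assms(2) by (simp add: has_sum_uminus)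

lemma fourier_series_abs_summable:
  assumes "(\<lambda>p. cmod (a p)) summable_on UNIV"
  shows "(\<lambda>p. cmod (a p * chi p \<theta>)) summable_on UNIV"
  using assms by (simp add: norm_mult)

lemma fourier_series_has_sum:
  assumes "(\<lambda>p. cmod (a p)) summable_on UNIV"
  shows "((\<lambda>p. a p * chi p \<theta>) has_sum fourier_series a \<theta>) UNIV"
  unfolding fourier_series_def
  by (rule has_sum_infsum, rule abs_summable_summable, rule fourier_series_abs_summable, rule assms)

lemma norm_fourier_series_le:
  assumes "(\<lambda>p. cmod (a p)) summable_on UNIV"
  shows "cmod (fourier_series a \<theta>) \<le> (\<Sum>\<^sub>\<infinity>p. cmod (a p))"
  unfolding fourier_series_def
  using norm_infsum_bound[OF fourier_series_abs_summable[OF assms, of \<theta>]] by (simp add: norm_mult)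

lemma fourier_series_add: "rapid a \<Longrightarrow> rapid b \<Longrightarrow> fourier_series (\<lambda>p. a p + b p) \<theta> = fourier_series a \<theta> + fourier_series b \<theta>"
proof -
  assume "rapid a" "rapid b"
  then have "((\<lambda>p. a p * chi p \<theta> + b p * chi p \<theta>) has_sum (fourier_series a \<theta> + fourier_series b \<theta>)) UNIV"
    by (intro has_sum_add fourier_series_has_sum rapid_abs_summable)
  then show ?thesis by (simp add: fourier_series_def distrib_right infsumI)
qed

lemma fourier_series_cmult: "fourier_series (\<lambda>p. c * a p) \<theta> = c * fourier_series a \<theta>"
  by (simp add: fourier_series_def mult.assoc infsum_cmult_right')

lemma fourier_series_0 [simp]: "fourier_series (\<lambda>p. 0) \<theta> = 0"
  by (simp add: fourier_series_def)

lemma fourier_series_diff: "rapid a \<Longrightarrow> rapid b \<Longrightarrow> fourier_series (\<lambda>p. a p - b p) \<theta> = fourier_series a \<theta> - fourier_series b \<theta>"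
  using fourier_series_add[OF _ rapid_cmult[of b "-1"], of a \<theta>] by (simp only: fourier_series_cmult) simp

lemma fourier_series_sum:
  "(\<And>i. i \<in> I \<Longrightarrow> rapid (a i)) \<Longrightarrow> fourier_series (\<lambda>p. \<Sum>i\<in>I. a i p) \<theta> = (\<Sum>i\<in>I. fourier_series (a i) \<theta>)"
proof (induction I rule: infinite_finite_induct)
  case (insert i I)
  then show ?case by (simp add: fourier_series_add rapid_sum)
qed auto

lemma fourier_series_reflect: "fourier_series a (- \<theta>) = fourier_series (\<lambda>p. a (- p)) \<theta>"
proof -
  have "bij_betw uminus (UNIV :: (int ^ 'n) set) UNIV"
    by (rule bij_betwI[where g = uminus]) auto
  from infsum_reindex_bij_betw[OF this, of "\<lambda>p. a p * chi p (- \<theta>)"]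
  show ?thesis by (simp add: fourier_series_def chi_uminus)
qed

lemma fourier_series_periodic: "fourier_series a (\<theta> + axis j 1) = fourier_series a \<theta>"
  by (simp add: fourier_series_def chi_add)

subsection \<open>Smoothness of Fourier series\<close>

text \<open>At a purely imaginary argument the factor \<open>exp \<bar>Re z\<bar>\<close> in the
  Taylor bound for \<open>exp\<close> equals 1.\<close>

lemma norm_cis_taylor2: "cmod (cis x - 1 - \<i> * of_real x) \<le> x\<^sup>2"
proof -
  have 1: "cmod (exp z - (\<Sum>i\<le>1. z ^ i / fact i)) \<le> exp \<bar>Re z\<bar> * cmod z ^ Suc 1 / fact 1" for z
    by (rule Taylor_exp)
  show ?thesis using 1[of "\<i> * of_real x"]
    by (simp add: cis_conv_exp norm_mult power2_eq_square algebra_simps)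
qed

text \<open>A second order Taylor bound for each character sums to an error quadratic in the
  increment, with the constant \<open>\<Sum>\<^sub>\<infinity>p. b p\<close>. This gives the total
  derivative at once, for all coordinates together.\<close>

lemma has_derivative_fourier_series:
  assumes a: "rapid a"
  shows "(fourier_series a has_derivative (\<lambda>v. \<Sum>j\<in>UNIV. (v $ j) *\<^sub>R fourier_series (\<lambda>p. 2 * pi * \<i> * (of_int (p $ j) * a p)) \<theta>)) (at \<theta>)"
    (is "(_ has_derivative ?L) _")
proof -
  define b where "b = (\<lambda>p. 4 * pi\<^sup>2 * (cmod (a p) * weight p ^ 2))"
  have bs: "(\<lambda>p. cmod (a p) * weight p ^ 2) summable_on UNIV"
  proof -
    have "rapid (\<lambda>p. of_real (weight p ^ 2) * a p)"
      by (rule rapid_mult_growth[OF a, where D = 1 and m = 2]) (simp add: norm_power)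
    from rapid_abs_summable[OF this] show ?thesis by (simp add: norm_mult norm_power mult.commute)
  qed
  have bs': "b summable_on UNIV" unfolding b_def by (intro summable_on_cmult_right bs)
  \<comment> \<open>As one series with the multiplier
    \<open>2 * pi * \<i> * (emb p \<bullet> v)\<close>, the candidate derivative can be compared
    with the increment term by term.\<close>
  have L: "?L v = fourier_series (\<lambda>p. 2 * pi * \<i> * of_real (emb p \<bullet> v) * a p) \<theta>" for v
  proof -
    have "?L v = (\<Sum>j\<in>UNIV. fourier_series (\<lambda>p. of_real (v $ j) * (2 * pi * \<i> * (of_int (p $ j) * a p))) \<theta>)"
      by (subst fourier_series_cmult) (simp add: scaleR_conv_of_real)
    also have "\<dots> = fourier_series (\<lambda>p. \<Sum>j\<in>UNIV. of_real (v $ j) * (2 * pi * \<i> * (of_int (p $ j) * a p))) \<theta>"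
      using a by (intro fourier_series_sum[symmetric] rapid_cmult rapid_coord)
    also have "(\<lambda>p. \<Sum>j\<in>UNIV. of_real (v $ j) * (2 * pi * \<i> * (of_int (p $ j) * a p))) =
        (\<lambda>p. 2 * pi * \<i> * of_real (emb p \<bullet> v) * a p)"
      by (simp add: inner_vec_def sum_distrib_left sum_distrib_right mult_ac)
    finally show ?thesis .
  qed
  have key: "cmod (fourier_series a (\<theta> + v) - fourier_series a \<theta> - ?L v) \<le> (\<Sum>\<^sub>\<infinity>p. b p) * (norm v)\<^sup>2" for v
  proof -
    have rv: "rapid (\<lambda>p. 2 * pi * \<i> * of_real (emb p \<bullet> v) * a p)"
    proof (rule rapid_mult_growth[OF a, where D = "2 * pi * norm v" and m = 1])
      fix p :: "int ^ 'a"
      have "\<bar>emb p \<bullet> v\<bar> \<le> norm (emb p) * norm v" by (rule Cauchy_Schwarz_ineq2)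
      also have "\<dots> \<le> weight p * norm v" by (intro mult_right_mono norm_emb_le_weight) auto
      finally show "cmod (2 * pi * \<i> * of_real (emb p \<bullet> v)) \<le> 2 * pi * norm v * weight p ^ 1"
        by (simp add: norm_mult mult.commute)
    qed
    have "((\<lambda>p. a p * chi p (\<theta> + v) - a p * chi p \<theta> - 2 * pi * \<i> * of_real (emb p \<bullet> v) * a p * chi p \<theta>)
        has_sum (fourier_series a (\<theta> + v) - fourier_series a \<theta> - ?L v)) UNIV"
      unfolding L by (intro has_sum_diff fourier_series_has_sum rapid_abs_summable a rv)
    moreover have "((\<lambda>p. b p * (norm v)\<^sup>2) has_sum ((\<Sum>\<^sub>\<infinity>p. b p) * (norm v)\<^sup>2)) UNIV"
      by (intro has_sum_cmult_left has_sum_infsum bs')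
    moreover have "cmod (a p * chi p (\<theta> + v) - a p * chi p \<theta> - 2 * pi * \<i> * of_real (emb p \<bullet> v) * a p * chi p \<theta>)
        \<le> b p * (norm v)\<^sup>2" for p
    proof -
      have "a p * chi p (\<theta> + v) - a p * chi p \<theta> - 2 * pi * \<i> * of_real (emb p \<bullet> v) * a p * chi p \<theta>
          = a p * chi p \<theta> * (cis (2 * pi * (emb p \<bullet> v)) - 1 - \<i> * of_real (2 * pi * (emb p \<bullet> v)))"
        by (simp add: chi_add algebra_simps) (simp add: chi_def mult_ac)
      also have "cmod \<dots> \<le> cmod (a p) * (2 * pi * (emb p \<bullet> v))\<^sup>2"
        using norm_cis_taylor2[of "2 * pi * (emb p \<bullet> v)"]
        unfolding norm_mult norm_chi mult_1_right by (intro mult_left_mono) auto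
      also have "\<dots> \<le> cmod (a p) * (4 * pi\<^sup>2 * (weight p ^ 2 * (norm v)\<^sup>2))"
      proof -
        have "\<bar>emb p \<bullet> v\<bar> \<le> norm (emb p) * norm v" by (rule Cauchy_Schwarz_ineq2)
        also have "\<dots> \<le> weight p * norm v" by (intro mult_right_mono norm_emb_le_weight) auto
        finally have "\<bar>emb p \<bullet> v\<bar>\<^sup>2 \<le> (weight p * norm v)\<^sup>2" by (intro power_mono) auto
        then show ?thesis by (intro mult_left_mono) (auto simp: power_mult_distrib)
      qed
      also have "\<dots> = b p * (norm v)\<^sup>2" by (simp add: b_def)
      finally show ?thesis .
    qed
    ultimately show ?thesis by (rule norm_infsum_le)
  qed
  show ?thesis
  proof (rule has_derivativeI_sandwich[where e = 1 and H = "\<lambda>y. (\<Sum>\<^sub>\<infinity>p. b p) * norm (y - \<theta>)"])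
    show "bounded_linear ?L"
      by (intro bounded_linear_sum bounded_linear_scaleR_left[THEN bounded_linear_compose] bounded_linear_vec_nth)
    show "norm (fourier_series a y - fourier_series a \<theta> - ?L (y - \<theta>)) / norm (y - \<theta>) \<le> (\<Sum>\<^sub>\<infinity>p. b p) * norm (y - \<theta>)"
      if "y \<noteq> \<theta>" for y
      using key[of "y - \<theta>"] that by (simp add: divide_le_eq power2_eq_square mult.assoc)
    have "((\<lambda>y. (\<Sum>\<^sub>\<infinity>p. b p) * norm (y - \<theta>)) \<longlongrightarrow> (\<Sum>\<^sub>\<infinity>p. b p) * norm (\<theta> - \<theta>)) (at \<theta>)"
      by (intro tendsto_intros)
    then show "((\<lambda>y. (\<Sum>\<^sub>\<infinity>p. b p) * norm (y - \<theta>)) \<longlongrightarrow> 0) (at \<theta>)" by simp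
  qed auto
qed

text \<open>Stated at a general parameter \<open>x\<close> of the coordinate line, because
  differentiation under the integral sign asks for the derivative at every parameter and not only at
  0.\<close>

lemma partial_eq_derivative:
  assumes L: "(f has_derivative L) (at (\<theta> + x *\<^sub>R axis j 1))"
  shows "((\<lambda>t. f (\<theta> + t *\<^sub>R axis j 1)) has_vector_derivative L (axis j 1)) (at x)"
    and "partial j f (\<theta> + x *\<^sub>R axis j 1) = L (axis j 1)"
proof -
  have *: "((\<lambda>t. f (\<eta> + t *\<^sub>R axis j 1)) has_vector_derivative L (axis j 1)) (at y)"
    if L: "(f has_derivative L) (at (\<eta> + y *\<^sub>R axis j 1))" for \<eta> y
  proof -
    have "((\<lambda>t. \<eta> + t *\<^sub>R axis j 1) has_derivative (\<lambda>t. t *\<^sub>R axis j 1)) (at y)"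
      by (auto intro!: derivative_eq_intros)
    from has_derivative_compose[OF this L]
    have "((\<lambda>t. f (\<eta> + t *\<^sub>R axis j 1)) has_derivative (\<lambda>t. L (t *\<^sub>R axis j 1))) (at y)" .
    moreover have "L (t *\<^sub>R axis j 1) = t *\<^sub>R L (axis j 1)" for t
      using has_derivative_linear[OF L] by (simp add: linear_cmul)
    ultimately show ?thesis by (simp add: has_vector_derivative_def)
  qed
  show "((\<lambda>t. f (\<theta> + t *\<^sub>R axis j 1)) has_vector_derivative L (axis j 1)) (at x)"
    by (rule *[OF L])
  show "partial j f (\<theta> + x *\<^sub>R axis j 1) = L (axis j 1)"
    unfolding partial_def using *[of "\<theta> + x *\<^sub>R axis j 1" 0] L by (simp add: vector_derivative_at)
qed

lemma partial_fourier_series: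
  assumes "rapid a"
  shows "partial j (fourier_series a) = fourier_series (\<lambda>p. 2 * pi * \<i> * (of_int (p $ j) * a p))"
proof
  fix \<theta>
  have "(\<Sum>i\<in>UNIV. (axis j 1 $ i) *\<^sub>R F i) = F j" for F :: "'a \<Rightarrow> complex"
  proof -
    have "(\<Sum>i\<in>UNIV. (axis j (1::real) $ i) *\<^sub>R F i) = (\<Sum>i\<in>UNIV. if i = j then F i else 0)"
      by (rule sum.cong) (auto simp: axis_def)
    then show ?thesis by simp
  qed
  then show "partial j (fourier_series a) \<theta> = fourier_series (\<lambda>p. 2 * pi * \<i> * (of_int (p $ j) * a p)) \<theta>"
    using partial_eq_derivative(2)[where x = 0, OF has_derivative_fourier_series[OF assms]] by simp
qed

lemma continuous_fourier_series: "rapid a \<Longrightarrow> continuous_on S (fourier_series a)"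
  using has_derivative_continuous[OF has_derivative_fourier_series, of a]
  by (intro continuous_at_imp_continuous_on ballI)

lemma C_times_fourier_series: "rapid a \<Longrightarrow> C_times m (fourier_series a)"
proof (induction m arbitrary: a)
  case (Suc m)
  have "fourier_series a differentiable_on UNIV"
    using has_derivative_fourier_series[OF Suc.prems] unfolding differentiable_on_def differentiable_def
    by auto
  moreover have "rapid (\<lambda>p. 2 * pi * \<i> * (of_int (p $ j) * a p))" for j
    using Suc.prems by (intro rapid_cmult rapid_coord)
  ultimately show ?case unfolding C_times.simps partial_fourier_series[OF Suc.prems] using Suc.IH by blast
qed (simp add: continuous_fourier_series)

lemma smooth_torus_fourier_series: "rapid a \<Longrightarrow> smooth_torus (fourier_series a)"
  by (simp add: smooth_torus_def C_times_fourier_series fourier_series_periodic)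

subsection \<open>Integration over the torus\<close>

abbreviation cube :: "(real ^ 'n) set" where
  "cube \<equiv> cbox 0 (\<chi> j. 1)"

definition fourier_coeff :: "(real ^ 'n::finite \<Rightarrow> complex) \<Rightarrow> int ^ 'n \<Rightarrow> complex" where
  "fourier_coeff f p = integral cube (\<lambda>\<theta>. chi (- p) \<theta> * f \<theta>)"

lemma content_cube [simp]: "measure lborel (cube :: (real ^ 'n::finite) set) = 1"
proof -
  have "(0 :: real ^ 'n) \<in> cube" by (simp add: mem_box_cart)
  then have "(cube :: (real ^ 'n) set) \<noteq> {}" by blast
  then show ?thesis by (simp add: content_cbox_cart)
qed

lemma box_cube_nonempty: "box (0 :: real ^ 'n::finite) (\<chi> j. 1) \<noteq> {}"
proof -
  have "(\<chi> j. 1 / 2) \<in> box (0 :: real ^ 'n) (\<chi> j. 1)" by (simp add: mem_box_cart)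
  then show ?thesis by blast
qed

text \<open>Cut the cube at height \<open>t\<close> in direction \<open>j\<close>. Moved up by one
  period, the lower slab completes the upper one to the translated cube.\<close>

lemma integral_cube_translate:
  fixes f :: "real ^ 'n::finite \<Rightarrow> complex"
  assumes cont: "continuous_on UNIV f" and per: "\<And>\<theta>. f (\<theta> + axis j 1) = f \<theta>"
    and t: "0 \<le> t" "t \<le> 1"
  shows "integral cube (\<lambda>\<theta>. f (\<theta> + t *\<^sub>R axis j 1)) = integral cube f"
proof -
  let ?e = "axis j 1 :: real ^ 'n" and ?one = "(\<chi> j. 1) :: real ^ 'n"
  have inner: "\<theta> \<bullet> ?e = \<theta> $ j" for \<theta> by (simp add: inner_axis)
  have int: "f integrable_on cbox a b" for a b
    by (intro integrable_continuous continuous_on_subset[OF cont]) auto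
  define I1 I2 where "I1 = integral (cbox (t *\<^sub>R ?e) ?one) f"
    and "I2 = integral (cbox 0 (?one - ?e + t *\<^sub>R ?e)) f"
  have I1: "(f has_integral I1) (cbox (t *\<^sub>R ?e) ?one)"
    and I2: "(f has_integral I2) (cbox 0 (?one - ?e + t *\<^sub>R ?e))"
    unfolding I1_def I2_def by (intro integrable_integral int)+
  have s1: "cube \<inter> {\<theta>. \<theta> \<bullet> ?e \<le> t} = cbox 0 (?one - ?e + t *\<^sub>R ?e)"
    using t unfolding inner by (auto simp: mem_box_cart axis_def split: if_splits) (smt (verit))+
  have s2: "cube \<inter> {\<theta>. \<theta> \<bullet> ?e \<ge> t} = cbox (t *\<^sub>R ?e) ?one"
    using t unfolding inner by (auto simp: mem_box_cart axis_def split: if_splits) (smt (verit))+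
  have s3: "cube \<inter> {\<theta>. \<theta> \<bullet> ?e \<le> 1 - t} = cbox (t *\<^sub>R ?e - t *\<^sub>R ?e) (?one - t *\<^sub>R ?e)"
    using t unfolding inner by (auto simp: mem_box_cart axis_def split: if_splits) (smt (verit))+
  have s4: "cube \<inter> {\<theta>. \<theta> \<bullet> ?e \<ge> 1 - t} =
      cbox (0 - (t *\<^sub>R ?e - ?e)) (?one - ?e + t *\<^sub>R ?e - (t *\<^sub>R ?e - ?e))"
    using t unfolding inner by (auto simp: mem_box_cart axis_def split: if_splits) (smt (verit))+
  have "(f has_integral (I2 + I1)) cube"
    by (rule has_integral_split[where k = ?e and c = t]) (use I1 I2 s1 s2 in auto)
  \<comment> \<open>In the translated coordinates the cut sits at \<open>1 - t\<close>: below it the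
    integrand runs through the slab of \<open>I1\<close>, and above it, after subtracting a period,
    through the slab of \<open>I2\<close>.\<close>
  moreover have "((\<lambda>\<theta>. f (\<theta> + t *\<^sub>R ?e)) has_integral (I1 + I2)) cube"
  proof (rule has_integral_split[where k = ?e and c = "1 - t"])
    show "((\<lambda>\<theta>. f (\<theta> + t *\<^sub>R ?e)) has_integral I1) (cube \<inter> {\<theta>. \<theta> \<bullet> ?e \<le> 1 - t})"
      unfolding s3 by (rule has_integral_shift_cbox[OF I1])
    have "f (\<theta> + (t *\<^sub>R ?e - ?e)) = f (\<theta> + t *\<^sub>R ?e)" for \<theta>
      using per[of "\<theta> + (t *\<^sub>R ?e - ?e)"] by (simp add: algebra_simps)
    with has_integral_shift_cbox[OF I2, of "t *\<^sub>R ?e - ?e"]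
    show "((\<lambda>\<theta>. f (\<theta> + t *\<^sub>R ?e)) has_integral I2) (cube \<inter> {\<theta>. \<theta> \<bullet> ?e \<ge> 1 - t})"
      unfolding s4 by simp
  qed (simp add: axis_in_Basis_iff)
  ultimately show ?thesis by (metis add.commute integral_unique)
qed

lemma partial_has_vector_derivative:
  assumes "f differentiable_on UNIV"
  shows "((\<lambda>t. f (\<theta> + t *\<^sub>R axis j 1)) has_vector_derivative partial j f (\<theta> + x *\<^sub>R axis j 1)) (at x)"
proof -
  obtain L where L: "(f has_derivative L) (at (\<theta> + x *\<^sub>R axis j 1))"
    using assms unfolding differentiable_on_def differentiable_def by auto
  show ?thesis using partial_eq_derivative(1)[OF L] unfolding partial_eq_derivative(2)[OF L] .
qed

text \<open>Translation in direction \<open>j\<close> does not change the integral, so the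
  derivative in the translation parameter vanishes; under the integral sign this derivative is
  \<open>partial j f\<close>.\<close>

lemma integral_cube_partial:
  assumes f: "f differentiable_on UNIV" and per: "\<And>\<theta>. f (\<theta> + axis j 1) = f \<theta>"
    and cont: "continuous_on UNIV (partial j f)"
  shows "integral cube (partial j f) = 0"
proof -
  have cf: "continuous_on UNIV f" by (rule differentiable_imp_continuous_on[OF f])
  let ?\<phi> = "\<lambda>x. integral cube (\<lambda>\<theta>. f (\<theta> + x *\<^sub>R axis j 1))"
  have "(?\<phi> has_vector_derivative integral cube (\<lambda>\<theta>. partial j f (\<theta> + 0 *\<^sub>R axis j 1))) (at 0 within {0..1})"
  proof (rule leibniz_rule_vector_derivative)
    show "((\<lambda>x. f (\<theta> + x *\<^sub>R axis j 1)) has_vector_derivative partial j f (\<theta> + x *\<^sub>R axis j 1)) (at x within {0..1})"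
      for x \<theta> by (rule has_vector_derivative_at_within[OF partial_has_vector_derivative[OF f]])
    show "(\<lambda>\<theta>. f (\<theta> + x *\<^sub>R axis j 1)) integrable_on cube" for x
      by (intro integrable_continuous continuous_on_compose2[OF cf] continuous_intros) auto
    show "continuous_on ({0..1} \<times> cube) (\<lambda>(x, \<theta>). partial j f (\<theta> + x *\<^sub>R axis j 1))"
      unfolding split_beta by (intro continuous_on_compose2[OF cont] continuous_intros) auto
  qed auto
  \<comment> \<open>Translation invariance is at hand for parameters in \<open>{0..1}\<close>, so
    the derivative at 0 is taken within this interval; it is unique, as 0 is a limit point.\<close>
  moreover have "(?\<phi> has_vector_derivative 0) (at 0 within {0..1})"
  proof (rule has_vector_derivative_transform[where f = "\<lambda>_. integral cube f"])
    show "?\<phi> x = integral cube f" if "x \<in> {0..1}" for x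
      using that integral_cube_translate[OF cf per, of x] by simp
  qed auto
  ultimately have "integral cube (\<lambda>\<theta>. partial j f (\<theta> + 0 *\<^sub>R axis j 1)) = 0"
    by (rule vector_derivative_unique_within[rotated]) (simp add: trivial_limit_within islimpt_Icc)
  then show ?thesis by simp
qed

section \<open>Characters and smooth functions on the torus\<close>

text \<open>Makes a character a Fourier series with a single coefficient, so that its smoothness and
  its derivatives are instances of the general results.\<close>

lemma rapid_delta: "rapid (\<lambda>q. if q = p then 1 else 0)"
proof (rule rapidI)
  fix M
  have "cmod (if q = p then 1 else 0) * weight q ^ M \<le> weight p ^ M" for q by simp
  then show "\<exists>C. \<forall>q. cmod (if q = p then 1 else 0) * weight q ^ M \<le> C" by blast
qed

lemma fourier_series_delta: "fourier_series (\<lambda>q. if q = p then c else 0) = (\<lambda>\<theta>. c * chi p \<theta>)"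
proof
  fix \<theta>
  have "fourier_series (\<lambda>q. if q = p then c else 0) \<theta> = (\<Sum>\<^sub>\<infinity>q\<in>{p}. c * chi q \<theta>)"
    unfolding fourier_series_def by (rule infsum_cong_neutral) auto
  then show "fourier_series (\<lambda>q. if q = p then c else 0) \<theta> = c * chi p \<theta>" by simp
qed

lemma smooth_chi: "smooth_torus (chi p)"
  using smooth_torus_fourier_series[OF rapid_delta[of p]] fourier_series_delta[of p 1] by simp

lemma partial_chi: "partial j (chi p) = (\<lambda>\<theta>. 2 * pi * \<i> * of_int (p $ j) * chi p \<theta>)"
proof -
  have "(\<lambda>q. 2 * pi * \<i> * (of_int (q $ j) * (if q = p then 1 else 0))) =
      (\<lambda>q. if q = p then 2 * pi * \<i> * of_int (p $ j) else 0)"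
    by auto
  then show ?thesis
    using partial_fourier_series[OF rapid_delta[of p], of j] fourier_series_delta[of p 1]
      fourier_series_delta[of p "2 * pi * \<i> * of_int (p $ j)"] by simp
qed

lemma smooth_torusD:
  assumes "smooth_torus f"
  shows "continuous_on UNIV f" "f differentiable_on UNIV" "f (\<theta> + axis j 1) = f \<theta>"
    "smooth_torus (partial j f)"
proof -
  have C: "C_times m f" for m using assms by (simp add: smooth_torus_def)
  show "continuous_on UNIV f" using C[of 0] by simp
  show "f differentiable_on UNIV" using C[of 1] by simp
  show per: "f (\<theta> + axis j 1) = f \<theta>" for \<theta> j using assms by (simp add: smooth_torus_def)
  have "partial j f (\<theta> + axis i 1) = partial j f \<theta>" for \<theta> i
  proof -
    have "f (\<theta> + axis i 1 + t *\<^sub>R axis j 1) = f (\<theta> + t *\<^sub>R axis j 1)" for t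
      using per[of "\<theta> + t *\<^sub>R axis j 1" i] by (simp add: algebra_simps)
    then show ?thesis by (simp add: partial_def)
  qed
  moreover have "C_times m (partial j f)" for m using C[of "Suc m"] by simp
  ultimately show "smooth_torus (partial j f)" by (simp add: smooth_torus_def)
qed

lemma partial_mult:
  assumes "f differentiable_on UNIV" "g differentiable_on UNIV"
  shows "partial j (\<lambda>\<theta>. f \<theta> * g \<theta>) = (\<lambda>\<theta>. f \<theta> * partial j g \<theta> + partial j f \<theta> * g \<theta>)"
proof
  fix \<theta>
  from has_vector_derivative_mult[OF partial_has_vector_derivative[OF assms(1), of \<theta> j 0]
      partial_has_vector_derivative[OF assms(2), of \<theta> j 0]]
  show "partial j (\<lambda>\<theta>. f \<theta> * g \<theta>) \<theta> = f \<theta> * partial j g \<theta> + partial j f \<theta> * g \<theta>"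
    unfolding partial_def by (simp add: vector_derivative_at)
qed

text \<open>Integration by parts: the derivative of the product with \<open>chi (- p)\<close>
  integrates to 0 over the torus.\<close>

lemma fourier_coeff_partial:
  assumes f: "smooth_torus f"
  shows "fourier_coeff (partial j f) p = 2 * pi * \<i> * of_int (p $ j) * fourier_coeff f p"
proof -
  note [continuous_intros] = smooth_torusD(1)[OF f, THEN continuous_on_subset, OF subset_UNIV]
    smooth_torusD(1)[OF smooth_torusD(4)[OF f], THEN continuous_on_subset, OF subset_UNIV]
  note df = smooth_torusD(2)[OF f] and dc = smooth_torusD(2)[OF smooth_chi]
  let ?g = "\<lambda>\<theta>. chi (- p) \<theta> * f \<theta>"
  have pg: "partial j ?g = (\<lambda>\<theta>. chi (- p) \<theta> * partial j f \<theta>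
      - 2 * pi * \<i> * of_int (p $ j) * (chi (- p) \<theta> * f \<theta>))"
    by (simp add: partial_mult[OF dc df] partial_chi mult.assoc)
  have "integral cube (partial j ?g) = 0"
  proof (rule integral_cube_partial)
    show "?g differentiable_on UNIV" by (intro differentiable_on_mult df dc)
    show "?g (\<theta> + axis j 1) = ?g \<theta>" for \<theta>
      by (simp only: smooth_torusD(3)[OF f] smooth_torusD(3)[OF smooth_chi])
    show "continuous_on UNIV (partial j ?g)" unfolding pg by (intro continuous_intros)
  qed
  moreover have "integral cube (partial j ?g) = fourier_coeff (partial j f) p - 2 * pi * \<i> * of_int (p $ j) * fourier_coeff f p"
    unfolding pg fourier_coeff_def
    by (subst integral_diff) (auto intro!: integrable_continuous continuous_intros)
  ultimately show ?thesis by simp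
qed

section \<open>Decay of Fourier coefficients\<close>

text \<open>The bound \<open>B\<close> is kept explicit: later it is a symbol estimate depending on
  the lattice point, and the coefficients must inherit it with the same constant.\<close>

lemma norm_fourier_coeff_le:
  assumes "continuous_on UNIV f" "\<And>\<theta>. cmod (f \<theta>) \<le> B"
  shows "cmod (fourier_coeff f p) \<le> B"
proof -
  have "((\<lambda>\<theta>. chi (- p) \<theta> * f \<theta>) has_integral fourier_coeff f p) cube"
    unfolding fourier_coeff_def
    by (intro integrable_integral integrable_continuous continuous_intros
        continuous_on_subset[OF assms(1)]) auto
  moreover have "0 \<le> B" using order_trans[OF norm_ge_zero assms(2)] .
  ultimately have "cmod (fourier_coeff f p) \<le> B * measure lborel (cube :: (real ^ 'a) set)"
    by (intro has_integral_bound) (auto simp: norm_mult assms)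
  then show ?thesis by simp
qed

lemma fourier_coeff_bounded:
  assumes "continuous_on UNIV f"
  shows "\<exists>B. \<forall>p. cmod (fourier_coeff f p) \<le> B"
proof -
  have "compact (f ` cube)"
    by (intro compact_continuous_image continuous_on_subset[OF assms]) auto
  then obtain B where "\<forall>z\<in>f ` cube. cmod z \<le> B" by (meson bounded_iff compact_imp_bounded)
  then have B: "cmod (f \<theta>) \<le> max B 0" if "\<theta> \<in> cube" for \<theta> using that by fastforce
  have "((\<lambda>\<theta>. chi (- p) \<theta> * f \<theta>) has_integral fourier_coeff f p) cube" for p
    unfolding fourier_coeff_def
    by (intro integrable_integral integrable_continuous continuous_intros
        continuous_on_subset[OF assms(1)]) auto
  from has_integral_bound[OF _ this, of "max B 0"]
  have "cmod (fourier_coeff f p) \<le> max B 0" for p using B by (simp add: norm_mult)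
  then show ?thesis by blast
qed

text \<open>Each integration by parts multiplies the coefficient by a number of modulus
  \<open>2 * pi * \<bar>p $ j\<bar>\<close>, hence at least \<open>\<bar>p $ j\<bar>\<close>, while
  the coefficients of the derivative are bounded again.\<close>

lemma fourier_coeff_coord_decay:
  "smooth_torus f \<Longrightarrow> \<exists>B. \<forall>p. \<bar>real_of_int (p $ j)\<bar> ^ M * cmod (fourier_coeff f p) \<le> B"
proof (induction M arbitrary: f)
  case 0
  then show ?case using fourier_coeff_bounded[OF smooth_torusD(1)] by simp
next
  case (Suc M)
  obtain B where B: "\<And>p. \<bar>real_of_int (p $ j)\<bar> ^ M * cmod (fourier_coeff (partial j f) p) \<le> B"
    using Suc.IH[OF smooth_torusD(4)[OF Suc.prems]] by blast
  have "\<bar>real_of_int (p $ j)\<bar> ^ Suc M * cmod (fourier_coeff f p) \<le> B" for p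
  proof -
    have "1 * \<bar>real_of_int (p $ j)\<bar> \<le> (2 * pi) * \<bar>real_of_int (p $ j)\<bar>"
      using pi_gt3 by (intro mult_right_mono) auto
    then have "\<bar>real_of_int (p $ j)\<bar> ^ M * (\<bar>real_of_int (p $ j)\<bar> * cmod (fourier_coeff f p))
        \<le> \<bar>real_of_int (p $ j)\<bar> ^ M * ((2 * pi * \<bar>real_of_int (p $ j)\<bar>) * cmod (fourier_coeff f p))"
      by (intro mult_left_mono mult_right_mono) auto
    also have "\<dots> = \<bar>real_of_int (p $ j)\<bar> ^ M * cmod (fourier_coeff (partial j f) p)"
      unfolding fourier_coeff_partial[OF Suc.prems] by (simp add: norm_mult)
    also have "\<dots> \<le> B" by (rule B)
    finally show ?thesis by (simp add: mult_ac)
  qed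
  then show ?case by blast
qed

text \<open>Turns decay in each coordinate into decay in the weight: \<open>weight p\<close> is at
  most \<open>1 + CARD('n)\<close> times the largest modulus of a coordinate, with 1 in its place
  when \<open>p = 0\<close>.\<close>

lemma weight_power_le:
  fixes p :: "int ^ 'n::finite"
  shows "weight p ^ M \<le> (1 + real CARD('n)) ^ M * (1 + (\<Sum>j\<in>UNIV. \<bar>real_of_int (p $ j)\<bar> ^ M))"
proof -
  define m where "m = (MAX j. \<bar>p $ j\<bar>)"
  have m: "\<bar>p $ j\<bar> \<le> m" for j unfolding m_def by (rule Max_ge) auto
  have "m \<in> range (\<lambda>j. \<bar>p $ j\<bar>)" unfolding m_def by (rule Max_in) auto
  then obtain i where i: "m = \<bar>p $ i\<bar>" by auto
  have "real (l1 p) = (\<Sum>j\<in>UNIV. \<bar>real_of_int (p $ j)\<bar>)" by (simp add: l1_def)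
  also have "\<dots> \<le> (\<Sum>j\<in>(UNIV :: 'n set). real_of_int m)" 
    by (intro sum_mono) (metis m of_int_abs of_int_le_iff)
  finally have "real (l1 p) \<le> real CARD('n) * real_of_int m" by simp
  also have "\<dots> \<le> real CARD('n) * max 1 (real_of_int m)"
    by (intro mult_left_mono) auto
  finally have "weight p \<le> (1 + real CARD('n)) * max 1 (real_of_int m)"
    unfolding weight_def distrib_right by linarith
  then have "weight p ^ M \<le> ((1 + real CARD('n)) * max 1 (real_of_int m)) ^ M"
    by (intro power_mono) auto
  also have "\<dots> = (1 + real CARD('n)) ^ M * max 1 (real_of_int m) ^ M"
    by (rule power_mult_distrib)
  also have "\<dots> \<le> (1 + real CARD('n)) ^ M * (1 + (\<Sum>j\<in>UNIV. \<bar>real_of_int (p $ j)\<bar> ^ M))"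
  proof (intro mult_left_mono)
    have 1: "\<bar>real_of_int (p $ i)\<bar> ^ M \<le> (\<Sum>j\<in>UNIV. \<bar>real_of_int (p $ j)\<bar> ^ M)"
      by (rule member_le_sum) auto
    have 2: "0 \<le> (\<Sum>j\<in>UNIV. \<bar>real_of_int (p $ j)\<bar> ^ M)" by (intro sum_nonneg) auto
    show "max 1 (real_of_int m) ^ M \<le> 1 + (\<Sum>j\<in>UNIV. \<bar>real_of_int (p $ j)\<bar> ^ M)"
      using 1 2 by (cases "1 \<le> real_of_int m") (auto simp: max_def i)
  qed auto
  finally show ?thesis .
qed

lemma rapid_fourier_coeff:
  assumes "smooth_torus f"
  shows "rapid (fourier_coeff f)"
proof (rule rapidI)
  fix M
  obtain B0 where B0: "\<And>p. cmod (fourier_coeff f p) \<le> B0"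
    using fourier_coeff_bounded[OF smooth_torusD(1)[OF assms]] by blast
  have "\<forall>j. \<exists>B. \<forall>p. \<bar>real_of_int (p $ j)\<bar> ^ M * cmod (fourier_coeff f p) \<le> B"
    using fourier_coeff_coord_decay[OF assms] by blast
  then obtain B where B: "\<And>j p. \<bar>real_of_int (p $ j)\<bar> ^ M * cmod (fourier_coeff f p) \<le> B j" by metis
  let ?c = "(1 + real CARD('a)) ^ M"
  have "cmod (fourier_coeff f p) * weight p ^ M \<le> ?c * (B0 + (\<Sum>j\<in>UNIV. B j))" for p
  proof -
    have "cmod (fourier_coeff f p) * weight p ^ M \<le> cmod (fourier_coeff f p) * (?c * (1 + (\<Sum>j\<in>UNIV. \<bar>real_of_int (p $ j)\<bar> ^ M)))"
      by (intro mult_left_mono weight_power_le) auto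
    also have "\<dots> = ?c * (cmod (fourier_coeff f p) + (\<Sum>j\<in>UNIV. \<bar>real_of_int (p $ j)\<bar> ^ M * cmod (fourier_coeff f p)))"
      by (simp add: algebra_simps sum_distrib_right sum_distrib_left)
    also have "\<dots> \<le> ?c * (B0 + (\<Sum>j\<in>UNIV. B j))"
      by (intro mult_left_mono add_mono B0 sum_mono B) auto
    finally show ?thesis .
  qed
  then show "\<exists>C. \<forall>p. cmod (fourier_coeff f p) * weight p ^ M \<le> C" by blast
qed

section \<open>Termwise integration and orthogonality\<close>

text \<open>By the Weierstrass M-test the net of finite partial sums converges uniformly on the
  cube, and uniform limits commute with the integral.\<close>

lemma has_sum_integral:
  fixes g :: "'b \<Rightarrow> real ^ 'n::finite \<Rightarrow> complex"
  assumes cont: "\<And>p. continuous_on cube (g p)" and bd: "\<And>p \<theta>. \<theta> \<in> cube \<Longrightarrow> cmod (g p \<theta>) \<le> B p"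
    and B: "B summable_on UNIV"
  shows "((\<lambda>p. integral cube (g p)) has_sum integral cube (\<lambda>\<theta>. \<Sum>\<^sub>\<infinity>p. g p \<theta>)) UNIV"
proof -
  have u: "uniform_limit cube (\<lambda>X \<theta>. \<Sum>p\<in>X. g p \<theta>) (\<lambda>\<theta>. \<Sum>\<^sub>\<infinity>p. g p \<theta>) (finite_subsets_at_top UNIV)"
    by (rule Weierstrass_m_test_general[OF bd B])
  have c: "continuous_on cube (\<lambda>\<theta>. \<Sum>p\<in>X. g p \<theta>)" for X
    by (intro continuous_on_sum cont)
  obtain I J where I: "\<And>X. ((\<lambda>\<theta>. \<Sum>p\<in>X. g p \<theta>) has_integral I X) cube"
    and J: "((\<lambda>\<theta>. \<Sum>\<^sub>\<infinity>p. g p \<theta>) has_integral J) cube"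
    and lim: "(I \<longlongrightarrow> J) (finite_subsets_at_top UNIV)"
    by (rule uniform_limit_integral_cbox[OF u c]) auto
  \<comment> \<open>The limit theorem yields some \<open>I X\<close> for each \<open>X\<close>; it
    is identified for finite \<open>X\<close>, which are the sets that the filter sees.\<close>
  have "I X = (\<Sum>p\<in>X. integral cube (g p))" if "finite X" for X
  proof -
    have "((\<lambda>\<theta>. \<Sum>p\<in>X. g p \<theta>) has_integral (\<Sum>p\<in>X. integral cube (g p))) cube"
      using that by (intro has_integral_sum integrable_integral integrable_continuous cont)
    with I show ?thesis by (rule has_integral_unique)
  qed
  then have "((\<lambda>X. \<Sum>p\<in>X. integral cube (g p)) \<longlongrightarrow> J) (finite_subsets_at_top UNIV)"
    using lim by (subst tendsto_cong[where g = I])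
      (auto simp: eventually_finite_subsets_at_top intro!: exI[of _ "{}"])
  then show ?thesis using J by (simp add: has_sum_def integral_unique)
qed

text \<open>A nontrivial character is a multiple of its own derivative in a direction with
  \<open>p $ j \<noteq> 0\<close>, and derivatives integrate to 0.\<close>

lemma integral_chi: "integral cube (chi p) = (if p = 0 then 1 else 0)"
proof (cases "p = 0")
  case True
  then have "chi p = (\<lambda>_. 1)" by auto
  then show ?thesis using True by (simp add: integral_const)
next
  case False
  then obtain j where j: "p $ j \<noteq> 0" by (auto simp: vec_eq_iff)
  have "integral cube (partial j (chi p)) = 0"
    by (intro integral_cube_partial smooth_torusD[OF smooth_chi]
        smooth_torusD(1)[OF smooth_torusD(4)[OF smooth_chi]])
  then have "(2 * pi * \<i> * of_int (p $ j)) * integral cube (chi p) = 0"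
    unfolding partial_chi by (simp add: integral_mult_right)
  then show ?thesis using j False by simp
qed

lemma fourier_coeff_fourier_series:
  assumes "(\<lambda>p. cmod (a p)) summable_on UNIV"
  shows "fourier_coeff (fourier_series a) p = a p"
proof -
  have "((\<lambda>q. integral cube (\<lambda>\<theta>. chi (- p) \<theta> * (a q * chi q \<theta>))) has_sum
      integral cube (\<lambda>\<theta>. \<Sum>\<^sub>\<infinity>q. chi (- p) \<theta> * (a q * chi q \<theta>))) UNIV"
    by (rule has_sum_integral[where B = "\<lambda>q. cmod (a q)"])
      (auto intro!: continuous_intros simp: norm_mult assms)
  moreover have "(\<lambda>\<theta>. \<Sum>\<^sub>\<infinity>q. chi (- p) \<theta> * (a q * chi q \<theta>)) = (\<lambda>\<theta>. chi (- p) \<theta> * fourier_series a \<theta>)"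
    by (simp add: fourier_series_def infsum_cmult_right')
  moreover have "integral cube (\<lambda>\<theta>. chi (- p) \<theta> * (a q * chi q \<theta>)) = (if q = p then a p else 0)" for q
  proof -
    have "(\<lambda>\<theta>. chi (- p) \<theta> * (a q * chi q \<theta>)) = (\<lambda>\<theta>. a q * chi (q - p) \<theta>)"
      by (auto simp: mult.left_commute chi_mult)
    then show ?thesis by (simp add: integral_mult_right integral_chi)
  qed
  ultimately have "((\<lambda>q. if q = p then a p else 0) has_sum fourier_coeff (fourier_series a) p) UNIV"
    by (simp add: fourier_coeff_def)
  moreover have "((\<lambda>q. if q = p then a p else 0) has_sum a p) UNIV"
    using has_sum_finite_neutralI[of "{p}" UNIV "\<lambda>q. if q = p then a p else 0"] by simp
  ultimately show ?thesis by (rule has_sum_unique)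
qed

subsection \<open>Fourier inversion\<close>

inductive trigpoly :: "(real ^ 'n::finite \<Rightarrow> complex) \<Rightarrow> bool" where
  chi: "trigpoly (chi p)"
| cmult: "trigpoly t \<Longrightarrow> trigpoly (\<lambda>\<theta>. c * t \<theta>)"
| add: "trigpoly s \<Longrightarrow> trigpoly t \<Longrightarrow> trigpoly (\<lambda>\<theta>. s \<theta> + t \<theta>)"

lemma trigpoly_const: "trigpoly (\<lambda>_. c)"
  using trigpoly.cmult[OF trigpoly.chi[of 0], of c] by simp

lemma trigpoly_sum: "(\<And>i. i \<in> I \<Longrightarrow> trigpoly (t i)) \<Longrightarrow> trigpoly (\<lambda>\<theta>. \<Sum>i\<in>I. t i \<theta>)"
  by (induction I rule: infinite_finite_induct) (simp_all add: trigpoly_const trigpoly.add)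

lemma trigpoly_mult_chi: "trigpoly t \<Longrightarrow> trigpoly (\<lambda>\<theta>. chi p \<theta> * t \<theta>)"
proof (induction rule: trigpoly.induct)
  case (chi q)
  then show ?case by (simp add: chi_mult trigpoly.chi)
next
  case (cmult t c)
  then show ?case using trigpoly.cmult[OF cmult.IH, of c] by (simp add: mult.left_commute)
next
  case (add s t)
  then show ?case using trigpoly.add[OF add.IH] by (simp add: distrib_left)
qed

lemma trigpoly_mult: "trigpoly s \<Longrightarrow> trigpoly t \<Longrightarrow> trigpoly (\<lambda>\<theta>. s \<theta> * t \<theta>)"
proof (induction rule: trigpoly.induct)
  case (chi q)
  then show ?case by (rule trigpoly_mult_chi)
next
  case (cmult s c)
  then show ?case using trigpoly.cmult[OF cmult.IH, of c] by (simp add: mult.assoc)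
next
  case (add s s')
  then show ?case using trigpoly.add[OF add.IH] by (simp add: distrib_right)
qed

lemma trigpoly_continuous: "trigpoly t \<Longrightarrow> continuous_on S t"
  by (induction rule: trigpoly.induct) (intro continuous_intros; assumption)+

lemma integral_trigpoly_eq_0:
  fixes f :: "real ^ 'n::finite \<Rightarrow> complex"
  assumes "trigpoly t" and f: "continuous_on UNIV f" and fourier_coeff: "\<And>p. fourier_coeff f p = 0"
  shows "integral cube (\<lambda>\<theta>. t \<theta> * f \<theta>) = 0"
  using assms(1)
proof (induction rule: trigpoly.induct)
  case (chi p)
  then show ?case using fourier_coeff[of "- p"] by (simp add: fourier_coeff_def)
next
  case (cmult t c)
  then show ?case by (simp add: mult.assoc integral_mult_right)
next
  case (add s t)
  have "(\<lambda>\<theta>. u \<theta> * f \<theta>) integrable_on cube" if "trigpoly u" for u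
    using that by (intro integrable_continuous continuous_intros trigpoly_continuous
        continuous_on_subset[OF f]) auto
  then show ?case using add by (simp add: distrib_right integral_add)
qed

section \<open>Density of trigonometric polynomials and uniqueness\<close>

text \<open>Embeds the torus as a compact subset of a Euclidean space, where polynomials are dense
  by Stone-Weierstrass.\<close>

definition torus_point :: "real ^ 'n \<Rightarrow> complex ^ 'n" where
  "torus_point \<theta> = (\<chi> j. cis (2 * pi * \<theta> $ j))"

lemma continuous_torus_point: "continuous_on S torus_point"
  unfolding torus_point_def by (intro continuous_intros)

lemma chi_coord: "chi (axis j 1) \<theta> = torus_point \<theta> $ j"
  by (simp add: chi_def torus_point_def emb_axis inner_axis' mult.commute)

lemma complex_vec_basis_expansion:
  fixes z :: "complex ^ 'n::finite"
  shows "z = (\<Sum>j\<in>UNIV. Re (z $ j) *\<^sub>R axis j 1 + Im (z $ j) *\<^sub>R axis j \<i>)"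
proof -
  have "(\<Sum>j\<in>UNIV. Re (z $ j) *\<^sub>R axis j 1 + Im (z $ j) *\<^sub>R axis j \<i>) $ i = z $ i" for i
  proof -
    have "(\<Sum>j\<in>UNIV. Re (z $ j) *\<^sub>R axis j 1 + Im (z $ j) *\<^sub>R axis j \<i>) $ i =
        (\<Sum>j\<in>UNIV. if j = i then z $ i else 0)"
      unfolding sum_component
      by (rule sum.cong) (auto simp: axis_def complex_eq_iff)
    then show ?thesis by simp
  qed
  then show ?thesis by (simp add: vec_eq_iff)
qed

text \<open>Real linear functionals generate the real polynomial functions, so it is enough to treat
  these; sums and products stay within \<open>trigpoly\<close>.\<close>

lemma trigpoly_real_polynomial:
  fixes g :: "complex ^ 'n::finite \<Rightarrow> real"
  shows "real_polynomial_function g \<Longrightarrow> trigpoly (\<lambda>\<theta>. of_real (g (torus_point \<theta>)))"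
proof (induction rule: real_polynomial_function.induct)
  case (linear g)
  interpret bounded_linear g by fact
  \<comment> \<open>A real linear functional is a combination of the real and imaginary parts of the
    coordinates, and these are half sums and half differences of \<open>chi (axis j 1)\<close> and
    its conjugate \<open>chi (- axis j 1)\<close>.\<close>
  have "of_real (g (torus_point \<theta>)) = (\<Sum>j\<in>UNIV.
      of_real (g (axis j 1)) * ((1 / 2) * (chi (axis j 1) \<theta> + chi (- axis j 1) \<theta>)) +
      of_real (g (axis j \<i>)) * ((- \<i> / 2) * (chi (axis j 1) \<theta> + (- 1) * chi (- axis j 1) \<theta>)))" for \<theta>
  proof -
    have c: "chi (- axis j 1) \<theta> = cnj (torus_point \<theta> $ j)" for j
      by (simp add: chi_uminus[symmetric] chi_coord torus_point_def cis_cnj)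
    have "g (torus_point \<theta>) =
        (\<Sum>j\<in>UNIV. Re (torus_point \<theta> $ j) * g (axis j 1) + Im (torus_point \<theta> $ j) * g (axis j \<i>))"
      by (subst (1) complex_vec_basis_expansion) (simp add: sum add scaleR)
    then show ?thesis
      unfolding c chi_coord by (auto intro!: sum.cong simp: complex_eq_iff)
  qed
  then show ?case by (simp only:) (intro trigpoly_sum trigpoly.intros)
next
  case (const c)
  then show ?case by (rule trigpoly_const)
next
  case (add g g')
  then show ?case using trigpoly.add[OF add.IH] by simp
next
  case (mult g g')
  then show ?case using trigpoly_mult[OF mult.IH] by simp
qed

lemma periodic_emb:
  assumes per: "\<And>\<theta> j. f (\<theta> + axis j 1) = f \<theta>"
  shows "f (\<theta> + emb p) = f \<theta>"
proof -
  have nat: "f (\<theta> + real n *\<^sub>R axis j 1) = f \<theta>" for n j \<theta>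
  proof (induction n)
    case (Suc n)
    then show ?case using per[of "\<theta> + real n *\<^sub>R axis j 1" j] by (simp add: algebra_simps)
  qed simp
  have int: "f (\<theta> + of_int m *\<^sub>R axis j 1) = f \<theta>" for m j \<theta>
  proof (cases m rule: int_cases2)
    case (nonneg n)
    then show ?thesis using nat by simp
  next
    case (nonpos n)
    then show ?thesis using nat[of "\<theta> + of_int m *\<^sub>R axis j 1" n j] by simp
  qed
  have "f (\<theta> + (\<Sum>j\<in>J. of_int (p $ j) *\<^sub>R axis j 1)) = f \<theta>" if "finite J" for J
    using that
  proof induction
    case (insert j J)
    then show ?case
      using int[of "\<theta> + (\<Sum>j\<in>J. of_int (p $ j) *\<^sub>R axis j 1)" "p $ j" j] by (simp add: algebra_simps)
  qed simp
  moreover have "(\<Sum>j\<in>UNIV. of_int (p $ j) *\<^sub>R axis j 1) = emb p"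
    using basis_expansion[of "emb p"] by (simp add: scalar_mult_eq_scaleR)
  ultimately show ?thesis using finite[of "UNIV :: 'a set"] by fastforce
qed

lemma torus_point_eqD:
  assumes "torus_point \<theta> = torus_point \<eta>"
  obtains p where "\<theta> = \<eta> + emb p"
proof -
  have "\<exists>n::int. \<theta> $ j = \<eta> $ j + of_int n" for j
  proof -
    have "cis (2 * pi * \<theta> $ j) = cis (2 * pi * \<eta> $ j)"
      using assms by (simp add: torus_point_def vec_eq_iff)
    then obtain n :: int where "2 * pi * \<theta> $ j = 2 * pi * \<eta> $ j + 2 * pi * of_int n"
      using sin_cos_eq_iff[of "2 * pi * \<theta> $ j" "2 * pi * \<eta> $ j"] by (auto simp: complex_eq_iff)
    then have "2 * pi * \<theta> $ j = 2 * pi * (\<eta> $ j + of_int n)" by (simp add: algebra_simps)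
    then show ?thesis by auto
  qed
  then obtain n where "\<And>j. \<theta> $ j = \<eta> $ j + of_int (n j)" by metis
  then have "\<theta> = \<eta> + emb (\<chi> j. n j)" by (simp add: vec_eq_iff)
  then show thesis by (rule that)
qed

text \<open>\<open>torus_point\<close> maps the compact cube continuously onto its image and is
  therefore a quotient map, so continuity of \<open>F\<close> can be tested on the cube. The
  preimage picked by \<open>inv_into\<close> is immaterial: two preimages differ by an integer
  vector.\<close>

lemma periodic_descends:
  fixes f :: "real ^ 'n::finite \<Rightarrow> complex"
  assumes cont: "continuous_on UNIV f" and per: "\<And>\<theta> j. f (\<theta> + axis j 1) = f \<theta>"
  obtains F where "continuous_on (torus_point ` cube) F" "\<And>\<theta>. \<theta> \<in> cube \<Longrightarrow> F (torus_point \<theta>) = f \<theta>"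
proof -
  define F where "F z = f (inv_into cube torus_point z)" for z
  have F: "F (torus_point \<theta>) = f \<theta>" if "\<theta> \<in> cube" for \<theta>
  proof -
    have "torus_point (inv_into cube torus_point (torus_point \<theta>)) = torus_point \<theta>"
      using that by (intro f_inv_into_f) auto
    then obtain p where "inv_into cube torus_point (torus_point \<theta>) = \<theta> + emb p"
      by (rule torus_point_eqD)
    then show ?thesis using periodic_emb[OF per] by (simp add: F_def)
  qed
  have "openin (top_of_set (torus_point ` cube)) (torus_point ` cube \<inter> F -` T)" if "open T" for T
  proof -
    have "cube \<inter> torus_point -` (torus_point ` cube \<inter> F -` T) = cube \<inter> f -` T"
      by (auto simp: F) (metis F imageI)
    moreover have "openin (top_of_set cube) (cube \<inter> f -` T)"
      using continuous_on_subset[OF cont] that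
      by (metis continuous_openin_preimage_eq subset_UNIV)
    ultimately show ?thesis
      using Abstract_Topology_2.continuous_imp_quotient_map[OF continuous_torus_point refl,
          of cube "torus_point ` cube \<inter> F -` T"] by auto
  qed
  then have "continuous_on (torus_point ` cube) F" by (simp add: continuous_openin_preimage_eq)
  then show thesis using F that by blast
qed

text \<open>\<open>f\<close> is orthogonal to all trigonometric polynomials. Approximating its
  conjugate uniformly by these shows that the square of its modulus has integral 0.\<close>

lemma fourier_uniqueness:
  fixes f :: "real ^ 'n::finite \<Rightarrow> complex"
  assumes cont: "continuous_on UNIV f" and per: "\<And>\<theta> j. f (\<theta> + axis j 1) = f \<theta>"
    and fourier_coeff: "\<And>p. fourier_coeff f p = 0"
  shows "f \<theta> = 0"
proof -
  note [continuous_intros] = continuous_on_subset[OF cont subset_UNIV]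
  obtain F where contF: "continuous_on (torus_point ` cube) F"
    and F: "\<And>\<theta>. \<theta> \<in> cube \<Longrightarrow> F (torus_point \<theta>) = f \<theta>"
    using periodic_descends[OF cont per] by metis
  have "compact (f ` cube)" by (intro compact_continuous_image continuous_intros) auto
  then obtain B where "\<forall>z\<in>f ` cube. cmod z \<le> B" by (meson bounded_iff compact_imp_bounded)
  then have B: "cmod (f \<theta>) \<le> max B 0" if "\<theta> \<in> cube" for \<theta> using that by fastforce
  have "cmod (integral cube (\<lambda>\<theta>. cnj (f \<theta>) * f \<theta>)) \<le> e * max B 0" if e: "e > 0" for e
  proof -
    have "compact (torus_point ` (cube :: (real ^ 'n) set))"
      by (intro compact_continuous_image continuous_torus_point) auto
    moreover have "continuous_on (torus_point ` cube) (\<lambda>z. cnj (F z))"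
      by (intro continuous_intros contF)
    ultimately obtain g where g: "polynomial_function g"
      and approx: "\<And>z. z \<in> torus_point ` cube \<Longrightarrow> cmod (cnj (F z) - g z) < e"
      using Stone_Weierstrass_polynomial_function e by metis
    \<comment> \<open>The transfer from polynomials to \<open>trigpoly\<close> is for real
      functions, hence the splitting of \<open>g\<close> into its real and imaginary parts.\<close>
    define t where "t \<theta> = of_real (Re (g (torus_point \<theta>))) + \<i> * of_real (Im (g (torus_point \<theta>)))" for \<theta>
    have t: "t \<theta> = g (torus_point \<theta>)" for \<theta> by (simp add: t_def complex_eq_iff)
    have "real_polynomial_function (Re \<circ> g)" "real_polynomial_function (Im \<circ> g)"
      using g bounded_linear_Re bounded_linear_Im unfolding polynomial_function_def by auto
    then have tp: "trigpoly t"
      unfolding t_def using trigpoly_real_polynomial by (intro trigpoly.intros) fastforce+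
    have "((\<lambda>\<theta>. cnj (f \<theta>) * f \<theta> - t \<theta> * f \<theta>) has_integral
        (integral cube (\<lambda>\<theta>. cnj (f \<theta>) * f \<theta>) - integral cube (\<lambda>\<theta>. t \<theta> * f \<theta>))) cube"
      by (intro has_integral_diff integrable_integral integrable_continuous continuous_intros
          trigpoly_continuous tp)
    then have "cmod (integral cube (\<lambda>\<theta>. cnj (f \<theta>) * f \<theta>) - integral cube (\<lambda>\<theta>. t \<theta> * f \<theta>))
        \<le> (e * max B 0) * measure lborel (cube :: (real ^ 'n) set)"
    proof (rule has_integral_bound[rotated])
      fix \<theta> :: "real ^ 'n" assume \<theta>: "\<theta> \<in> cube"
      have "cmod ((cnj (f \<theta>) - t \<theta>) * f \<theta>) \<le> e * max B 0"
        unfolding norm_mult using approx[of "torus_point \<theta>"] B[OF \<theta>] \<theta> e F[OF \<theta>]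
        by (intro mult_mono) (auto simp: t)
      then show "cmod (cnj (f \<theta>) * f \<theta> - t \<theta> * f \<theta>) \<le> e * max B 0"
        by (simp add: left_diff_distrib)
    qed (use e in auto)
    then show ?thesis using integral_trigpoly_eq_0[OF tp cont fourier_coeff] by simp
  qed
  then have "cmod (integral cube (\<lambda>\<theta>. cnj (f \<theta>) * f \<theta>)) \<le> 0 + e" if "e > 0" for e
  proof -
    have "e / (max B 0 + 1) > 0" using that by (simp add: add_nonneg_pos)
    from \<open>\<And>e. e > 0 \<Longrightarrow> _ e\<close>[OF this]
    have "cmod (integral cube (\<lambda>\<theta>. cnj (f \<theta>) * f \<theta>)) \<le> e / (max B 0 + 1) * max B 0" .
    also have "\<dots> \<le> e" using that by (simp add: field_simps)
    finally show ?thesis by simp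
  qed
  then have "cmod (integral cube (\<lambda>\<theta>. cnj (f \<theta>) * f \<theta>)) \<le> 0" by (rule field_le_epsilon)
  then have 0: "integral cube (\<lambda>\<theta>. cnj (f \<theta>) * f \<theta>) = 0" by simp
  have "((\<lambda>\<theta>. cnj (f \<theta>) * f \<theta>) has_integral 0) cube"
    using integrable_integral[of "\<lambda>\<theta>. cnj (f \<theta>) * f \<theta>" cube] unfolding 0
    by (simp add: integrable_continuous continuous_intros)
  from has_integral_linear[OF this bounded_linear_Re]
  have "((\<lambda>\<theta>. (cmod (f \<theta>))\<^sup>2) has_integral 0) cube"
    by (simp add: o_def cmod_power2 flip: power2_eq_square)
  \<comment> \<open>A continuous nonnegative function with integral 0 vanishes on the closed cube,
    whose interior is nonempty.\<close>
  then have "(cmod (f \<theta>))\<^sup>2 = 0" if "\<theta> \<in> cube" for \<theta>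
    by (rule has_integral_0_cbox_imp_0[rotated 2])
      (use that box_cube_nonempty in \<open>auto intro!: continuous_intros\<close>)
  then have cube0: "f \<theta> = 0" if "\<theta> \<in> cube" for \<theta> using that by simp
  \<comment> \<open>Fractional parts move an arbitrary point into the cube by an integer
    vector.\<close>
  have "f \<theta> = f ((\<chi> j. frac (\<theta> $ j)) + emb (\<chi> j. \<lfloor>\<theta> $ j\<rfloor>))"
    by (rule arg_cong[where f = f]) (simp add: vec_eq_iff frac_def)
  also have "\<dots> = f (\<chi> j. frac (\<theta> $ j))" by (rule periodic_emb[OF per])
  also have "\<dots> = 0"
    by (rule cube0) (simp add: mem_box_cart frac_lt_1 less_imp_le)
  finally show ?thesis .
qed

text \<open>The absolutely convergent series has the same coefficients as \<open>f\<close>, and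
  uniqueness applies to the difference.\<close>

lemma fourier_inversion:
  assumes f: "smooth_torus f"
  shows "f = fourier_series (fourier_coeff f)"
proof
  fix \<theta>
  note r = rapid_fourier_coeff[OF f]
  note [continuous_intros] = continuous_on_subset[OF smooth_torusD(1)[OF f] subset_UNIV]
  have "f \<theta> - fourier_series (fourier_coeff f) \<theta> = 0"
  proof (rule fourier_uniqueness)
    show "continuous_on UNIV (\<lambda>\<theta>. f \<theta> - fourier_series (fourier_coeff f) \<theta>)"
      by (intro continuous_intros continuous_fourier_series r)
    show "f (\<theta> + axis j 1) - fourier_series (fourier_coeff f) (\<theta> + axis j 1) = f \<theta> - fourier_series (fourier_coeff f) \<theta>" for \<theta> j
      using smooth_torusD(3)[OF f] by (simp add: fourier_series_periodic)
    show "fourier_coeff (\<lambda>\<theta>. f \<theta> - fourier_series (fourier_coeff f) \<theta>) p = 0" for p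
    proof -
      have "fourier_coeff (\<lambda>\<theta>. f \<theta> - fourier_series (fourier_coeff f) \<theta>) p = fourier_coeff f p - fourier_coeff (fourier_series (fourier_coeff f)) p"
        unfolding fourier_coeff_def[of _ p] right_diff_distrib
        by (intro integral_diff integrable_continuous continuous_intros continuous_fourier_series r)
      then show ?thesis using fourier_coeff_fourier_series[OF rapid_abs_summable[OF r]] by simp
    qed
  qed
  then show "f \<theta> = fourier_series (fourier_coeff f) \<theta>" by simp
qed

section \<open>Symbols in terms of their Fourier coefficients\<close>

subsection \<open>Differences on the integer lattice\<close>

text \<open>Without the division by \<open>h\<close>: the powers of \<open>h\<close> are split off
  once, and what remains is calculus on the integer lattice.\<close>

definition lat_diff1 :: "'n \<Rightarrow> (int ^ 'n \<Rightarrow> complex) \<Rightarrow> int ^ 'n \<Rightarrow> complex" where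
  "lat_diff1 j g x = g (x + axis j 1) - g x"

definition lat_diff :: "('n::finite \<Rightarrow> nat) \<Rightarrow> (int ^ 'n \<Rightarrow> complex) \<Rightarrow> int ^ 'n \<Rightarrow> complex" where
  "lat_diff \<alpha> = foldr (\<lambda>j. lat_diff1 j ^^ \<alpha> j) coords"

lemma lat_diff1_commute: "lat_diff1 i (lat_diff1 j g) = lat_diff1 j (lat_diff1 i g)"
  by (simp add: lat_diff1_def fun_eq_iff algebra_simps)

lemma foldr_funpow_commute:
  assumes comm: "\<And>i j g. F i (F j g) = F j (F i g)"
  shows "(F i ^^ m) (foldr (\<lambda>j. F j ^^ \<alpha> j) js g) = foldr (\<lambda>j. F j ^^ \<alpha> j) js ((F i ^^ m) g)"
proof -
  have 1: "F i ((F j ^^ n) g) = (F j ^^ n) (F i g)" for i j n g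
    by (induction n) (simp_all add: comm[of i j])
  have 2: "F i (foldr (\<lambda>j. F j ^^ \<alpha> j) js g) = foldr (\<lambda>j. F j ^^ \<alpha> j) js (F i g)" for i g
    by (induction js) (simp_all add: 1)
  show ?thesis by (induction m) (simp_all add: 2)
qed

lemma foldr_funpow_add:
  assumes comm: "\<And>i j g. F i (F j g) = F j (F i g)"
  shows "foldr (\<lambda>j. F j ^^ \<alpha> j) js (foldr (\<lambda>j. F j ^^ \<beta> j) js g) = foldr (\<lambda>j. F j ^^ (\<alpha> j + \<beta> j)) js g"
  by (induction js) (simp_all add: funpow_add foldr_funpow_commute[of F, OF comm, symmetric])

lemma lat_diff_lat_diff: "lat_diff \<alpha> (lat_diff \<beta> g) = lat_diff (\<lambda>j. \<alpha> j + \<beta> j) g"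
  unfolding lat_diff_def by (rule foldr_funpow_add) (rule lat_diff1_commute)

lemma lat_diff_0: "lat_diff (\<lambda>_. 0) g = g"
proof -
  have "foldr (\<lambda>j. lat_diff1 j ^^ 0) js g = g" for js by (induction js) auto
  then show ?thesis by (simp add: lat_diff_def)
qed

definition mi_unit :: "'n \<Rightarrow> 'n \<Rightarrow> nat" where
  "mi_unit j = (\<lambda>i. if i = j then 1 else 0)"

lemma mi_size_unit [simp]: "mi_size (mi_unit j) = 1"
  by (simp add: mi_size_def mi_unit_def)

lemma mi_size_add: "mi_size (\<lambda>j. \<alpha> j + \<beta> j) = mi_size \<alpha> + mi_size \<beta>"
  by (simp add: mi_size_def sum.distrib)

lemma mi_size_0 [simp]: "mi_size (\<lambda>_. 0) = 0"
  by (simp add: mi_size_def)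

lemma mi_size_fun_upd: "mi_size (\<alpha>(j := Suc (\<alpha> j))) = Suc (mi_size \<alpha>)"
proof -
  have "\<alpha>(j := Suc (\<alpha> j)) = (\<lambda>i. \<alpha> i + mi_unit j i)" by (auto simp: mi_unit_def)
  then show ?thesis by (simp only: mi_size_add mi_size_unit)
qed

lemma lat_diff_unit:
  fixes j :: "'n::finite"
  shows "lat_diff (mi_unit j) g = lat_diff1 j g"
proof -
  have "foldr (\<lambda>i. lat_diff1 i ^^ mi_unit j i) js g = (if j \<in> set js then lat_diff1 j g else g)" if "distinct js" for js
    using that by (induction js) (auto simp: mi_unit_def)
  from this[of coords] show ?thesis using coords[where 'n = 'n] by (simp add: lat_diff_def)
qed

text \<open>A fixed finite combination of shifts, independent of \<open>g\<close> and
  \<open>x\<close>. Linearity, compatibility with shifts and the interchange with Fourier series can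
  all be read off from this form without an induction over the multi-index.\<close>

lemma lat_diff_repr:
  fixes \<alpha> :: "'n::finite \<Rightarrow> nat"
  shows "\<exists>m w q. \<forall>g x. lat_diff \<alpha> g x = (\<Sum>i<(m::nat). w i * g (x + q i))"
proof -
  \<comment> \<open>Weighted shifts are collected in a list, so that a further difference is the
    concatenation of a shifted and a negated copy.\<close>
  let ?P = "\<lambda>T :: (int ^ 'n \<Rightarrow> complex) \<Rightarrow> int ^ 'n \<Rightarrow> complex.
    \<exists>l. \<forall>g x. T g x = sum_list (map (\<lambda>(w, q). w * g (x + q)) l)"
  have step: "?P (\<lambda>g. lat_diff1 j (T g))" if T: "?P T" for T j
  proof -
    obtain l where l: "\<And>g x. T g x = sum_list (map (\<lambda>(w, q). w * g (x + q)) l)" using T by blast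
    have neg: "(\<Sum>z\<leftarrow>l. - (fst z * g (x + snd z))) = - (\<Sum>z\<leftarrow>l. fst z * g (x + snd z))"
      for g :: "int ^ 'n \<Rightarrow> complex" and x
      by (induction l) auto
    show ?thesis
    proof (intro exI allI)
      fix g x
      show "lat_diff1 j (T g) x = sum_list (map (\<lambda>(w, q). w * g (x + q))
          (map (\<lambda>(w, q). (w, axis j 1 + q)) l @ map (\<lambda>(w, q). (- w, q)) l))"
        by (simp add: lat_diff1_def l o_def split_beta neg add.assoc case_prod_unfold)
    qed
  qed
  have pow: "?P (\<lambda>g. (lat_diff1 j ^^ n) (T g))" if "?P T" for T j n
    by (induction n) (use that step in auto)
  have "?P (foldr (\<lambda>j. lat_diff1 j ^^ \<alpha> j) js)" for js
  proof (induction js)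
    case Nil
    show ?case by (rule exI[of _ "[(1, 0)]"]) simp
  next
    case (Cons j js)
    then show ?case using pow by (simp add: o_def)
  qed
  then obtain l where l: "\<And>g x. lat_diff \<alpha> g x = sum_list (map (\<lambda>(w, q). w * g (x + q)) l)"
    unfolding lat_diff_def by blast
  have "lat_diff \<alpha> g x = (\<Sum>i<length l. fst (l ! i) * g (x + snd (l ! i)))" for g x
    by (simp add: l sum_list_sum_nth split_beta atLeast0LessThan)
  then show ?thesis
    by (intro exI[of _ "length l"] exI[of _ "\<lambda>i. fst (l ! i)"] exI[of _ "\<lambda>i. snd (l ! i)"]) blast
qed

lemma lat_diff_cmult: "lat_diff \<alpha> (\<lambda>y. c * g y) x = c * lat_diff \<alpha> g x"
proof -
  obtain m w q where "\<And>g x. lat_diff \<alpha> g x = (\<Sum>i<(m::nat). w i * g (x + q i))" using lat_diff_repr[of \<alpha>] by blast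
  then show ?thesis by (simp add: sum_distrib_left mult_ac)
qed

lemma lat_diff_diff: "lat_diff \<alpha> (\<lambda>y. f y - g y) x = lat_diff \<alpha> f x - lat_diff \<alpha> g x"
proof -
  obtain m w q where "\<And>g x. lat_diff \<alpha> g x = (\<Sum>i<(m::nat). w i * g (x + q i))" using lat_diff_repr[of \<alpha>] by blast
  then show ?thesis by (simp add: sum_subtractf right_diff_distrib)
qed

lemma lat_diff_sum: "lat_diff \<alpha> (\<lambda>y. \<Sum>i\<in>I. g i y) x = (\<Sum>i\<in>I. lat_diff \<alpha> (g i) x)"
proof -
  obtain m w q where r: "\<And>g x. lat_diff \<alpha> g x = (\<Sum>i<(m::nat). w i * g (x + q i))" using lat_diff_repr[of \<alpha>] by blast
  show ?thesis unfolding r sum_distrib_left by (rule sum.swap)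
qed

lemma lat_diff_shift: "lat_diff \<alpha> (\<lambda>y. g (y + p)) x = lat_diff \<alpha> g (x + p)"
proof -
  obtain m w q where "\<And>g x. lat_diff \<alpha> g x = (\<Sum>i<(m::nat). w i * g (x + q i))" using lat_diff_repr[of \<alpha>] by blast
  then show ?thesis by (simp add: algebra_simps)
qed

lemma rapid_lat_diff: "(\<And>x. rapid (a x)) \<Longrightarrow> rapid (\<lambda>p. lat_diff \<alpha> (\<lambda>y. a y p) x)"
proof -
  obtain m w q where "\<And>g x. lat_diff \<alpha> g x = (\<Sum>i<(m::nat). w i * g (x + q i))" using lat_diff_repr[of \<alpha>] by blast
  then show "(\<And>x. rapid (a x)) \<Longrightarrow> ?thesis" by (simp add: rapid_sum rapid_cmult)
qed

lemma lat_diff_fourier_series: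
  assumes "\<And>x. rapid (a x)"
  shows "lat_diff \<alpha> (\<lambda>y. fourier_series (a y) \<theta>) x = fourier_series (\<lambda>p. lat_diff \<alpha> (\<lambda>y. a y p) x) \<theta>"
proof -
  obtain m w q where r: "\<And>g x. lat_diff \<alpha> g x = (\<Sum>i<(m::nat). w i * g (x + q i))" using lat_diff_repr[of \<alpha>] by blast
  show ?thesis unfolding r by (subst fourier_series_sum) (simp_all add: fourier_series_cmult rapid_cmult assms)
qed

section \<open>Passage from the scaled lattice to integer vectors\<close>

lemma hlattice_eq: "hlattice h = range (\<lambda>x. h *\<^sub>R emb x)"
proof -
  have "\<exists>x. k = emb x" if "\<And>j. k $ j \<in> \<int>" for k :: "real ^ 'a"
  proof -
    have "k = emb (\<chi> j. \<lfloor>k $ j\<rfloor>)" using that by (auto simp: vec_eq_iff elim!: Ints_cases)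
    then show ?thesis by blast
  qed
  moreover have "emb x $ j \<in> \<int>" for x :: "int ^ 'a" and j by simp
  ultimately show ?thesis unfolding hlattice_def by blast
qed

lemma inj_scaled_emb: "h \<noteq> 0 \<Longrightarrow> inj (\<lambda>x. h *\<^sub>R emb x)"
  using inj_emb by (auto simp: inj_on_def)

lemma diff_op_lat_diff:
  fixes h :: real and \<alpha> :: "'n::finite \<Rightarrow> nat"
  shows "diff_op h \<alpha> g (h *\<^sub>R emb x) = lat_diff \<alpha> (\<lambda>y. g (h *\<^sub>R emb y)) x / of_real (h ^ mi_size \<alpha>)"
proof -
  \<comment> \<open>The power \<open>h ^ m\<close> already accumulated is part of the premise, so
    that a single difference, its iterates and the fold over the coordinates can be chained.\<close>
  have 1: "diff1 h j G (h *\<^sub>R emb x) = lat_diff1 j G' x / of_real (h ^ Suc m)"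
    if "\<And>x. G (h *\<^sub>R emb x) = G' x / of_real (h ^ m)" for G G' j m x
  proof -
    have "h *\<^sub>R emb x + h *\<^sub>R axis j 1 = h *\<^sub>R emb (x + axis j 1)"
      by (simp add: emb_add emb_axis scaleR_add_right)
    then show ?thesis by (simp add: diff1_def lat_diff1_def that diff_divide_distrib mult.commute)
  qed
  have 2: "(diff1 h j ^^ n) G (h *\<^sub>R emb x) = (lat_diff1 j ^^ n) G' x / of_real (h ^ (n + m))"
    if "\<And>x. G (h *\<^sub>R emb x) = G' x / of_real (h ^ m)" for G G' j m n x
  proof (induction n arbitrary: x)
    case (Suc n)
    then show ?case using 1[of "(diff1 h j ^^ n) G" "(lat_diff1 j ^^ n) G'" "n + m", OF Suc] by simp
  qed (use that in simp)
  have 3: "foldr (\<lambda>j. diff1 h j ^^ \<alpha> j) js g (h *\<^sub>R emb x) =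
      foldr (\<lambda>j. lat_diff1 j ^^ \<alpha> j) js (\<lambda>y. g (h *\<^sub>R emb y)) x / of_real (h ^ sum_list (map \<alpha> js))" for js x
  proof (induction js arbitrary: x)
    case (Cons j js)
    then show ?case 
      using 2[of "foldr (\<lambda>j. diff1 h j ^^ \<alpha> j) js g"
        "foldr (\<lambda>j. lat_diff1 j ^^ \<alpha> j) js (\<lambda>y. g (h *\<^sub>R emb y))", OF Cons.IH] by simp
  qed simp
  have "sum_list (map \<alpha> coords) = mi_size \<alpha>"
    using coords[where 'n = 'n] by (simp add: sum_list_distinct_conv_sum_set mi_size_def)
  then show ?thesis unfolding diff_op_def lat_diff_def 3 by simp
qed

subsection \<open>Polynomial Fourier multipliers\<close>

definition falling_fact :: "('n::finite \<Rightarrow> nat) \<Rightarrow> int ^ 'n \<Rightarrow> complex" where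
  "falling_fact \<beta> p = (\<Prod>j\<in>UNIV. \<Prod>l<\<beta> j. (of_int (p $ j) - of_nat l))"

lemma tor_factor_fourier_series:
  assumes "rapid a"
  shows "tor_factor j l (fourier_series a) = fourier_series (\<lambda>p. (of_int (p $ j) - of_nat l) * a p)"
proof
  fix \<theta>
  have "tor_factor j l (fourier_series a) \<theta> = fourier_series (\<lambda>p. of_int (p $ j) * a p) \<theta> - fourier_series (\<lambda>p. of_nat l * a p) \<theta>"
    unfolding tor_factor_def partial_fourier_series[OF assms] fourier_series_cmult by simp
  also have "\<dots> = fourier_series (\<lambda>p. of_int (p $ j) * a p - of_nat l * a p) \<theta>"
    using assms by (intro fourier_series_diff[symmetric] rapid_cmult rapid_coord)
  finally show "tor_factor j l (fourier_series a) \<theta> = fourier_series (\<lambda>p. (of_int (p $ j) - of_nat l) * a p) \<theta>"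
    by (simp add: left_diff_distrib)
qed

text \<open>Both claims go through the induction together: differentiating the series once more
  presupposes that its current coefficients decrease rapidly.\<close>

lemma foldr_tor_factor_fourier_series:
  assumes "rapid a"
  shows "rapid (\<lambda>p. (\<Prod>l\<leftarrow>ls. of_int (p $ j) - of_nat l) * a p) \<and>
    foldr (tor_factor j) ls (fourier_series a) = fourier_series (\<lambda>p. (\<Prod>l\<leftarrow>ls. of_int (p $ j) - of_nat l) * a p)"
proof (induction ls)
  case (Cons l ls)
  let ?b = "\<lambda>p. (\<Prod>l\<leftarrow>ls. of_int (p $ j) - of_nat l) * a p"
  have b: "rapid ?b" using Cons by simp
  have "rapid (\<lambda>p. of_int (p $ j) * ?b p - of_nat l * ?b p)"
    by (intro rapid_diff rapid_coord rapid_cmult b)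
  then have "rapid (\<lambda>p. (of_int (p $ j) - of_nat l) * ?b p)" by (simp only: left_diff_distrib)
  moreover have "foldr (tor_factor j) (l # ls) (fourier_series a) = fourier_series (\<lambda>p. (of_int (p $ j) - of_nat l) * ?b p)"
    using Cons by (simp add: tor_factor_fourier_series)
  ultimately show ?case by (simp add: mult.assoc)
qed (simp add: assms)

lemma tor_op_fourier_series:
  fixes a :: "int ^ 'n::finite \<Rightarrow> complex"
  assumes "rapid a"
  shows "rapid (\<lambda>p. falling_fact \<beta> p * a p)"
    and "tor_op h \<beta> (fourier_series a) \<theta> = of_real (h ^ mi_size \<beta>) * fourier_series (\<lambda>p. falling_fact \<beta> p * a p) \<theta>"
proof -
  let ?f = "\<lambda>j p. \<Prod>l\<leftarrow>[0..<\<beta> j]. (of_int (p $ j) - of_nat l :: complex)"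
  have *: "rapid (\<lambda>p. (\<Prod>j\<leftarrow>js. ?f j p) * a p) \<and>
      foldr (\<lambda>j. foldr (tor_factor j) [0..<\<beta> j]) js (fourier_series a) = fourier_series (\<lambda>p. (\<Prod>j\<leftarrow>js. ?f j p) * a p)" for js
  proof (induction js)
    case (Cons j js)
    then have "rapid (\<lambda>p. (\<Prod>j\<leftarrow>js. ?f j p) * a p)" by blast
    from foldr_tor_factor_fourier_series[OF this, of j "[0..<\<beta> j]"] Cons show ?case by (simp add: mult.assoc)
  qed (simp add: assms)
  have "(\<Prod>j\<leftarrow>coords. ?f j p) = falling_fact \<beta> p" for p :: "int ^ 'n"
    using coords(1)[where 'n = 'n]
    by (simp add: falling_fact_def prod.distinct_set_conv_list[symmetric] coords(2) atLeast0LessThan)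
  with *[of coords] show "rapid (\<lambda>p. falling_fact \<beta> p * a p)"
    and "tor_op h \<beta> (fourier_series a) \<theta> = of_real (h ^ mi_size \<beta>) * fourier_series (\<lambda>p. falling_fact \<beta> p * a p) \<theta>"
    by (simp_all add: tor_op_def)
qed

text \<open>Polynomials of degree at most \<open>m\<close>, generated by coordinate multiplication;
  the degree bound later counts the losses of \<open>\<delta>\<close> in the symbol order.\<close>

inductive polyfun :: "nat \<Rightarrow> (int ^ 'n::finite \<Rightarrow> complex) \<Rightarrow> bool" where
  const: "polyfun m (\<lambda>_. c)"
| add: "polyfun m q \<Longrightarrow> polyfun m r \<Longrightarrow> polyfun m (\<lambda>p. q p + r p)"
| coord: "polyfun m q \<Longrightarrow> polyfun (Suc m) (\<lambda>p. of_int (p $ j) * q p)"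

lemma polyfun_Suc: "polyfun m q \<Longrightarrow> polyfun (Suc m) q"
  by (induction rule: polyfun.induct) (auto intro: polyfun.intros)

lemma polyfun_mono: "polyfun m q \<Longrightarrow> m \<le> n \<Longrightarrow> polyfun n q"
  by (induction n) (auto simp: le_Suc_eq polyfun_Suc)

lemma polyfun_cmult: "polyfun m q \<Longrightarrow> polyfun m (\<lambda>p. c * q p)"
proof (induction rule: polyfun.induct)
  case (const m d)
  then show ?case by (rule polyfun.const)
next
  case (add m q r)
  then show ?case using polyfun.add[OF add.IH] by (simp add: distrib_left)
next
  case (coord m q j)
  then show ?case using polyfun.coord[OF coord.IH, of j] by (simp add: mult.left_commute)
qed

lemma polyfun_mult: "polyfun m q \<Longrightarrow> polyfun n r \<Longrightarrow> polyfun (m + n) (\<lambda>p. q p * r p)"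
proof (induction rule: polyfun.induct)
  case (const m c)
  then show ?case by (intro polyfun_cmult) (erule polyfun_mono, simp)
next
  case (add m q q')
  then show ?case using polyfun.add[of "m + n" "\<lambda>p. q p * r p" "\<lambda>p. q' p * r p"] by (simp add: distrib_right)
next
  case (coord m q j)
  then show ?case using polyfun.coord[of "m + n" "\<lambda>p. q p * r p" j] by (simp add: mult.assoc)
qed

text \<open>Needed for \<open>\<theta> \<mapsto> - \<theta>\<close>: the falling factorial of
  \<open>- p\<close> is in general no falling factorial of \<open>p\<close>, but it is a polynomial
  of the same degree.\<close>

lemma polyfun_reflect: "polyfun m q \<Longrightarrow> polyfun m (\<lambda>p. q (- p))"
proof (induction rule: polyfun.induct)
  case (const m c)
  then show ?case by (rule polyfun.const)
next
  case (add m q r)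
  then show ?case using polyfun.add[OF add.IH] by simp
next
  case (coord m q j)
  then show ?case using polyfun_cmult[OF polyfun.coord[OF coord.IH, of j], of "- 1"] by simp
qed

lemma polyfun_growth: "polyfun m q \<Longrightarrow> \<exists>D. \<forall>p. cmod (q p) \<le> D * weight p ^ m"
proof (induction rule: polyfun.induct)
  case (const m c)
  have "cmod c * 1 \<le> cmod c * weight p ^ m" for p :: "int ^ 'a"
    by (intro mult_left_mono one_le_power weight_ge_1) auto
  then show ?case by auto
next
  case (add m q r)
  then obtain D E where "\<And>p. cmod (q p) \<le> D * weight p ^ m" "\<And>p. cmod (r p) \<le> E * weight p ^ m" by blast
  then have "cmod (q p + r p) \<le> (D + E) * weight p ^ m" for p
    unfolding distrib_right by (intro norm_triangle_le add_mono)
  then show ?case by blast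
next
  case (coord m q j)
  then obtain D where D: "\<And>p. cmod (q p) \<le> D * weight p ^ m" by blast
  have "cmod (of_int (p $ j) * q p) \<le> D * weight p ^ Suc m" for p
  proof -
    have "cmod (of_int (p $ j) * q p) \<le> weight p * (D * weight p ^ m)"
      unfolding norm_mult by (intro mult_mono D) (auto simp: abs_nth_le_weight)
    then show ?thesis by (simp add: mult_ac)
  qed
  then show ?case by blast
qed

lemma polyfun_prod: "finite I \<Longrightarrow> (\<And>i. i \<in> I \<Longrightarrow> polyfun (m i) (q i)) \<Longrightarrow> polyfun (\<Sum>i\<in>I. m i) (\<lambda>p. \<Prod>i\<in>I. q i p)"
  by (induction I rule: finite_induct) (simp_all add: polyfun.const polyfun_mult)

lemma polyfun_falling_fact: "polyfun (mi_size \<beta>) (falling_fact \<beta>)"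
proof -
  have 1: "polyfun (Suc 0) (\<lambda>p. of_int (p $ j) - of_nat l)" for j l
    using polyfun.add[OF polyfun.coord[OF polyfun.const[of 0 1], of j] polyfun.const[of _ "- of_nat l"]] by simp
  have "polyfun (\<Sum>l<\<beta> j. 1) (\<lambda>p. \<Prod>l<\<beta> j. of_int (p $ j) - of_nat l)" for j
    by (rule polyfun_prod) (use 1 in auto)
  then have "polyfun (\<Sum>j\<in>UNIV. \<Sum>l<\<beta> j. 1) (\<lambda>p. \<Prod>j\<in>UNIV. \<Prod>l<\<beta> j. of_int (p $ j) - of_nat l)"
    by (rule polyfun_prod[rotated]) auto
  then show ?thesis by (simp add: mi_size_def falling_fact_def[abs_def])
qed

lemma polyfun_coord_power: "polyfun m (\<lambda>p. of_int (p $ j) ^ m)"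
proof (induction m)
  case (Suc m)
  then show ?case using polyfun.coord[OF Suc, of j] by simp
qed (simp add: polyfun.const)

lemma falling_fact_fun_upd: "falling_fact (\<beta>(j := Suc (\<beta> j))) p = (of_int (p $ j) - of_nat (\<beta> j)) * falling_fact \<beta> p"
proof -
  have "falling_fact \<gamma> p = (\<Prod>l<\<gamma> j. of_int (p $ j) - of_nat l) * (\<Prod>i\<in>UNIV - {j}. \<Prod>l<\<gamma> i. of_int (p $ i) - of_nat l)"
    for \<gamma> unfolding falling_fact_def by (rule prod.remove) auto
  then show ?thesis by (simp add: mult_ac)
qed

text \<open>Falling factorials span all polynomials, so the symbol estimates, stated for the toroidal operators
  only, extend to every polynomial Fourier multiplier.\<close>

inductive falling_fact_span :: "nat \<Rightarrow> (int ^ 'n::finite \<Rightarrow> complex) \<Rightarrow> bool" where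
  falling_fact: "mi_size \<beta> \<le> m \<Longrightarrow> falling_fact_span m (falling_fact \<beta>)"
| cmult: "falling_fact_span m q \<Longrightarrow> falling_fact_span m (\<lambda>p. c * q p)"
| add: "falling_fact_span m q \<Longrightarrow> falling_fact_span m r \<Longrightarrow> falling_fact_span m (\<lambda>p. q p + r p)"

text \<open>Writing \<open>p $ j\<close> as \<open>(p $ j - \<beta> j) + \<beta> j\<close> splits
  the product into the next falling factorial and a multiple of the present one.\<close>

lemma falling_fact_span_coord: "falling_fact_span m q \<Longrightarrow> falling_fact_span (Suc m) (\<lambda>p. of_int (p $ j) * q p)"
proof (induction rule: falling_fact_span.induct)
  case (falling_fact \<beta> m)
  have "(\<lambda>p. of_int (p $ j) * falling_fact \<beta> p) = (\<lambda>p. falling_fact (\<beta>(j := Suc (\<beta> j))) p + of_nat (\<beta> j) * falling_fact \<beta> p)"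
    by (simp add: falling_fact_fun_upd algebra_simps)
  moreover have "falling_fact_span (Suc m) (\<lambda>p. falling_fact (\<beta>(j := Suc (\<beta> j))) p + of_nat (\<beta> j) * falling_fact \<beta> p)"
    using falling_fact by (intro falling_fact_span.intros) (auto simp: mi_size_fun_upd)
  ultimately show ?case by simp
next
  case (cmult m q c)
  then show ?case using falling_fact_span.cmult[OF cmult.IH, of c] by (simp add: mult.left_commute)
next
  case (add m q r)
  then show ?case using falling_fact_span.add[OF add.IH] by (simp add: distrib_left)
qed

lemma polyfun_falling_fact_span: "polyfun m q \<Longrightarrow> falling_fact_span m q"
proof (induction rule: polyfun.induct)
  case (const m c)
  have "falling_fact_span m (\<lambda>p. c * falling_fact (\<lambda>_. 0) p :: complex)" by (intro falling_fact_span.intros) auto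
  then show ?case by (simp add: falling_fact_def)
qed (auto intro: falling_fact_span.intros falling_fact_span_coord)

section \<open>The lattice weight and Peetre's inequality\<close>

definition jbracket :: "real \<Rightarrow> int ^ 'n::finite \<Rightarrow> real" where
  "jbracket h x = 1 + norm (h *\<^sub>R emb x)"

lemma jbracket_ge_1: "1 \<le> jbracket h x"
  by (simp add: jbracket_def)

lemma jbracket_pos [simp]: "0 < jbracket h x"
  using jbracket_ge_1[of h x] by linarith

lemma jbracket_nonneg [simp]: "0 \<le> jbracket h x"
  using jbracket_pos[of h x] by linarith

lemma jbracket_powr_mono: "s \<le> t \<Longrightarrow> jbracket h x powr s \<le> jbracket h x powr t"
  by (intro powr_mono jbracket_ge_1)

text \<open>The triangle inequality together with \<open>1 + u + v \<le> (1 + u) * (1 + v)\<close>;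
  \<open>h \<le> 1\<close> keeps the factor for \<open>q\<close> free of \<open>h\<close>.\<close>

lemma jbracket_peetre:
  assumes "0 < h" "h \<le> 1"
  shows "jbracket h (x + q) \<le> jbracket h x * weight q"
proof -
  have "norm (h *\<^sub>R emb q) \<le> 1 * real (l1 q)"
    using assms unfolding norm_scaleR by (intro mult_mono norm_emb_le) auto
  moreover have "norm (h *\<^sub>R emb (x + q)) \<le> norm (h *\<^sub>R emb x) + norm (h *\<^sub>R emb q)"
    unfolding emb_add scaleR_add_right by (rule norm_triangle_ineq)
  moreover have "jbracket h x * weight q = jbracket h x + jbracket h x * real (l1 q)" by (simp add: weight_def algebra_simps)
  moreover have "1 * real (l1 q) \<le> jbracket h x * real (l1 q)" by (intro mult_right_mono jbracket_ge_1) auto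
  ultimately show ?thesis unfolding jbracket_def[of h "x + q"] jbracket_def[of h x] by linarith
qed

text \<open>For negative exponents the inequality is applied to the shift back, from
  \<open>x + q\<close> by \<open>- q\<close>.\<close>

lemma jbracket_peetre_powr:
  assumes "0 < h" "h \<le> 1" "s \<le> 0"
  shows "jbracket h (x + q) powr s \<le> jbracket h x powr s * weight q powr (- s)"
proof -
  have "jbracket h x \<le> jbracket h (x + q) * weight q" using jbracket_peetre[OF assms(1,2), of "x + q" "- q"] by simp
  then have "(jbracket h (x + q) * weight q) powr s \<le> jbracket h x powr s"
    using assms(3) by (intro powr_mono2') auto
  then have "(jbracket h (x + q) powr s * weight q powr s) * weight q powr (- s) \<le> jbracket h x powr s * weight q powr (- s)"
    by (intro mult_right_mono) (auto simp: powr_mult)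
  moreover have "weight q powr s * weight q powr (- s) = 1" by (simp add: powr_add[symmetric])
  ultimately show ?thesis by (simp add: mult.assoc)
qed

section \<open>Symbol estimates in terms of coefficients\<close>

lemma tor_op_diff_op_fourier_series:
  assumes a: "\<And>x. rapid (a x)" and \<sigma>: "\<And>x \<theta>. \<sigma> (h *\<^sub>R emb x) \<theta> = fourier_series (a x) \<theta>"
  shows "tor_op h \<beta> (\<lambda>\<eta>. diff_op h \<alpha> (\<lambda>l. \<sigma> l \<eta>) (h *\<^sub>R emb x)) \<theta> =
    of_real (h ^ mi_size \<beta> / h ^ mi_size \<alpha>) * fourier_series (\<lambda>p. falling_fact \<beta> p * lat_diff \<alpha> (\<lambda>y. a y p) x) \<theta>"
proof -
  define c where "c = 1 / complex_of_real (h ^ mi_size \<alpha>)"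
  have "(\<lambda>\<eta>. diff_op h \<alpha> (\<lambda>l. \<sigma> l \<eta>) (h *\<^sub>R emb x)) = (\<lambda>\<eta>. c * lat_diff \<alpha> (\<lambda>y. fourier_series (a y) \<eta>) x)"
    by (simp add: diff_op_lat_diff \<sigma> c_def)
  also have "\<dots> = fourier_series (\<lambda>p. c * lat_diff \<alpha> (\<lambda>y. a y p) x)"
    by (simp add: lat_diff_fourier_series a fourier_series_cmult fun_eq_iff)
  finally have "tor_op h \<beta> (\<lambda>\<eta>. diff_op h \<alpha> (\<lambda>l. \<sigma> l \<eta>) (h *\<^sub>R emb x)) \<theta> =
      of_real (h ^ mi_size \<beta>) * fourier_series (\<lambda>p. falling_fact \<beta> p * (c * lat_diff \<alpha> (\<lambda>y. a y p) x)) \<theta>"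
    by (simp only: tor_op_fourier_series(2)[OF rapid_cmult[OF rapid_lat_diff[of a, OF a]]])
  then show ?thesis unfolding mult.left_commute[of "falling_fact \<beta> _" c] fourier_series_cmult by (simp add: c_def)
qed

text \<open>The bound is still one for the whole series, uniform in \<open>\<theta>\<close>, and not
  for single coefficients, so that the passage from and to \<open>symbol_class\<close> costs no
  power of the weight.\<close>

definition coeff_bounds :: "real \<Rightarrow> real \<Rightarrow> real \<Rightarrow> real \<Rightarrow> (int ^ 'n::finite \<Rightarrow> int ^ 'n \<Rightarrow> complex) \<Rightarrow> bool" where
  "coeff_bounds h \<mu> \<rho> \<delta> a \<longleftrightarrow> (\<forall>x. rapid (a x)) \<and>
    (\<forall>\<alpha> \<beta>. \<exists>C. \<forall>x \<theta>. cmod (fourier_series (\<lambda>p. falling_fact \<beta> p * lat_diff \<alpha> (\<lambda>y. a y p) x) \<theta>)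
      \<le> C * jbracket h x powr (\<mu> - \<rho> * real (mi_size \<alpha>) + \<delta> * real (mi_size \<beta>)))"

lemma coeff_boundsD:
  assumes "0 < h" and \<sigma>: "\<sigma> \<in> symbol_class h \<mu> \<rho> \<delta>"
  shows "\<sigma> (h *\<^sub>R emb x) = fourier_series (fourier_coeff (\<sigma> (h *\<^sub>R emb x)))"
    and "coeff_bounds h \<mu> \<rho> \<delta> (\<lambda>x. fourier_coeff (\<sigma> (h *\<^sub>R emb x)))"
proof -
  let ?a = "\<lambda>x. fourier_coeff (\<sigma> (h *\<^sub>R emb x))"
  have smooth: "smooth_torus (\<sigma> (h *\<^sub>R emb x))" for x
    using \<sigma> by (simp add: symbol_class_def hlattice_eq)
  show eq: "\<sigma> (h *\<^sub>R emb x) = fourier_series (?a x)" for x by (rule fourier_inversion[OF smooth])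
  have r: "rapid (?a x)" for x by (rule rapid_fourier_coeff[OF smooth])
  have "\<exists>C. \<forall>x \<theta>. cmod (fourier_series (\<lambda>p. falling_fact \<beta> p * lat_diff \<alpha> (\<lambda>y. ?a y p) x) \<theta>)
      \<le> C * jbracket h x powr (\<mu> - \<rho> * real (mi_size \<alpha>) + \<delta> * real (mi_size \<beta>))" for \<alpha> \<beta>
  proof -
    obtain C where C: "\<And>x \<theta>. cmod (tor_op h \<beta> (\<lambda>\<eta>. diff_op h \<alpha> (\<lambda>l. \<sigma> l \<eta>) (h *\<^sub>R emb x)) \<theta>)
        \<le> C * jbracket h x powr (\<mu> - \<rho> * real (mi_size \<alpha>) + \<delta> * real (mi_size \<beta>))"
      using \<sigma> unfolding symbol_class_def hlattice_eq jbracket_def by blast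
    \<comment> \<open>For fixed \<open>h\<close> this quotient is a positive constant and can be
      moved into the symbol constant.\<close>
    define d where "d = h ^ mi_size \<beta> / h ^ mi_size \<alpha>"
    have d: "0 < d" using assms(1) by (simp add: d_def)
    have "d * cmod (fourier_series (\<lambda>p. falling_fact \<beta> p * lat_diff \<alpha> (\<lambda>y. ?a y p) x) \<theta>)
        \<le> C * jbracket h x powr (\<mu> - \<rho> * real (mi_size \<alpha>) + \<delta> * real (mi_size \<beta>))" for x \<theta>
      using C[of x \<theta>] d unfolding tor_op_diff_op_fourier_series[of ?a \<sigma> h, OF r fun_cong[OF eq]] d_def[symmetric]
      by (simp add: norm_mult)
    then have "cmod (fourier_series (\<lambda>p. falling_fact \<beta> p * lat_diff \<alpha> (\<lambda>y. ?a y p) x) \<theta>)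
        \<le> C / d * jbracket h x powr (\<mu> - \<rho> * real (mi_size \<alpha>) + \<delta> * real (mi_size \<beta>))" for x \<theta>
      using d by (simp add: pos_le_divide_eq mult.commute)
    then show ?thesis by blast
  qed
  then show "coeff_bounds h \<mu> \<rho> \<delta> ?a" using r by (simp add: coeff_bounds_def)
qed

lemma symbol_classI:
  assumes "0 < h" and a: "coeff_bounds h \<mu> \<rho> \<delta> a" and \<sigma>: "\<And>x \<theta>. \<sigma> (h *\<^sub>R emb x) \<theta> = fourier_series (a x) \<theta>"
  shows "\<sigma> \<in> symbol_class h \<mu> \<rho> \<delta>"
proof -
  have r: "rapid (a x)" for x using a by (simp add: coeff_bounds_def)
  have "smooth_torus (\<sigma> k)" if k: "k \<in> hlattice h" for k
  proof -
    obtain x where "k = h *\<^sub>R emb x" using k by (auto simp: hlattice_eq)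
    then have "\<sigma> k = fourier_series (a x)" using \<sigma> by auto
    then show ?thesis using smooth_torus_fourier_series[OF r] by simp
  qed
  moreover have "\<exists>C>0. \<forall>k\<in>hlattice h. \<forall>\<theta>. cmod (tor_op h \<beta> (\<lambda>\<eta>. diff_op h \<alpha> (\<lambda>l. \<sigma> l \<eta>) k) \<theta>)
      \<le> C * (1 + norm k) powr (\<mu> - \<rho> * real (mi_size \<alpha>) + \<delta> * real (mi_size \<beta>))" for \<alpha> \<beta>
  proof -
    let ?e = "\<mu> - \<rho> * real (mi_size \<alpha>) + \<delta> * real (mi_size \<beta>)"
    obtain C where C: "\<And>x \<theta>. cmod (fourier_series (\<lambda>p. falling_fact \<beta> p * lat_diff \<alpha> (\<lambda>y. a y p) x) \<theta>) \<le> C * jbracket h x powr ?e"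
      using a unfolding coeff_bounds_def by blast
    define d where "d = h ^ mi_size \<beta> / h ^ mi_size \<alpha>"
    have d: "0 < d" using assms(1) by (simp add: d_def)
    \<comment> \<open>\<open>symbol_class\<close> asks for a positive constant, hence
      \<open>max C 1\<close>.\<close>
    have "cmod (tor_op h \<beta> (\<lambda>\<eta>. diff_op h \<alpha> (\<lambda>l. \<sigma> l \<eta>) (h *\<^sub>R emb x)) \<theta>)
        \<le> d * max C 1 * jbracket h x powr ?e" for x \<theta>
    proof -
      have "cmod (tor_op h \<beta> (\<lambda>\<eta>. diff_op h \<alpha> (\<lambda>l. \<sigma> l \<eta>) (h *\<^sub>R emb x)) \<theta>) =
          d * cmod (fourier_series (\<lambda>p. falling_fact \<beta> p * lat_diff \<alpha> (\<lambda>y. a y p) x) \<theta>)"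
        unfolding tor_op_diff_op_fourier_series[of a \<sigma> h, OF r \<sigma>] d_def[symmetric] using d by (simp add: norm_mult)
      also have "\<dots> \<le> d * (max C 1 * jbracket h x powr ?e)"
        using d by (intro mult_left_mono order_trans[OF C] mult_right_mono) auto
      finally show ?thesis by (simp add: mult.assoc)
    qed
    then show ?thesis using d
      by (intro exI[of _ "d * max C 1"]) (auto simp: hlattice_eq jbracket_def)
  qed
  ultimately show ?thesis by (simp add: symbol_class_def)
qed

lemma coeff_bounds_rapid: "coeff_bounds h \<mu> \<rho> \<delta> a \<Longrightarrow> rapid (a x)"
  by (simp add: coeff_bounds_def)

lemma rapid_polyfun_mult: "polyfun m q \<Longrightarrow> rapid a \<Longrightarrow> rapid (\<lambda>p. q p * a p)"
  using polyfun_growth rapid_mult_growth by metis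

lemma falling_fact_span_polyfun: "falling_fact_span m q \<Longrightarrow> polyfun m q"
  by (induction rule: falling_fact_span.induct) (auto intro: polyfun.add polyfun_cmult polyfun_mono[OF polyfun_falling_fact])

text \<open>Expand the multiplier in falling factorials. Those of degree below \<open>m\<close> obey
  better bounds, which are weakened to the common exponent because \<open>\<delta> \<ge> 0\<close>
  and \<open>jbracket\<close> is at least 1.\<close>

lemma coeff_bounds_polyfun:
  assumes a: "coeff_bounds h \<mu> \<rho> \<delta> a" and \<delta>: "0 \<le> \<delta>" and q: "polyfun m q"
  shows "\<exists>C. \<forall>x \<theta>. cmod (fourier_series (\<lambda>p. q p * lat_diff \<alpha> (\<lambda>y. a y p) x) \<theta>)
    \<le> C * jbracket h x powr (\<mu> - \<rho> * real (mi_size \<alpha>) + \<delta> * real m)"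
  using polyfun_falling_fact_span[OF q]
proof (induction rule: falling_fact_span.induct)
  case (falling_fact \<beta> m)
  obtain C where C: "\<And>x \<theta>. cmod (fourier_series (\<lambda>p. falling_fact \<beta> p * lat_diff \<alpha> (\<lambda>y. a y p) x) \<theta>)
      \<le> C * jbracket h x powr (\<mu> - \<rho> * real (mi_size \<alpha>) + \<delta> * real (mi_size \<beta>))"
    using a unfolding coeff_bounds_def by blast
  have "cmod (fourier_series (\<lambda>p. falling_fact \<beta> p * lat_diff \<alpha> (\<lambda>y. a y p) x) \<theta>)
      \<le> max C 0 * jbracket h x powr (\<mu> - \<rho> * real (mi_size \<alpha>) + \<delta> * real m)" for x \<theta>
  proof (rule order_trans[OF C], rule mult_mono)
    show "jbracket h x powr (\<mu> - \<rho> * real (mi_size \<alpha>) + \<delta> * real (mi_size \<beta>))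
        \<le> jbracket h x powr (\<mu> - \<rho> * real (mi_size \<alpha>) + \<delta> * real m)"
      using falling_fact \<delta> by (intro jbracket_powr_mono add_left_mono mult_left_mono) auto
  qed auto
  then show ?case by blast
next
  case (cmult m q c)
  then obtain C where C: "\<And>x \<theta>. cmod (fourier_series (\<lambda>p. q p * lat_diff \<alpha> (\<lambda>y. a y p) x) \<theta>)
      \<le> C * jbracket h x powr (\<mu> - \<rho> * real (mi_size \<alpha>) + \<delta> * real m)" by blast
  have "cmod (fourier_series (\<lambda>p. c * q p * lat_diff \<alpha> (\<lambda>y. a y p) x) \<theta>)
      \<le> (cmod c * C) * jbracket h x powr (\<mu> - \<rho> * real (mi_size \<alpha>) + \<delta> * real m)" for x \<theta>
    unfolding mult.assoc fourier_series_cmult norm_mult by (intro mult_left_mono C) auto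
  then show ?case by blast
next
  case (add m q r)
  then obtain C D where CD: "\<And>x \<theta>. cmod (fourier_series (\<lambda>p. q p * lat_diff \<alpha> (\<lambda>y. a y p) x) \<theta>)
      \<le> C * jbracket h x powr (\<mu> - \<rho> * real (mi_size \<alpha>) + \<delta> * real m)"
    "\<And>x \<theta>. cmod (fourier_series (\<lambda>p. r p * lat_diff \<alpha> (\<lambda>y. a y p) x) \<theta>)
      \<le> D * jbracket h x powr (\<mu> - \<rho> * real (mi_size \<alpha>) + \<delta> * real m)" by blast
  have rap: "rapid (\<lambda>p. q p * lat_diff \<alpha> (\<lambda>y. a y p) x)" "rapid (\<lambda>p. r p * lat_diff \<alpha> (\<lambda>y. a y p) x)" for x
    using add.hyps[THEN falling_fact_span_polyfun]
    by (auto intro!: rapid_polyfun_mult rapid_lat_diff coeff_bounds_rapid[OF a])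
  have "cmod (fourier_series (\<lambda>p. (q p + r p) * lat_diff \<alpha> (\<lambda>y. a y p) x) \<theta>)
      \<le> (C + D) * jbracket h x powr (\<mu> - \<rho> * real (mi_size \<alpha>) + \<delta> * real m)" for x \<theta>
    unfolding distrib_right fourier_series_add[OF rap] by (intro norm_triangle_le add_mono CD)
  then show ?case by blast
qed

text \<open>A coefficient is bounded by the supremum of its series. With the multipliers 1 and
  \<open>of_int (p $ j) ^ M\<close> this gives decay in \<open>p\<close>, and each power of it is
  paid for with \<open>\<delta>\<close> in the order in \<open>x\<close>.\<close>

lemma coeff_decay:
  fixes a :: "int ^ 'n::finite \<Rightarrow> int ^ 'n \<Rightarrow> complex"
  assumes a: "coeff_bounds h \<mu> \<rho> \<delta> a" and \<delta>: "0 \<le> \<delta>"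
  shows "\<exists>C\<ge>0. \<forall>x p. cmod (lat_diff \<alpha> (\<lambda>y. a y p) x) * weight p ^ M
    \<le> C * jbracket h x powr (\<mu> - \<rho> * real (mi_size \<alpha>) + \<delta> * real M)"
proof -
  let ?s = "\<mu> - \<rho> * real (mi_size \<alpha>) + \<delta> * real M"
  have q: "\<exists>C. \<forall>x p. cmod (q p) * cmod (lat_diff \<alpha> (\<lambda>y. a y p) x) \<le> C * jbracket h x powr ?s"
    if q: "polyfun M q" for q
  proof -
    obtain C where C: "\<And>x \<theta>. cmod (fourier_series (\<lambda>p. q p * lat_diff \<alpha> (\<lambda>y. a y p) x) \<theta>) \<le> C * jbracket h x powr ?s"
      using coeff_bounds_polyfun[OF a \<delta> q] by blast
    have r: "rapid (\<lambda>p. q p * lat_diff \<alpha> (\<lambda>y. a y p) x)" for x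
      by (intro rapid_polyfun_mult[OF q] rapid_lat_diff coeff_bounds_rapid[OF a])
    have "cmod (q p * lat_diff \<alpha> (\<lambda>y. a y p) x) \<le> C * jbracket h x powr ?s" for x p
      using norm_fourier_coeff_le[OF continuous_fourier_series[OF r] C, of x p] unfolding fourier_coeff_fourier_series[OF rapid_abs_summable[OF r]] .
    then show ?thesis unfolding norm_mult by blast
  qed
  obtain C0 where C0: "\<And>x p. cmod (lat_diff \<alpha> (\<lambda>y. a y p) x) \<le> C0 * jbracket h x powr ?s"
    using q[OF polyfun.const[of M 1]] by auto
  have "\<forall>j. \<exists>C. \<forall>x p. \<bar>real_of_int (p $ j)\<bar> ^ M * cmod (lat_diff \<alpha> (\<lambda>y. a y p) x) \<le> C * jbracket h x powr ?s"
    using q[OF polyfun_coord_power] by (simp add: norm_power)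
  then obtain C where C: "\<And>j x p. \<bar>real_of_int (p $ j)\<bar> ^ M * cmod (lat_diff \<alpha> (\<lambda>y. a y p) x) \<le> C j * jbracket h x powr ?s"
    by metis
  let ?k = "(1 + real CARD('n)) ^ M"
  have *: "cmod (lat_diff \<alpha> (\<lambda>y. a y p) x) * weight p ^ M \<le> ?k * (C0 + (\<Sum>j\<in>UNIV. C j)) * jbracket h x powr ?s" for x p
  proof -
    let ?d = "cmod (lat_diff \<alpha> (\<lambda>y. a y p) x)"
    have "?d * weight p ^ M \<le> ?d * (?k * (1 + (\<Sum>j\<in>UNIV. \<bar>real_of_int (p $ j)\<bar> ^ M)))"
      by (intro mult_left_mono weight_power_le) auto
    also have "\<dots> = ?k * (?d + (\<Sum>j\<in>UNIV. \<bar>real_of_int (p $ j)\<bar> ^ M * ?d))"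
      by (simp add: algebra_simps sum_distrib_right sum_distrib_left)
    also have "\<dots> \<le> ?k * (C0 * jbracket h x powr ?s + (\<Sum>j\<in>UNIV. C j * jbracket h x powr ?s))"
      by (intro mult_left_mono add_mono C0 sum_mono C) auto
    also have "\<dots> = ?k * (C0 + (\<Sum>j\<in>UNIV. C j)) * jbracket h x powr ?s"
      by (simp add: sum_distrib_right[symmetric] distrib_right mult.assoc)
    finally show ?thesis .
  qed
  show ?thesis
  proof (intro exI conjI allI)
    show "cmod (lat_diff \<alpha> (\<lambda>y. a y p) x) * weight p ^ M \<le> max 0 (?k * (C0 + (\<Sum>j\<in>UNIV. C j))) * jbracket h x powr ?s" for x p
      by (rule order_trans[OF *]) (intro mult_right_mono, auto)
  qed auto
qed

subsection \<open>Discrete Taylor expansion\<close>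

text \<open>The product of the binomial coefficients of \<open>p $ j\<close> over
  \<open>\<alpha> j\<close>, also for negative entries of \<open>p\<close>.\<close>

definition taylor_coeff :: "('n::finite \<Rightarrow> nat) \<Rightarrow> int ^ 'n \<Rightarrow> complex" where
  "taylor_coeff \<alpha> p = falling_fact \<alpha> p / of_nat (mi_fact \<alpha>)"

lemma mi_fact_fun_upd: "mi_fact (\<beta>(j := Suc (\<beta> j))) = Suc (\<beta> j) * mi_fact \<beta>"
proof -
  have "mi_fact \<gamma> = fact (\<gamma> j) * (\<Prod>i\<in>UNIV - {j}. fact (\<gamma> i))" for \<gamma>
    unfolding mi_fact_def by (rule prod.remove) auto
  then show ?thesis by (simp add: distrib_right)
qed

lemma mi_fact_pos: "mi_fact \<alpha> > 0"
  by (simp add: mi_fact_def prod_pos)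

lemma lat_diff1_falling_fact_eq_0:
  assumes "\<alpha> j = 0"
  shows "lat_diff1 j (falling_fact \<alpha>) q = 0"
proof -
  have "(\<Prod>l<\<alpha> i. of_int ((q + axis j 1) $ i) - of_nat l) = (\<Prod>l<\<alpha> i. of_int (q $ i) - of_nat l :: complex)" for i
    using assms by (cases "i = j") (auto simp: axis_def)
  then show ?thesis by (simp add: lat_diff1_def falling_fact_def)
qed

text \<open>The discrete power rule: the two products in direction \<open>j\<close> share
  \<open>\<beta> j\<close> factors, and the remaining ones, \<open>x + 1\<close> and
  \<open>x - \<beta> j\<close>, differ by \<open>\<beta> j + 1\<close>.\<close>

lemma lat_diff1_falling_fact_Suc: "lat_diff1 j (falling_fact (\<beta>(j := Suc (\<beta> j)))) q = of_nat (Suc (\<beta> j)) * falling_fact \<beta> q"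
proof -
  have split: "falling_fact \<gamma> p = (\<Prod>l<\<gamma> j. of_int (p $ j) - of_nat l) * (\<Prod>i\<in>UNIV - {j}. \<Prod>l<\<gamma> i. of_int (p $ i) - of_nat l)"
    for \<gamma> p unfolding falling_fact_def by (rule prod.remove) auto
  let ?r = "\<Prod>i\<in>UNIV - {j}. \<Prod>l<\<beta> i. of_int (q $ i) - of_nat l :: complex"
  let ?x = "of_int (q $ j) :: complex"
  have r: "(\<Prod>i\<in>UNIV - {j}. \<Prod>l<(\<beta>(j := Suc (\<beta> j))) i. of_int ((q + axis j 1) $ i) - of_nat l) = ?r"
    "(\<Prod>i\<in>UNIV - {j}. \<Prod>l<(\<beta>(j := Suc (\<beta> j))) i. of_int (q $ i) - of_nat l) = ?r"
    by (rule prod.cong; simp add: axis_def)+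
  have "(\<Prod>l<Suc (\<beta> j). (?x + 1) - of_nat l) = (?x + 1) * (\<Prod>l<\<beta> j. ?x - of_nat l)"
    by (simp only: prod.lessThan_Suc_shift) (simp add: algebra_simps)
  then show ?thesis
    unfolding lat_diff1_def split[of "\<beta>(j := Suc (\<beta> j))"] r split[of \<beta> q]
    by (simp add: axis_def) (simp add: algebra_simps)
qed

text \<open>Pascal's rule; it makes differences lower the Taylor coefficients by one order.\<close>

lemma lat_diff1_taylor_coeff_Suc: "lat_diff1 j (taylor_coeff (\<beta>(j := Suc (\<beta> j)))) q = taylor_coeff \<beta> q"
proof -
  have "lat_diff1 j (taylor_coeff (\<beta>(j := Suc (\<beta> j)))) q = lat_diff1 j (falling_fact (\<beta>(j := Suc (\<beta> j)))) q / of_nat (mi_fact (\<beta>(j := Suc (\<beta> j))))"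
    by (simp add: lat_diff1_def taylor_coeff_def diff_divide_distrib)
  also have "\<dots> = of_nat (Suc (\<beta> j)) * falling_fact \<beta> q / (of_nat (Suc (\<beta> j)) * of_nat (mi_fact \<beta>))"
    unfolding lat_diff1_falling_fact_Suc mi_fact_fun_upd of_nat_mult ..
  also have "\<dots> = taylor_coeff \<beta> q" unfolding taylor_coeff_def by (rule mult_divide_mult_cancel_left) (simp del: of_nat_Suc)
  finally show ?thesis .
qed

lemma lat_diff1_taylor_coeff_eq_0: "\<alpha> j = 0 \<Longrightarrow> lat_diff1 j (taylor_coeff \<alpha>) q = 0"
  using lat_diff1_falling_fact_eq_0[of \<alpha> j q] by (simp add: lat_diff1_def taylor_coeff_def diff_divide_distrib[symmetric])

lemma taylor_coeff_at_0: "taylor_coeff \<alpha> 0 = (if \<alpha> = (\<lambda>_. 0) then 1 else 0)"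
proof (cases "\<alpha> = (\<lambda>_. 0)")
  case False
  then obtain j where "\<alpha> j \<noteq> 0" by auto
  then have "(\<Prod>l<\<alpha> j. - of_nat l :: complex) = 0" by (simp add: prod_zero_iff) 
  then have "falling_fact \<alpha> 0 = 0" unfolding falling_fact_def by (subst prod_zero_iff) auto
  then show ?thesis using False by (simp add: taylor_coeff_def)
qed (simp add: taylor_coeff_def falling_fact_def mi_fact_def)

definition taylor_rem :: "nat \<Rightarrow> (int ^ 'n::finite \<Rightarrow> complex) \<Rightarrow> int ^ 'n \<Rightarrow> complex" where
  "taylor_rem N f q = f q - (\<Sum>\<alpha> | mi_size \<alpha> < N. taylor_coeff \<alpha> q * lat_diff \<alpha> f 0)"

text \<open>The difference of a Taylor remainder is the remainder of one order less of the difference,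
  so the remainder can be bounded by summing along a lattice path to the origin.\<close>

lemma lat_diff1_taylor_rem: "lat_diff1 j (taylor_rem (Suc N) f) q = taylor_rem N (lat_diff1 j f) q"
proof -
  have "lat_diff1 j (taylor_rem (Suc N) f) q = lat_diff1 j f q - (\<Sum>\<alpha> | mi_size \<alpha> < Suc N. lat_diff1 j (taylor_coeff \<alpha>) q * lat_diff \<alpha> f 0)"
    unfolding lat_diff1_def taylor_rem_def by (simp add: left_diff_distrib sum_subtractf)
  also have "(\<Sum>\<alpha> | mi_size \<alpha> < Suc N. lat_diff1 j (taylor_coeff \<alpha>) q * lat_diff \<alpha> f 0) =
      (\<Sum>\<alpha> | mi_size \<alpha> < Suc N \<and> \<alpha> j \<noteq> 0. lat_diff1 j (taylor_coeff \<alpha>) q * lat_diff \<alpha> f 0)"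
    by (rule sum.mono_neutral_right) (auto simp: finite_mi_size_less lat_diff1_taylor_coeff_eq_0)
  also have "\<dots> = (\<Sum>\<beta> | mi_size \<beta> < N. taylor_coeff \<beta> q * lat_diff \<beta> (lat_diff1 j f) 0)"
  \<comment> \<open>Multi-indices with \<open>\<alpha> j = 0\<close> have dropped out; on the
    others, lowering the entry \<open>j\<close> is a bijection onto the sizes below
    \<open>N\<close>.\<close>
  proof (rule sum.reindex_bij_witness[where i = "\<lambda>\<beta>. \<beta>(j := Suc (\<beta> j))" and j = "\<lambda>\<alpha>. \<alpha>(j := \<alpha> j - 1)"])
    fix \<alpha> assume "\<alpha> \<in> {\<alpha>. mi_size \<alpha> < Suc N \<and> \<alpha> j \<noteq> 0}"
    then have \<alpha>: "mi_size \<alpha> < Suc N" "\<alpha> j \<noteq> 0" by auto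
    let ?\<beta> = "\<alpha>(j := \<alpha> j - 1)"
    show eq: "?\<beta>(j := Suc (?\<beta> j)) = \<alpha>" using \<alpha>(2) by auto
    show "?\<beta> \<in> {\<beta>. mi_size \<beta> < N}"
      using mi_size_fun_upd[of ?\<beta> j] \<alpha>(1) unfolding eq by simp
    have "(\<lambda>i. ?\<beta> i + mi_unit j i) = \<alpha>" using \<alpha>(2) by (auto simp: mi_unit_def)
    then have "lat_diff \<alpha> f = lat_diff ?\<beta> (lat_diff1 j f)"
      by (metis lat_diff_lat_diff lat_diff_unit)
    then show "taylor_coeff ?\<beta> q * lat_diff ?\<beta> (lat_diff1 j f) 0 = lat_diff1 j (taylor_coeff \<alpha>) q * lat_diff \<alpha> f 0"
      using lat_diff1_taylor_coeff_Suc[of j ?\<beta> q] unfolding eq by simp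
  qed (auto simp: mi_size_fun_upd)
  finally show ?thesis by (simp add: taylor_rem_def[abs_def])
qed

text \<open>At the origin only the term of the zero multi-index survives, and it cancels
  \<open>f 0\<close>. It is present from order 1 on, hence \<open>Suc N\<close>.\<close>

lemma taylor_rem_at_0: "taylor_rem (Suc N) f 0 = 0"
proof -
  have "(\<Sum>\<alpha> | mi_size \<alpha> < Suc N. taylor_coeff \<alpha> 0 * lat_diff \<alpha> f 0) = (\<Sum>\<alpha>\<in>{\<lambda>_. 0}. taylor_coeff \<alpha> 0 * lat_diff \<alpha> f 0)"
    by (rule sum.mono_neutral_right) (auto simp: finite_mi_size_less taylor_coeff_at_0)
  then show ?thesis by (simp add: taylor_rem_def taylor_coeff_at_0 lat_diff_0)
qed

lemma l1_axis_step:
  assumes "p $ j > 0"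
  shows "Suc (l1 (p - axis j 1)) = l1 p"
proof -
  have split: "l1 q = nat \<bar>q $ j\<bar> + (\<Sum>i\<in>UNIV - {j}. nat \<bar>q $ i\<bar>)" for q :: "int ^ 'a"
    unfolding l1_def by (rule sum.remove) auto
  have "(\<Sum>i\<in>UNIV - {j}. nat \<bar>(p - axis j 1) $ i\<bar>) = (\<Sum>i\<in>UNIV - {j}. nat \<bar>p $ i\<bar>)"
    by (rule sum.cong) (auto simp: axis_def)
  then show ?thesis
    using assms by (simp add: split axis_def)
qed

text \<open>Each step moves a nonzero coordinate of \<open>p\<close> towards 0 and shortens the path
  by one. The difference is read at the new point when the coordinate is positive and at
  \<open>p\<close> when it is negative; both lie in the ball on which \<open>D\<close> is
  assumed.\<close>

lemma path_bound:
  fixes g :: "int ^ 'n::finite \<Rightarrow> complex"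
  assumes g0: "g 0 = 0" and D: "\<And>j q. l1 q \<le> L \<Longrightarrow> cmod (lat_diff1 j g q) \<le> D"
  shows "l1 p \<le> L \<Longrightarrow> cmod (g p) \<le> real (l1 p) * D"
proof (induction "l1 p" arbitrary: p)
  case 0
  then have "p = 0" using l1_eq_0[of p] by simp
  then show ?case by (simp add: g0 l1_def)
next
  case (Suc n)
  then have "p \<noteq> 0" using l1_eq_0[of p] by auto
  then obtain j where j: "p $ j \<noteq> 0" by (auto simp: vec_eq_iff)
  show ?case
  proof (cases "p $ j > 0")
    case True
    let ?p = "p - axis j 1"
    have n: "l1 ?p = n" using l1_axis_step[OF True] Suc.hyps(2) by simp
    have "cmod (g ?p) \<le> real n * D" using Suc.hyps(1)[of ?p] Suc.prems Suc.hyps(2) n by simp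
    moreover have "cmod (lat_diff1 j g ?p) \<le> D" using D[of ?p j] Suc.prems Suc.hyps(2) n by simp
    moreover have "g p = g ?p + lat_diff1 j g ?p" by (simp add: lat_diff1_def)
    then have "cmod (g p) \<le> cmod (g ?p) + cmod (lat_diff1 j g ?p)" using norm_triangle_ineq by metis
    ultimately show ?thesis unfolding Suc.hyps(2)[symmetric] by (simp add: algebra_simps)
  next
    case False
    let ?p = "p + axis j 1"
    have "Suc (l1 (- p - axis j 1)) = l1 (- p)" using j False by (intro l1_axis_step) simp
    then have n: "l1 ?p = n" using Suc.hyps(2) l1_minus[of ?p] by simp
    have "cmod (g ?p) \<le> real n * D" using Suc.hyps(1)[of ?p] Suc.prems Suc.hyps(2) n by simp
    moreover have "cmod (lat_diff1 j g p) \<le> D" using D[of p j] Suc.prems by simp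
    moreover have "g p = g ?p - lat_diff1 j g p" by (simp add: lat_diff1_def)
    then have "cmod (g p) \<le> cmod (g ?p) + cmod (lat_diff1 j g p)" using norm_triangle_ineq4 by metis
    ultimately show ?thesis unfolding Suc.hyps(2)[symmetric] by (simp add: algebra_simps)
  qed
qed

text \<open>One summation along a path per order, each costing a factor \<open>L\<close>. The radius
  \<open>L\<close> is fixed independently of \<open>p\<close>, since the induction hypothesis is
  applied to the differences at other points of the ball.\<close>

lemma taylor_bound:
  fixes f :: "int ^ 'n::finite \<Rightarrow> complex"
  assumes "\<And>\<alpha> q. mi_size \<alpha> = N \<Longrightarrow> l1 q \<le> L \<Longrightarrow> cmod (lat_diff \<alpha> f q) \<le> B"
  shows "l1 p \<le> L \<Longrightarrow> cmod (taylor_rem N f p) \<le> real L ^ N * B"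
  using assms
proof (induction N arbitrary: f p)
  case 0
  then show ?case using "0.prems"(2)[of "\<lambda>_. 0" p] by (simp add: taylor_rem_def lat_diff_0)
next
  case (Suc N)
  have D: "cmod (lat_diff1 j (taylor_rem (Suc N) f) q) \<le> real L ^ N * B" if "l1 q \<le> L" for j q
    unfolding lat_diff1_taylor_rem
  proof (rule Suc.IH[OF that])
    fix \<alpha> :: "'n \<Rightarrow> nat" and r :: "int ^ 'n" assume *: "mi_size \<alpha> = N" "l1 r \<le> L"
    have "lat_diff \<alpha> (lat_diff1 j f) r = lat_diff (\<lambda>i. \<alpha> i + mi_unit j i) f r"
      by (simp only: lat_diff_unit[symmetric] lat_diff_lat_diff)
    then show "cmod (lat_diff \<alpha> (lat_diff1 j f) r) \<le> B"
      using Suc.prems(2)[of "\<lambda>i. \<alpha> i + mi_unit j i" r] * by (simp add: mi_size_add)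
  qed
  have "0 \<le> real L ^ N * B" using order_trans[OF norm_ge_zero D[of 0]] by (simp add: l1_def)
  have "cmod (taylor_rem (Suc N) f p) \<le> real (l1 p) * (real L ^ N * B)"
    by (rule path_bound[OF taylor_rem_at_0 D Suc.prems(1)])
  also have "\<dots> \<le> real L * (real L ^ N * B)"
    using Suc.prems(1) \<open>0 \<le> real L ^ N * B\<close> by (intro mult_right_mono) auto
  finally show ?case by (simp add: mult.assoc)
qed

subsection \<open>The remainder of the transposed symbol\<close>

text \<open>Reflection of the frequency amounts to reflection of \<open>\<theta>\<close>, under
  which suprema are unchanged; the reflected multiplier is covered by the estimate for
  polynomials.\<close>

lemma coeff_bounds_reflect:
  assumes c: "coeff_bounds h \<mu> \<rho> \<delta> c" and \<delta>: "0 \<le> \<delta>"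
  shows "coeff_bounds h \<mu> \<rho> \<delta> (\<lambda>x p. c x (- p))"
proof -
  have "\<exists>C. \<forall>x \<theta>. cmod (fourier_series (\<lambda>p. falling_fact \<beta> p * lat_diff \<alpha> (\<lambda>y. c y (- p)) x) \<theta>)
      \<le> C * jbracket h x powr (\<mu> - \<rho> * real (mi_size \<alpha>) + \<delta> * real (mi_size \<beta>))" for \<alpha> \<beta>
  proof -
    obtain C where C: "\<And>x \<theta>. cmod (fourier_series (\<lambda>p. falling_fact \<beta> (- p) * lat_diff \<alpha> (\<lambda>y. c y p) x) \<theta>)
        \<le> C * jbracket h x powr (\<mu> - \<rho> * real (mi_size \<alpha>) + \<delta> * real (mi_size \<beta>))"
      using coeff_bounds_polyfun[OF c \<delta> polyfun_reflect[OF polyfun_falling_fact]] by blast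
    have "fourier_series (\<lambda>p. falling_fact \<beta> p * lat_diff \<alpha> (\<lambda>y. c y (- p)) x) \<theta> = fourier_series (\<lambda>p. falling_fact \<beta> (- p) * lat_diff \<alpha> (\<lambda>y. c y p) x) (- \<theta>)"
      for x \<theta> by (simp add: fourier_series_reflect)
    then have "cmod (fourier_series (\<lambda>p. falling_fact \<beta> p * lat_diff \<alpha> (\<lambda>y. c y (- p)) x) \<theta>)
        \<le> C * jbracket h x powr (\<mu> - \<rho> * real (mi_size \<alpha>) + \<delta> * real (mi_size \<beta>))" for x \<theta>
      using C[of x "- \<theta>"] by (simp only:)
    then show ?thesis by blast
  qed
  then show ?thesis
    using rapid_reflect[OF coeff_bounds_rapid[OF c]] by (simp add: coeff_bounds_def)
qed

text \<open>For \<open>N = 0\<close> the sum is empty and these are the coefficients of the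
  transposed symbol itself.\<close>

definition transpose_rem :: "(int ^ 'n::finite \<Rightarrow> int ^ 'n \<Rightarrow> complex) \<Rightarrow> nat \<Rightarrow> int ^ 'n \<Rightarrow> int ^ 'n \<Rightarrow> complex" where
  "transpose_rem a N x p = a (x + p) p - (\<Sum>\<alpha> | mi_size \<alpha> < N. taylor_coeff \<alpha> p * lat_diff \<alpha> (\<lambda>y. a y p) x)"

lemma transpose_rem_eq_taylor_rem: "transpose_rem a N x p = taylor_rem N (\<lambda>q. a (x + q) p) p"
  by (simp add: transpose_rem_def taylor_rem_def lat_diff_shift[of _ "\<lambda>y. a y p" x, unfolded add.commute[of _ x]])

text \<open>The frequency \<open>p\<close> is held fixed, and differences in \<open>x\<close>
  commute with the shift by \<open>p\<close> and with each other. So differences of a remainder need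
  no estimate of their own.\<close>

lemma lat_diff_transpose_rem:
  "lat_diff \<gamma> (\<lambda>x. transpose_rem a N x p) x = transpose_rem (\<lambda>x p. lat_diff \<gamma> (\<lambda>y. a y p) x) N x p"
proof -
  have "lat_diff \<gamma> (lat_diff \<alpha> g) x = lat_diff \<alpha> (lat_diff \<gamma> g) x" for \<alpha> and g :: "int ^ 'a \<Rightarrow> complex"
    by (simp add: lat_diff_lat_diff add.commute)
  then show ?thesis
    by (simp add: transpose_rem_def lat_diff_diff lat_diff_sum lat_diff_cmult lat_diff_shift[of \<gamma> "\<lambda>y. a y p" p x])
qed

lemma transpose_rem_split:
  assumes "N \<le> N'"
  shows "transpose_rem a N x p = transpose_rem a N' x p +
    (\<Sum>\<alpha> | N \<le> mi_size \<alpha> \<and> mi_size \<alpha> < N'. taylor_coeff \<alpha> p * lat_diff \<alpha> (\<lambda>y. a y p) x)"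
proof -
  have "{\<alpha> :: 'a \<Rightarrow> nat. mi_size \<alpha> < N'} = {\<alpha>. mi_size \<alpha> < N} \<union> {\<alpha>. N \<le> mi_size \<alpha> \<and> mi_size \<alpha> < N'}"
    using assms by auto
  moreover have "finite {\<alpha> :: 'a \<Rightarrow> nat. N \<le> mi_size \<alpha> \<and> mi_size \<alpha> < N'}"
    by (rule finite_subset[OF _ finite_mi_size_less[of N']]) auto
  ultimately show ?thesis
    unfolding transpose_rem_def by (simp add: sum.union_disjoint finite_mi_size_less disjoint_iff)
qed

text \<open>The order \<open>N\<close> of the expansion and the number \<open>M\<close> of \<open>\<theta>\<close>-derivatives spent on the decay in
  \<open>p\<close> have to be balanced: \<open>M\<close> is about \<open>(1 + \<rho>) N / (1 + \<delta>)\<close>, and then \<open>\<rho> N - \<delta> M\<close> grows like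
  \<open>(\<rho> - \<delta>) N / (1 + \<delta>)\<close>.\<close>

lemma balance_orders:
  fixes \<mu> \<rho> \<delta> K B :: real
  assumes "0 \<le> \<delta>" "\<delta> < \<rho>" "\<rho> \<le> 1"
  shows "\<exists>N\<ge>N0. \<exists>M::nat. \<mu> - \<rho> * real N + \<delta> * real M \<le> - K \<and>
    real N - (\<mu> - \<rho> * real N + \<delta> * real M) - real M \<le> - B"
proof -
  \<comment> \<open>The second inequality amounts to
    \<open>(1 + \<rho>) * N + B - \<mu> \<le> (1 + \<delta>) * M\<close>, which \<open>X\<close>
    satisfies in place of \<open>M\<close>, with \<open>T\<close> as an upper bound of
    \<open>B - \<mu>\<close>. \<open>N\<close> is taken so large that the first one follows; its
    summand 1 pays for rounding \<open>X\<close> up, as \<open>\<delta> \<le> 1\<close>.\<close>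
  define T where "T = \<bar>B - \<mu>\<bar>"
  define N where "N = max N0 (nat \<lceil>(1 + \<delta>) / (\<rho> - \<delta>) * (\<bar>K\<bar> + \<bar>\<mu>\<bar> + T + 1)\<rceil>)"
  define X where "X = ((1 + \<rho>) * real N + T) / (1 + \<delta>)"
  define M where "M = nat \<lceil>X\<rceil>"
  have X0: "0 \<le> X" using assms by (simp add: X_def T_def)
  have M: "X \<le> real M" "real M \<le> X + 1"
    using X0 unfolding M_def by linarith+
  have X: "(1 + \<delta>) * X = (1 + \<rho>) * real N + T" using assms by (simp add: X_def)
  have N: "(1 + \<delta>) / (\<rho> - \<delta>) * (\<bar>K\<bar> + \<bar>\<mu>\<bar> + T + 1) \<le> real N"
    unfolding N_def of_nat_max by (rule max.coboundedI2) (rule real_nat_ceiling_ge)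
  have "(\<bar>K\<bar> + \<bar>\<mu>\<bar> + T + 1) * (1 + \<delta>) \<le> real N * (\<rho> - \<delta>)"
    using N assms by (simp add: field_simps)
  also have "real N * (\<rho> - \<delta>) = (1 + \<delta>) * (\<rho> * real N - \<delta> * X) + \<delta> * T"
    using X by algebra
  also have "\<delta> * T \<le> (1 + \<delta>) * T" using assms by (intro mult_right_mono) (auto simp: T_def)
  finally have "(1 + \<delta>) * (\<bar>K\<bar> + \<bar>\<mu>\<bar> + T + 1) \<le> (1 + \<delta>) * (\<rho> * real N - \<delta> * X + T)"
    by (simp add: algebra_simps)
  then have "\<bar>K\<bar> + \<bar>\<mu>\<bar> + T + 1 \<le> \<rho> * real N - \<delta> * X + T" using assms by simp
  moreover have "\<delta> * real M \<le> \<delta> * X + 1"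
  proof -
    have "\<delta> * real M \<le> \<delta> * (X + 1)" using M assms by (intro mult_left_mono) auto
    then show ?thesis using assms by (simp add: distrib_left)
  qed
  ultimately have "\<mu> - \<rho> * real N + \<delta> * real M \<le> - K" by linarith
  moreover have "(1 + \<delta>) * X \<le> (1 + \<delta>) * real M" using M assms by (intro mult_left_mono) auto
  then have "(1 + \<rho>) * real N + T \<le> real M + \<delta> * real M" unfolding X by (simp add: distrib_right)
  then have "real N - (\<mu> - \<rho> * real N + \<delta> * real M) - real M \<le> - B"
    unfolding T_def by (simp add: distrib_right)
  moreover have "N0 \<le> N" by (simp add: N_def)
  ultimately show ?thesis by blast
qed

text \<open>The differences of order \<open>N\<close> have a negative exponent \<open>e\<close> in
  \<open>jbracket\<close>, so Peetre's inequality can move them from the points of the path back to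
  \<open>x\<close>. The losses in \<open>p\<close> are outdone by \<open>M\<close> powers of
  decay.\<close>

lemma transpose_rem_decay:
  fixes a :: "int ^ 'n::finite \<Rightarrow> int ^ 'n \<Rightarrow> complex"
  assumes h: "0 < h" "h \<le> 1" and \<delta>\<rho>: "0 \<le> \<delta>" "\<delta> < \<rho>" "\<rho> \<le> 1"
    and a: "coeff_bounds h \<mu> \<rho> \<delta> a" and K: "0 \<le> K"
  shows "\<exists>N\<ge>N0. \<exists>C\<ge>0. \<forall>x p. cmod (lat_diff \<gamma> (\<lambda>x. transpose_rem a N x p) x) \<le> C * jbracket h x powr (- K) / weight p ^ B"
proof -
  obtain N M where N: "N0 \<le> N"
    and e: "\<mu> - \<rho> * real N + \<delta> * real M \<le> - K"
    and eM: "real N - (\<mu> - \<rho> * real N + \<delta> * real M) - real M \<le> - real B"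
    using balance_orders[OF \<delta>\<rho>, of N0 \<mu> K "real B"] by blast
  define e where "e = \<mu> - \<rho> * real N + \<delta> * real M"
  have e0: "e \<le> - K" "e \<le> 0" using e K by (auto simp: e_def)
  have "\<forall>\<alpha>. \<exists>C\<ge>0. \<forall>x p. cmod (lat_diff (\<lambda>j. \<alpha> j + \<gamma> j) (\<lambda>y. a y p) x) * weight p ^ M
      \<le> C * jbracket h x powr (\<mu> - \<rho> * real (mi_size (\<lambda>j. \<alpha> j + \<gamma> j)) + \<delta> * real M)"
    using coeff_decay[OF a \<delta>\<rho>(1)] by blast
  then obtain C where C0: "\<And>\<alpha>. 0 \<le> C \<alpha>"
    and C: "\<And>\<alpha> x p. cmod (lat_diff (\<lambda>j. \<alpha> j + \<gamma> j) (\<lambda>y. a y p) x) * weight p ^ M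
      \<le> C \<alpha> * jbracket h x powr (\<mu> - \<rho> * real (mi_size (\<lambda>j. \<alpha> j + \<gamma> j)) + \<delta> * real M)" by metis
  let ?A = "{\<alpha> :: 'n \<Rightarrow> nat. mi_size \<alpha> = N}"
  define C' where "C' = (\<Sum>\<alpha>\<in>?A. C \<alpha>)"
  have finA: "finite ?A" by (rule finite_subset[OF _ finite_mi_size_less[of "Suc N"]]) auto
  have C'0: "0 \<le> C'" unfolding C'_def by (intro sum_nonneg C0)
  have "cmod (lat_diff \<gamma> (\<lambda>x. transpose_rem a N x p) x) \<le> C' * jbracket h x powr (- K) / weight p ^ B" for x p
  proof -
    let ?b = "\<lambda>q. lat_diff \<gamma> (\<lambda>y. a y p) (x + q)"
    let ?D = "C' * (jbracket h x powr e * weight p powr (- e)) / weight p ^ M"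
    \<comment> \<open>The ball of radius \<open>l1 p\<close> contains the path from \<open>p\<close>
      to the origin, and \<open>weight q \<le> weight p\<close> on it.\<close>
    have "cmod (taylor_rem N ?b p) \<le> real (l1 p) ^ N * ?D"
    proof (rule taylor_bound[OF _ order_refl])
      fix \<alpha> :: "'n \<Rightarrow> nat" and q :: "int ^ 'n" assume \<alpha>: "mi_size \<alpha> = N" and q: "l1 q \<le> l1 p"
      have "lat_diff \<alpha> ?b q = lat_diff \<alpha> (lat_diff \<gamma> (\<lambda>y. a y p)) (x + q)"
        using lat_diff_shift[of \<alpha> "lat_diff \<gamma> (\<lambda>y. a y p)" x q] by (simp add: add.commute)
      then have "cmod (lat_diff \<alpha> ?b q) * weight p ^ M \<le>
          C \<alpha> * jbracket h (x + q) powr (\<mu> - \<rho> * real (mi_size (\<lambda>j. \<alpha> j + \<gamma> j)) + \<delta> * real M)"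
        using C by (simp add: lat_diff_lat_diff)
      also have "\<dots> \<le> C' * (jbracket h x powr e * weight p powr (- e))"
      proof (intro mult_mono)
        show "C \<alpha> \<le> C'" unfolding C'_def using \<alpha> finA C0 by (intro member_le_sum) auto
        \<comment> \<open>Further differences \<open>\<gamma>\<close> only lower the exponent, so
          that \<open>e\<close>, which does not involve \<open>\<gamma>\<close>, serves for all of
          them.\<close>
        have "jbracket h (x + q) powr (\<mu> - \<rho> * real (mi_size (\<lambda>j. \<alpha> j + \<gamma> j)) + \<delta> * real M) \<le> jbracket h (x + q) powr e"
          using \<alpha> \<delta>\<rho> by (intro jbracket_powr_mono) (simp add: e_def mi_size_add distrib_left)
        also have "\<dots> \<le> jbracket h x powr e * weight q powr (- e)" by (rule jbracket_peetre_powr[OF h e0(2)])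
        also have "\<dots> \<le> jbracket h x powr e * weight p powr (- e)"
          using q e0 by (intro mult_left_mono powr_mono2) (auto simp: weight_def)
        finally show "jbracket h (x + q) powr (\<mu> - \<rho> * real (mi_size (\<lambda>j. \<alpha> j + \<gamma> j)) + \<delta> * real M)
            \<le> jbracket h x powr e * weight p powr (- e)" .
      qed (auto simp: C'0)
      finally show "cmod (lat_diff \<alpha> ?b q) \<le> ?D" by (simp add: pos_le_divide_eq)
    qed
    also have "\<dots> \<le> weight p ^ N * ?D"
      using C'0 by (intro mult_right_mono power_mono) (auto simp: weight_def)
    \<comment> \<open>The exponent of the weight collects \<open>N\<close> from the path,
      \<open>- e\<close> from Peetre's inequality and \<open>- M\<close> from the decay of the
      coefficients.\<close>
    also have "\<dots> = C' * jbracket h x powr e * weight p powr (real N - e - real M)"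
      by (simp add: powr_diff powr_minus powr_realpow divide_simps)
    also have "\<dots> \<le> C' * jbracket h x powr (- K) * weight p powr (- real B)"
      using e0 eM C'0 by (intro mult_mono mult_nonneg_nonneg jbracket_powr_mono powr_mono weight_ge_1) (auto simp: e_def)
    also have "\<dots> = C' * jbracket h x powr (- K) / weight p ^ B" by (simp add: powr_minus powr_realpow divide_simps)
    also have "taylor_rem N ?b p = lat_diff \<gamma> (\<lambda>x. transpose_rem a N x p) x"
      by (subst lat_diff_transpose_rem, rule transpose_rem_eq_taylor_rem[symmetric])
    finally show ?thesis .
  qed
  then show ?thesis using N C'0 by blast
qed

text \<open>For each power \<open>B\<close> a suitable later order \<open>N'\<close> has a remainder
  with that decay; the finitely many terms in between are polynomials times rapidly decreasing
  coefficients.\<close>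

lemma rapid_transpose_rem:
  assumes h: "0 < h" "h \<le> 1" and \<delta>\<rho>: "0 \<le> \<delta>" "\<delta> < \<rho>" "\<rho> \<le> 1"
    and a: "coeff_bounds h \<mu> \<rho> \<delta> a"
  shows "rapid (transpose_rem a N x)"
proof (rule rapidI)
  fix B
  obtain N' C where N': "N \<le> N'"
    and "\<forall>x p. cmod (lat_diff (\<lambda>_. 0) (\<lambda>x. transpose_rem a N' x p) x) \<le> C * jbracket h x powr (- 0) / weight p ^ B"
    using transpose_rem_decay[OF h \<delta>\<rho> a order_refl, of N "\<lambda>_. 0" B] by blast
  then have C: "cmod (transpose_rem a N' x p) * weight p ^ B \<le> C" for p
    by (simp add: lat_diff_0 pos_le_divide_eq less_imp_neq[OF jbracket_pos, symmetric])
  let ?s = "\<lambda>p. \<Sum>\<alpha> | N \<le> mi_size \<alpha> \<and> mi_size \<alpha> < N'. taylor_coeff \<alpha> p * lat_diff \<alpha> (\<lambda>y. a y p) x"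
  have "rapid (\<lambda>p. 1 / of_nat (mi_fact \<alpha>) * (falling_fact \<alpha> p * lat_diff \<alpha> (\<lambda>y. a y p) x))" for \<alpha>
    by (intro rapid_cmult rapid_polyfun_mult[OF polyfun_falling_fact] rapid_lat_diff coeff_bounds_rapid[OF a])
  then have "rapid (\<lambda>p. taylor_coeff \<alpha> p * lat_diff \<alpha> (\<lambda>y. a y p) x)" for \<alpha>
    by (simp add: taylor_coeff_def)
  then have "rapid ?s" by (rule rapid_sum)
  then obtain D where D: "\<And>p. cmod (?s p) * weight p ^ B \<le> D" unfolding rapid_def by blast
  have "cmod (transpose_rem a N x p) * weight p ^ B \<le> C + D" for p
  proof -
    have "cmod (transpose_rem a N x p) * weight p ^ B \<le> (cmod (transpose_rem a N' x p) + cmod (?s p)) * weight p ^ B"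
      unfolding transpose_rem_split[OF N', of a x p] by (intro mult_right_mono norm_triangle_ineq) auto
    then show ?thesis using C[of p] D[of p] by (simp add: distrib_right)
  qed
  then show "\<exists>C. \<forall>p. cmod (transpose_rem a N x p) * weight p ^ B \<le> C" by blast
qed

lemma coeff_bounds_transpose_rem:
  fixes a :: "int ^ 'n::finite \<Rightarrow> int ^ 'n \<Rightarrow> complex"
  assumes h: "0 < h" "h \<le> 1" and \<delta>\<rho>: "0 \<le> \<delta>" "\<delta> < \<rho>" "\<rho> \<le> 1"
    and a: "coeff_bounds h \<mu> \<rho> \<delta> a"
  shows "coeff_bounds h (\<mu> - real N * (\<rho> - \<delta>)) \<rho> \<delta> (transpose_rem a N)"
proof -
  note ra = coeff_bounds_rapid[OF a] and rt = rapid_transpose_rem[OF h \<delta>\<rho> a]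
  have "\<exists>C. \<forall>x \<theta>. cmod (fourier_series (\<lambda>p. falling_fact \<beta> p * lat_diff \<gamma> (\<lambda>y. transpose_rem a N y p) x) \<theta>)
      \<le> C * jbracket h x powr (\<mu> - real N * (\<rho> - \<delta>) - \<rho> * real (mi_size \<gamma>) + \<delta> * real (mi_size \<beta>))" for \<beta> \<gamma>
  proof -
    define s where "s = \<mu> - real N * (\<rho> - \<delta>) - \<rho> * real (mi_size \<gamma>) + \<delta> * real (mi_size \<beta>)"
    let ?m = "2 * CARD('n)"
    \<comment> \<open>The decay in \<open>x\<close> is \<open>- \<bar>s\<bar>\<close>, which is at
      most \<open>s\<close> whatever its sign. Of the decay in \<open>p\<close>,
      \<open>mi_size \<beta>\<close> powers pay for the multiplier and \<open>?m\<close> make the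
      moduli summable.\<close>
    obtain N' C where N': "N \<le> N'" and "0 \<le> C"
      and C: "\<And>x p. cmod (lat_diff \<gamma> (\<lambda>x. transpose_rem a N' x p) x) \<le> C * jbracket h x powr (- \<bar>s\<bar>) / weight p ^ (mi_size \<beta> + ?m)"
      using transpose_rem_decay[OF h \<delta>\<rho> a abs_ge_zero[of s], of N \<gamma> "mi_size \<beta> + ?m"] by blast
    let ?A = "{\<alpha> :: 'n \<Rightarrow> nat. N \<le> mi_size \<alpha> \<and> mi_size \<alpha> < N'}"
    let ?g = "\<lambda>\<alpha> x p. falling_fact \<beta> p * (taylor_coeff \<alpha> p * lat_diff (\<lambda>j. \<gamma> j + \<alpha> j) (\<lambda>y. a y p) x)"
    have taylor_coeff_eq: "?g \<alpha> x = (\<lambda>p. 1 / of_nat (mi_fact \<alpha>) * ((falling_fact \<beta> p * falling_fact \<alpha> p) * lat_diff (\<lambda>j. \<gamma> j + \<alpha> j) (\<lambda>y. a y p) x))" for \<alpha> x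
      by (simp add: taylor_coeff_def fun_eq_iff)
    have rg: "rapid (?g \<alpha> x)" for \<alpha> x
      unfolding taylor_coeff_eq by (intro rapid_cmult rapid_polyfun_mult[OF polyfun_mult[OF polyfun_falling_fact polyfun_falling_fact]] rapid_lat_diff ra)
    have rh: "rapid (\<lambda>p. falling_fact \<beta> p * lat_diff \<gamma> (\<lambda>y. transpose_rem a N' y p) x)" for x
      by (intro rapid_polyfun_mult[OF polyfun_falling_fact] rapid_lat_diff rt)
    have split: "fourier_series (\<lambda>p. falling_fact \<beta> p * lat_diff \<gamma> (\<lambda>y. transpose_rem a N y p) x) \<theta> =
        fourier_series (\<lambda>p. falling_fact \<beta> p * lat_diff \<gamma> (\<lambda>y. transpose_rem a N' y p) x) \<theta> + (\<Sum>\<alpha>\<in>?A. fourier_series (?g \<alpha> x) \<theta>)" for x \<theta>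
    proof -
      have "falling_fact \<beta> p * lat_diff \<gamma> (\<lambda>y. transpose_rem a N y p) x =
          falling_fact \<beta> p * lat_diff \<gamma> (\<lambda>y. transpose_rem a N' y p) x + (\<Sum>\<alpha>\<in>?A. ?g \<alpha> x p)" for p
      proof -
        have "lat_diff \<gamma> (\<lambda>y. transpose_rem a N y p) x - lat_diff \<gamma> (\<lambda>y. transpose_rem a N' y p) x =
            (\<Sum>\<alpha>\<in>?A. taylor_coeff \<alpha> p * lat_diff (\<lambda>j. \<gamma> j + \<alpha> j) (\<lambda>y. a y p) x)"
          unfolding lat_diff_diff[symmetric] transpose_rem_split[OF N', of a] add_diff_cancel_left'
          by (simp add: lat_diff_sum lat_diff_cmult lat_diff_lat_diff)
        then show ?thesis
          unfolding diff_eq_eq by (simp only: distrib_left sum_distrib_left add.commute)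
      qed
      then show ?thesis by (simp add: fourier_series_add rh rapid_sum rg fourier_series_sum)
    qed
    obtain D where D: "\<And>p. cmod (falling_fact \<beta> p) \<le> D * weight p ^ mi_size \<beta>" using polyfun_growth[OF polyfun_falling_fact] by blast
    have D0: "0 \<le> D" using order_trans[OF norm_ge_zero D[of 0]] by (simp add: weight_def l1_def)
    define S where "S = (\<Sum>\<^sub>\<infinity>p::int ^ 'n. 1 / weight p ^ ?m)"
    have S0: "0 \<le> S" unfolding S_def by (intro infsum_nonneg) auto
    have 1: "cmod (fourier_series (\<lambda>p. falling_fact \<beta> p * lat_diff \<gamma> (\<lambda>y. transpose_rem a N' y p) x) \<theta>) \<le> D * C * S * jbracket h x powr s" for x \<theta>
    proof -
      let ?t = "D * C * jbracket h x powr (- \<bar>s\<bar>)"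
      have le: "cmod (falling_fact \<beta> p * lat_diff \<gamma> (\<lambda>y. transpose_rem a N' y p) x) \<le> ?t * (1 / weight p ^ ?m)" for p
      proof -
        have "cmod (falling_fact \<beta> p * lat_diff \<gamma> (\<lambda>y. transpose_rem a N' y p) x) \<le>
            (D * weight p ^ mi_size \<beta>) * (C * jbracket h x powr (- \<bar>s\<bar>) / weight p ^ (mi_size \<beta> + ?m))"
          unfolding norm_mult using D0 by (intro mult_mono D C) auto
        also have "\<dots> = ?t * (1 / weight p ^ ?m)" by (simp add: power_add)
        finally show ?thesis .
      qed
      have "cmod (fourier_series (\<lambda>p. falling_fact \<beta> p * lat_diff \<gamma> (\<lambda>y. transpose_rem a N' y p) x) \<theta>)
          \<le> (\<Sum>\<^sub>\<infinity>p. cmod (falling_fact \<beta> p * lat_diff \<gamma> (\<lambda>y. transpose_rem a N' y p) x))"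
        by (intro norm_fourier_series_le rapid_abs_summable rh)
      also have "\<dots> \<le> (\<Sum>\<^sub>\<infinity>p::int ^ 'n. ?t * (1 / weight p ^ ?m))"
        by (intro infsum_mono rapid_abs_summable rh summable_on_cmult_right summable_weight le)
      also have "\<dots> = ?t * S" unfolding S_def by (rule infsum_cmult_right')
      also have "\<dots> \<le> (D * C * jbracket h x powr s) * S"
        using D0 \<open>0 \<le> C\<close> S0 by (intro mult_right_mono mult_left_mono jbracket_powr_mono) auto
      finally show ?thesis by (simp add: mult_ac)
    qed
    have "\<exists>E. \<forall>x \<theta>. cmod (fourier_series (?g \<alpha> x) \<theta>) \<le> E * jbracket h x powr s" if "\<alpha> \<in> ?A" for \<alpha>
    proof -
      \<comment> \<open>A term of order \<open>\<alpha>\<close> gains \<open>\<rho>\<close> and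
        loses \<open>\<delta>\<close> for each unit of \<open>mi_size \<alpha>\<close>, so its
        exponent is at most \<open>s\<close> once \<open>mi_size \<alpha> \<ge> N\<close>.\<close>
      let ?r = "\<mu> - \<rho> * real (mi_size (\<lambda>j. \<gamma> j + \<alpha> j)) + \<delta> * real (mi_size \<beta> + mi_size \<alpha>)"
      obtain E where E: "\<And>x \<theta>. cmod (fourier_series (\<lambda>p. (falling_fact \<beta> p * falling_fact \<alpha> p) * lat_diff (\<lambda>j. \<gamma> j + \<alpha> j) (\<lambda>y. a y p) x) \<theta>) \<le> E * jbracket h x powr ?r"
        using coeff_bounds_polyfun[OF a \<delta>\<rho>(1) polyfun_mult[OF polyfun_falling_fact polyfun_falling_fact]] by blast
      have "real N * (\<rho> - \<delta>) \<le> real (mi_size \<alpha>) * (\<rho> - \<delta>)"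
        using that \<delta>\<rho> by (intro mult_right_mono) auto
      then have rs: "?r \<le> s" unfolding s_def by (simp add: mi_size_add algebra_simps)
      have "cmod (fourier_series (?g \<alpha> x) \<theta>) \<le> max 0 E * jbracket h x powr s" for x \<theta>
      proof -
        have "cmod (fourier_series (?g \<alpha> x) \<theta>) =
            cmod (1 / of_nat (mi_fact \<alpha>)) * cmod (fourier_series (\<lambda>p. (falling_fact \<beta> p * falling_fact \<alpha> p) * lat_diff (\<lambda>j. \<gamma> j + \<alpha> j) (\<lambda>y. a y p) x) \<theta>)"
          unfolding taylor_coeff_eq fourier_series_cmult norm_mult ..
        also have "\<dots> \<le> 1 * (E * jbracket h x powr ?r)"
          using mi_fact_pos[of \<alpha>] by (intro mult_mono E) (auto simp: norm_divide)
        also have "\<dots> \<le> max 0 E * jbracket h x powr s"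
          unfolding mult_1 using rs by (intro mult_mono jbracket_powr_mono) auto
        finally show ?thesis .
      qed
      then show ?thesis by blast
    qed
    then have "\<forall>\<alpha>\<in>?A. \<exists>E. \<forall>x \<theta>. cmod (fourier_series (?g \<alpha> x) \<theta>) \<le> E * jbracket h x powr s" by blast
    from bchoice[OF this] obtain E where
      "\<forall>\<alpha>\<in>?A. \<forall>x \<theta>. cmod (fourier_series (?g \<alpha> x) \<theta>) \<le> E \<alpha> * jbracket h x powr s" by blast
    then have E: "cmod (fourier_series (?g \<alpha> x) \<theta>) \<le> E \<alpha> * jbracket h x powr s" if "\<alpha> \<in> ?A" for \<alpha> x \<theta>
      using that by blast
    have "cmod (fourier_series (\<lambda>p. falling_fact \<beta> p * lat_diff \<gamma> (\<lambda>y. transpose_rem a N y p) x) \<theta>)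
        \<le> (D * C * S + (\<Sum>\<alpha>\<in>?A. E \<alpha>)) * jbracket h x powr s" for x \<theta>
    proof -
      have "cmod (\<Sum>\<alpha>\<in>?A. fourier_series (?g \<alpha> x) \<theta>) \<le> (\<Sum>\<alpha>\<in>?A. E \<alpha> * jbracket h x powr s)"
        by (intro sum_norm_le E)
      then show ?thesis unfolding split distrib_right sum_distrib_right
        by (intro norm_triangle_le add_mono 1)
    qed
    then show ?thesis unfolding s_def by blast
  qed
  then show ?thesis using rt by (simp add: coeff_bounds_def)
qed

subsection \<open>Operators as infinite matrices\<close>

lemma schwartz_rapid:
  fixes f :: "real ^ 'n::finite \<Rightarrow> complex"
  assumes h: "0 < h" "h \<le> 1" and f: "f \<in> schwartz h"
  shows "rapid (\<lambda>m. f (h *\<^sub>R emb m))"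
proof (rule rapidI)
  fix M
  let ?n = "real CARD('n)"
  have "bdd_above ((\<lambda>k. (1 + norm k) ^ M * cmod (f k)) ` hlattice h)"
    using f by (simp add: schwartz_def)
  then obtain C where C: "\<And>m. jbracket h m ^ M * cmod (f (h *\<^sub>R emb m)) \<le> C"
    unfolding bdd_above_def hlattice_eq jbracket_def by auto
  have n1: "1 \<le> ?n" by (simp add: Suc_leI)
  \<comment> \<open>The \<open>l1\<close> length is at most the dimension times the Euclidean norm;
    undoing the scaling costs \<open>1 / h\<close>.\<close>
  have weight: "weight m \<le> ?n / h * jbracket h m" for m :: "int ^ 'n"
  proof -
    have "real (l1 m) = (\<Sum>j\<in>UNIV. \<bar>emb m $ j\<bar>)" by (simp add: l1_def)
    also have "\<dots> \<le> (\<Sum>j\<in>(UNIV :: 'n set). norm (emb m))"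
      by (intro sum_mono component_le_norm_cart)
    finally have "h * real (l1 m) \<le> h * (?n * norm (emb m))"
      using h by (intro mult_left_mono) auto
    moreover have "h \<le> ?n" using h n1 by linarith
    moreover have "h * weight m = h + h * real (l1 m)" "?n * jbracket h m = ?n + h * (?n * norm (emb m))"
      using h by (simp_all add: weight_def jbracket_def algebra_simps)
    ultimately have "h * weight m \<le> ?n * jbracket h m" by linarith
    then show ?thesis using h by (simp add: field_simps)
  qed
  have "cmod (f (h *\<^sub>R emb m)) * weight m ^ M \<le> (?n / h) ^ M * C" for m
  proof -
    have "cmod (f (h *\<^sub>R emb m)) * weight m ^ M \<le> cmod (f (h *\<^sub>R emb m)) * (?n / h * jbracket h m) ^ M"
      by (intro mult_left_mono power_mono weight) auto
    also have "\<dots> = (?n / h) ^ M * (jbracket h m ^ M * cmod (f (h *\<^sub>R emb m)))"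
      by (simp only: power_mult_distrib mult_ac)
    also have "\<dots> \<le> (?n / h) ^ M * C" using h by (intro mult_left_mono C) auto
    finally show ?thesis .
  qed
  then show "\<exists>C. \<forall>m. cmod (f (h *\<^sub>R emb m)) * weight m ^ M \<le> C" by blast
qed

lemma infsum_hlattice: "h \<noteq> 0 \<Longrightarrow> (\<Sum>\<^sub>\<infinity>k\<in>hlattice h. g k) = (\<Sum>\<^sub>\<infinity>x. g (h *\<^sub>R emb x))"
  unfolding hlattice_eq by (subst infsum_reindex[OF inj_scaled_emb]) (simp_all add: o_def)

lemma summable_hlattice: "h \<noteq> 0 \<Longrightarrow> g summable_on hlattice h \<longleftrightarrow> (\<lambda>x. g (h *\<^sub>R emb x)) summable_on UNIV"
  unfolding hlattice_eq by (subst summable_on_reindex[OF inj_scaled_emb]) (simp_all add: o_def)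

lemma exp_eq_chi:
  assumes "h \<noteq> 0"
  shows "exp (2 * of_real pi * (\<i> / of_real h) * of_real ((h *\<^sub>R emb x) \<bullet> \<theta>)) = chi x \<theta>"
    "exp (- 2 * of_real pi * (\<i> / of_real h) * of_real ((h *\<^sub>R emb x) \<bullet> \<theta>)) = chi (- x) \<theta>"
  using assms by (simp_all add: chi_def cis_conv_exp emb_minus mult_ac)

text \<open>Only the series of \<open>f\<close> is expanded under the integral, dominated by the
  summable values of \<open>f\<close>. The symbol stays summed, and each integral is its Fourier
  coefficient at \<open>m - x\<close>, because \<open>chi x\<close> and \<open>chi (- m)\<close>
  combine to one character.\<close>

lemma semi_Op_eq_infsum:
  assumes h: "0 < h" "h \<le> 1" and c: "rapid (c x)" and \<sigma>: "\<sigma> (h *\<^sub>R emb x) = fourier_series (c x)"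
    and f: "f \<in> schwartz h"
  shows "semi_Op h \<sigma> f (h *\<^sub>R emb x) = (\<Sum>\<^sub>\<infinity>m. c x (m - x) * f (h *\<^sub>R emb m))"
proof -
  define F where "F m = f (h *\<^sub>R emb m)" for m
  have F: "rapid F" unfolding F_def by (rule schwartz_rapid[OF h f])
  have four: "semi_fourier h f = (\<lambda>\<theta>. \<Sum>\<^sub>\<infinity>m. chi (- m) \<theta> * F m)"
  proof
    have h0: "h \<noteq> 0" using h by simp
    show "semi_fourier h f \<theta> = (\<Sum>\<^sub>\<infinity>m. chi (- m) \<theta> * F m)" for \<theta>
      unfolding semi_fourier_def F_def by (simp only: infsum_hlattice[OF h0] exp_eq_chi(2)[OF h0])
  qed
  have "semi_fourier h f = fourier_series (\<lambda>m. F (- m))"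
  proof
    fix \<theta>
    have "semi_fourier h f \<theta> = fourier_series F (- \<theta>)" by (simp add: four fourier_series_def chi_uminus mult.commute)
    then show "semi_fourier h f \<theta> = fourier_series (\<lambda>m. F (- m)) \<theta>" by (simp add: fourier_series_reflect)
  qed
  then have cont: "continuous_on cube (semi_fourier h f)"
    by (simp add: continuous_fourier_series rapid_reflect F)
  define g where "g m \<theta> = F m * (chi (- (m - x)) \<theta> * fourier_series (c x) \<theta>)" for m \<theta>
  let ?u = "\<lambda>\<theta>. chi x \<theta> * fourier_series (c x) \<theta> * semi_fourier h f \<theta>"
  have u: "?u \<theta> = (\<Sum>\<^sub>\<infinity>m. g m \<theta>)" for \<theta>
  proof -
    have "chi x \<theta> * fourier_series (c x) \<theta> * (chi (- m) \<theta> * F m) = g m \<theta>" for m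
      using chi_mult[of x \<theta> "- m"] by (simp add: g_def mult_ac)
    then show ?thesis unfolding four infsum_cmult_right'[symmetric] by simp
  qed
  have "continuous_on cube ?u" by (intro continuous_intros continuous_fourier_series c cont)
  then have "set_integrable lborel cube ?u"
    unfolding set_integrable_def by (rule borel_integrable_compact[OF compact_cbox])
  then have "semi_Op h \<sigma> f (h *\<^sub>R emb x) = integral cube ?u"
    unfolding semi_Op_def \<sigma> exp_eq_chi(1)[OF less_imp_neq[OF h(1), symmetric]]
    by (rule set_borel_integral_eq_integral(2))
  moreover have "((\<lambda>m. integral cube (g m)) has_sum integral cube ?u) UNIV"
    unfolding u
  proof (rule has_sum_integral[where B = "\<lambda>m. cmod (F m) * (\<Sum>\<^sub>\<infinity>p. cmod (c x p))"])
    show "continuous_on cube (g m)" for m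
      unfolding g_def by (intro continuous_intros continuous_fourier_series c)
    show "cmod (g m \<theta>) \<le> cmod (F m) * (\<Sum>\<^sub>\<infinity>p. cmod (c x p))" for m \<theta>
      using norm_fourier_series_le[OF rapid_abs_summable[OF c]] by (simp add: g_def norm_mult mult_left_mono)
    show "(\<lambda>m. cmod (F m) * (\<Sum>\<^sub>\<infinity>p. cmod (c x p))) summable_on UNIV"
      by (intro summable_on_cmult_left rapid_abs_summable F)
  qed
  moreover have "integral cube (g m) = c x (m - x) * F m" for m
  proof -
    have "integral cube (g m) = F m * fourier_coeff (fourier_series (c x)) (m - x)"
      unfolding g_def fourier_coeff_def by (rule integral_mult_right)
    then show ?thesis by (simp add: fourier_coeff_fourier_series rapid_abs_summable c mult.commute)
  qed
  ultimately show ?thesis by (simp add: infsumI F_def)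
qed

lemma jbracket_le_weight: "0 < h \<Longrightarrow> h \<le> 1 \<Longrightarrow> jbracket h x \<le> weight x"
  using jbracket_peetre[of h 0 x] by (simp add: jbracket_def)

text \<open>Both sides are iterated sums of the same kernel \<open>K\<close>, so the claim is an
  interchange of summation, justified by absolute summability over pairs.\<close>

lemma semi_Op_transpose:
  fixes c b :: "int ^ 'n::finite \<Rightarrow> int ^ 'n \<Rightarrow> complex"
  assumes h: "0 < h" "h \<le> 1" and \<delta>: "0 \<le> \<delta>" and c: "coeff_bounds h \<mu> \<rho> \<delta> c"
    and \<sigma>: "\<And>x. \<sigma> (h *\<^sub>R emb x) = fourier_series (c x)" and b: "\<And>x. rapid (b x)" "\<And>x p. b x p = c (x + p) (- p)"
    and \<sigma>t: "\<And>x. \<sigma>t (h *\<^sub>R emb x) = fourier_series (b x)"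
  shows "is_transpose h (semi_Op h \<sigma>) (semi_Op h \<sigma>t)"
  unfolding is_transpose_def
proof (intro ballI)
  fix f g :: "real ^ 'n \<Rightarrow> complex"
  assume f: "f \<in> schwartz h" and g: "g \<in> schwartz h"
  define F G where "F m = f (h *\<^sub>R emb m)" and "G m = g (h *\<^sub>R emb m)" for m
  have F: "rapid F" and G: "rapid G"
    unfolding F_def[abs_def] G_def[abs_def] by (intro schwartz_rapid h f g)+
  define K where "K x m = c m (x - m) * F m * G x" for x m
  have T: "semi_Op h \<sigma> g (h *\<^sub>R emb m) = (\<Sum>\<^sub>\<infinity>x. c m (x - m) * G x)" for m
    unfolding G_def
    by (rule semi_Op_eq_infsum[where c = c and x = m and \<sigma> = \<sigma>, OF h coeff_bounds_rapid[OF c] \<sigma> g])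
  have Tt: "semi_Op h \<sigma>t f (h *\<^sub>R emb x) = (\<Sum>\<^sub>\<infinity>m. c m (x - m) * F m)" for x
    unfolding F_def using semi_Op_eq_infsum[where c = b and x = x and \<sigma> = \<sigma>t, OF h b(1) \<sigma>t f] by (simp add: b(2))
  obtain C where C: "0 \<le> C" "\<And>m p. cmod (lat_diff (\<lambda>_. 0) (\<lambda>y. c y p) m) * weight p ^ 0
      \<le> C * jbracket h m powr (\<mu> - \<rho> * real (mi_size (\<lambda>_ :: 'n. 0)) + \<delta> * real 0)"
    using coeff_decay[OF c \<delta>] by blast
  define k where "k = nat \<lceil>\<bar>\<mu>\<bar>\<rceil>"
  \<comment> \<open>The entries grow at most polynomially in \<open>m\<close>, uniformly in
    \<open>p\<close>; the rapid decay of \<open>F\<close> absorbs this, and that of \<open>G\<close>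
    handles the other variable.\<close>
  have bd: "cmod (c m p) \<le> C * weight m ^ k" for m p
  proof -
    have "cmod (c m p) \<le> C * jbracket h m powr \<mu>" using C(2)[of p m] by (simp add: lat_diff_0)
    also have "jbracket h m powr \<mu> \<le> jbracket h m powr real k"
      unfolding k_def by (intro jbracket_powr_mono) linarith
    also have "jbracket h m powr real k \<le> weight m powr real k" by (intro powr_mono2 jbracket_le_weight h) auto
    also have "\<dots> = weight m ^ k" by (simp add: powr_realpow)
    finally show ?thesis using C(1) by (simp add: mult_left_mono)
  qed
  have r: "rapid (\<lambda>m. of_real (weight m ^ k) * F m)"
    by (rule rapid_mult_growth[OF F, where D = 1 and m = k]) (simp add: norm_power)
  have S1: "(\<lambda>m. C * cmod (of_real (weight m ^ k) * F m)) summable_on UNIV"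
    by (intro summable_on_cmult_right rapid_abs_summable r)
  have "(\<lambda>(x, m). cmod (G x) * (C * cmod (of_real (weight m ^ k) * F m))) summable_on UNIV \<times> UNIV"
  proof (rule summable_on_SigmaI)
    show "((\<lambda>m. case (x, m) of (x, m) \<Rightarrow> cmod (G x) * (C * cmod (of_real (weight m ^ k) * F m))) has_sum
        cmod (G x) * (\<Sum>\<^sub>\<infinity>m. C * cmod (of_real (weight m ^ k) * F m))) UNIV" for x
      unfolding prod.case by (intro has_sum_cmult_right has_sum_infsum S1)
    show "(\<lambda>x. cmod (G x) * (\<Sum>\<^sub>\<infinity>m. C * cmod (of_real (weight m ^ k) * F m))) summable_on UNIV"
      by (intro summable_on_cmult_left rapid_abs_summable G)
  qed (use C(1) in auto)
  then have "(\<lambda>z. cmod (case z of (x, m) \<Rightarrow> K x m)) summable_on UNIV \<times> UNIV"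
  proof (rule Infinite_Sum.abs_summable_on_comparison_test')
    fix z :: "(int ^ 'n) \<times> (int ^ 'n)"
    obtain x m where z: "z = (x, m)" by (cases z)
    have "cmod (K x m) \<le> (C * weight m ^ k) * cmod (F m) * cmod (G x)"
      unfolding K_def norm_mult by (intro mult_right_mono bd) auto
    then show "cmod (case z of (x, m) \<Rightarrow> K x m) \<le>
        (case z of (x, m) \<Rightarrow> cmod (G x) * (C * cmod (of_real (weight m ^ k) * F m)))"
      by (simp add: z norm_mult norm_power mult_ac)
  qed
  then have K: "(\<lambda>(x, m). K x m) summable_on UNIV \<times> UNIV" by (rule abs_summable_summable)
  then have K': "(\<lambda>(m, x). K x m) summable_on UNIV \<times> UNIV"
    by (subst (asm) summable_on_swap) (simp add: split_def)
  have L: "semi_Op h \<sigma>t f (h *\<^sub>R emb x) * g (h *\<^sub>R emb x) = (\<Sum>\<^sub>\<infinity>m. K x m)" for x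
    unfolding Tt K_def infsum_cmult_left' G_def ..
  have R: "f (h *\<^sub>R emb m) * semi_Op h \<sigma> g (h *\<^sub>R emb m) = (\<Sum>\<^sub>\<infinity>x. K x m)" for m
  proof -
    have "(\<Sum>\<^sub>\<infinity>x. K x m) = (\<Sum>\<^sub>\<infinity>x. F m * (c m (x - m) * G x))" by (simp add: K_def mult_ac)
    then show ?thesis unfolding T by (simp add: infsum_cmult_right' F_def)
  qed
  have "h \<noteq> 0" using h by simp
  then show "(\<lambda>k. semi_Op h \<sigma>t f k * g k) summable_on hlattice h \<and>
      (\<lambda>k. f k * semi_Op h \<sigma> g k) summable_on hlattice h \<and>
      (\<Sum>\<^sub>\<infinity>k\<in>hlattice h. semi_Op h \<sigma>t f k * g k) = (\<Sum>\<^sub>\<infinity>k\<in>hlattice h. f k * semi_Op h \<sigma> g k)"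
    using summable_on_Sigma_banach[OF K] summable_on_Sigma_banach[OF K'] infsum_swap_banach[OF K]
    by (simp add: summable_hlattice infsum_hlattice L R)
qed

section \<open>The transposed symbol and its expansion\<close>

text \<open>The powers of \<open>h\<close> from the toroidal operator and from the differences
  cancel, which leaves precisely a term of the discrete Taylor expansion.\<close>

lemma expansion_term_fourier_series:
  assumes h: "0 < h" and a: "\<And>x. rapid (a x)" and \<tau>: "\<And>x. \<tau> (h *\<^sub>R emb x) = fourier_series (a x)"
  shows "1 / of_nat (mi_fact \<alpha>) * diff_op h \<alpha> (\<lambda>l. tor_op h \<alpha> (\<tau> l) \<theta>) (h *\<^sub>R emb x) =
    fourier_series (\<lambda>p. taylor_coeff \<alpha> p * lat_diff \<alpha> (\<lambda>y. a y p) x) \<theta>"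
proof -
  have "diff_op h \<alpha> (\<lambda>l. tor_op h \<alpha> (\<tau> l) \<theta>) (h *\<^sub>R emb x) =
      lat_diff \<alpha> (\<lambda>y. of_real (h ^ mi_size \<alpha>) * fourier_series (\<lambda>p. falling_fact \<alpha> p * a y p) \<theta>) x / of_real (h ^ mi_size \<alpha>)"
    by (simp add: diff_op_lat_diff \<tau> tor_op_fourier_series(2)[OF a])
  also have "\<dots> = lat_diff \<alpha> (\<lambda>y. fourier_series (\<lambda>p. falling_fact \<alpha> p * a y p) \<theta>) x"
    using h by (simp add: lat_diff_cmult)
  also have "\<dots> = fourier_series (\<lambda>p. falling_fact \<alpha> p * lat_diff \<alpha> (\<lambda>y. a y p) x) \<theta>"
    by (simp add: lat_diff_fourier_series tor_op_fourier_series(1)[OF a] lat_diff_cmult)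
  also have "1 / of_nat (mi_fact \<alpha>) * \<dots> = fourier_series (\<lambda>p. taylor_coeff \<alpha> p * lat_diff \<alpha> (\<lambda>y. a y p) x) \<theta>"
    unfolding fourier_series_cmult[symmetric] by (simp add: taylor_coeff_def)
  finally show ?thesis .
qed

theorem theorem4p3:
  fixes h \<mu> \<rho> \<delta> :: real
    and \<sigma> :: "real ^ 'n::finite \<Rightarrow> real ^ 'n \<Rightarrow> complex"
  assumes "0 < h" and "h \<le> 1"
    and "0 \<le> \<delta>" and "\<delta> < \<rho>" and "\<rho> \<le> 1"
    and "\<sigma> \<in> symbol_class h \<mu> \<rho> \<delta>"
  shows "\<exists>\<sigma>t \<in> symbol_class h \<mu> \<rho> \<delta>.
    is_transpose h (semi_Op h \<sigma>) (semi_Op h \<sigma>t) \<and>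
    (\<forall>N::nat.
      (\<lambda>k \<theta>. \<sigma>t k \<theta> -
         (\<Sum>\<alpha> | mi_size \<alpha> < N.
            1 / of_nat (mi_fact \<alpha>) *
            diff_op h \<alpha> (\<lambda>l. tor_op h \<alpha> (\<lambda>\<eta>. \<sigma> l (- \<eta>)) \<theta>) k))
      \<in> symbol_class h (\<mu> - real N * (\<rho> - \<delta>)) \<rho> \<delta>)"
proof -
  define c where "c x = fourier_coeff (\<sigma> (h *\<^sub>R emb x))" for x
  define a where "a x p = c x (- p)" for x p
  have c: "coeff_bounds h \<mu> \<rho> \<delta> c" and \<sigma>: "\<sigma> (h *\<^sub>R emb x) = fourier_series (c x)" for x
    unfolding c_def[abs_def] using coeff_boundsD[OF assms(1,6)] by simp_all
  have a: "coeff_bounds h \<mu> \<rho> \<delta> a"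
    unfolding a_def[abs_def] by (rule coeff_bounds_reflect[OF c assms(3)])
  have refl: "(\<lambda>\<eta>. \<sigma> (h *\<^sub>R emb x) (- \<eta>)) = fourier_series (a x)" for x
    by (simp add: \<sigma> fourier_series_reflect a_def[abs_def] fun_eq_iff)
  note rem = coeff_bounds_transpose_rem[OF assms(1-5) a]
  \<comment> \<open>On the lattice \<open>inv\<close> recovers the integer index of the point;
    elsewhere it gives an arbitrary index, and lattice values are all that enters the
    claims.\<close>
  define \<sigma>t where "\<sigma>t k = fourier_series (transpose_rem a 0 (inv (\<lambda>x. h *\<^sub>R emb x) k))" for k
  have \<sigma>t: "\<sigma>t (h *\<^sub>R emb x) = fourier_series (transpose_rem a 0 x)" for x
    using assms(1) by (simp add: \<sigma>t_def inv_f_f[OF inj_scaled_emb])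
  have expand: "(\<lambda>k \<theta>. \<sigma>t k \<theta> - (\<Sum>\<alpha> | mi_size \<alpha> < N. 1 / of_nat (mi_fact \<alpha>) *
      diff_op h \<alpha> (\<lambda>l. tor_op h \<alpha> (\<lambda>\<eta>. \<sigma> l (- \<eta>)) \<theta>) k))
      \<in> symbol_class h (\<mu> - real N * (\<rho> - \<delta>)) \<rho> \<delta>" for N
  proof (rule symbol_classI[OF assms(1) rem])
    fix x :: "int ^ 'n" and \<theta>
    let ?s = "\<lambda>\<alpha> p. taylor_coeff \<alpha> p * lat_diff \<alpha> (\<lambda>y. a y p) x"
    have "rapid (\<lambda>p. 1 / of_nat (mi_fact \<alpha>) * (falling_fact \<alpha> p * lat_diff \<alpha> (\<lambda>y. a y p) x))" for \<alpha>
      by (intro rapid_cmult rapid_polyfun_mult[OF polyfun_falling_fact] rapid_lat_diff coeff_bounds_rapid[OF a])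
    then have r: "rapid (?s \<alpha>)" for \<alpha> by (simp add: taylor_coeff_def)
    have "fourier_series (transpose_rem a N x) \<theta> =
        fourier_series (\<lambda>p. transpose_rem a 0 x p - (\<Sum>\<alpha> | mi_size \<alpha> < N. ?s \<alpha> p)) \<theta>"
      by (simp add: transpose_rem_def[abs_def])
    also have "\<dots> = fourier_series (transpose_rem a 0 x) \<theta> - (\<Sum>\<alpha> | mi_size \<alpha> < N. fourier_series (?s \<alpha>) \<theta>)"
      by (simp add: fourier_series_diff coeff_bounds_rapid[OF rem] rapid_sum r fourier_series_sum)
    finally show "\<sigma>t (h *\<^sub>R emb x) \<theta> - (\<Sum>\<alpha> | mi_size \<alpha> < N. 1 / of_nat (mi_fact \<alpha>) *
        diff_op h \<alpha> (\<lambda>l. tor_op h \<alpha> (\<lambda>\<eta>. \<sigma> l (- \<eta>)) \<theta>) (h *\<^sub>R emb x)) =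
        fourier_series (transpose_rem a N x) \<theta>"
      unfolding \<sigma>t expansion_term_fourier_series[where \<tau> = "\<lambda>l \<eta>. \<sigma> l (- \<eta>)", OF assms(1) coeff_bounds_rapid[OF a] refl]
      by simp
  qed
  \<comment> \<open>The remainder of order 0, whose class has order \<open>\<mu>\<close>.\<close>
  have "\<sigma>t \<in> symbol_class h \<mu> \<rho> \<delta>"
    using symbol_classI[where \<sigma> = \<sigma>t, OF assms(1) rem[of 0]] \<sigma>t by simp
  moreover have "is_transpose h (semi_Op h \<sigma>) (semi_Op h \<sigma>t)"
  proof (rule semi_Op_transpose[OF assms(1-3) c])
    show "\<sigma> (h *\<^sub>R emb x) = fourier_series (c x)" "\<sigma>t (h *\<^sub>R emb x) = fourier_series (transpose_rem a 0 x)"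
      "rapid (transpose_rem a 0 x)" "transpose_rem a 0 x p = c (x + p) (- p)" for x p
      by (simp_all add: \<sigma> \<sigma>t coeff_bounds_rapid[OF rem] transpose_rem_def a_def)
  qed
  ultimately show ?thesis using expand by blast
qed

end
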